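(* Let $\mathcal{C}$ be an additive category with an automorphism $\Sigma$, let $n\ge3$, and let $\mathscr{N}$ be a collection of $n$-$\Sigma$-sequences in $\mathcal{C}$ satisfying the axioms (N1), (N2), (N3) and (N4* ). Then $\mathscr{N}$ also satisfies (N4).
   Context: $\mathcal{C}$ is an additive category, $\Sigma$ an automorphism of $\mathcal{C}$, $n\ge3$. An $n$-$\Sigma$-sequence is a diagram $A_1\xrightarrow{\alpha_1}A_2\to\cdots\xrightarrow{\alpha_{n-1}}A_n\xrightarrow{\alpha_n}\Sigma A_1$; its left rotation is $A_2\xrightarrow{\alpha_2}\cdots\xrightarrow{\alpha_n}\Sigma A_1\xrightarrow{(-1)^n\Sigma\alpha_1}\Sigma A_2$. A morphism $(\varphi_1,\dots,\varphi_n)\colon A_\bullet\to B_\bullet$ consists of $\varphi_i\colon A_i\to B_i$ with $\varphi_{i+1}\alpha_i=\beta_i\varphi_i$ ($1\le i\le n-1$) and $\Sigma\varphi_1\alpha_n=\beta_n\varphi_n$; isomorphisms have all $\varphi_i$ invertible. Direct sums are termwise; $A_\bullet$ is a direct summand of $B_\bullet$ if there are morphisms $\varphi\colon A_\bullet\to B_\bullet$, $\psi\colon B_\bullet\to A_\bullet$ with $\psi_i\varphi_i=1$. The mapping cone of $(\varphi_1,\dots,\varphi_n)$ is $A_2\oplus B_1\xrightarrow{\left[\begin{smallmatrix}-\alpha_2&0\\ \varphi_2&\beta_1\end{smallmatrix}\right]}A_3\oplus B_2\to\cdots\xrightarrow{\left[\begin{smallmatrix}-\alpha_n&0\\ \varphi_n&\beta_{n-1}\end{smallmatrix}\right]}\Sigma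 A_1\oplus B_n\xrightarrow{\left[\begin{smallmatrix}-\Sigma\alpha_1&0\\ \Sigma\varphi_1&\beta_n\end{smallmatrix}\right]}\Sigma A_2\oplus\Sigma B_1$ (the map $A_k\oplus B_{k-1}\to A_{k+1}\oplus B_k$ being $\left[\begin{smallmatrix}-\alpha_k&0\\ \varphi_k&\beta_{k-1}\end{smallmatrix}\right]$). Sequences in $\mathscr{N}$ are called $n$-angles. Axioms: (N1)(a) $\mathscr{N}$ is closed under direct sums, direct summands and isomorphisms; (b) $A\xrightarrow{1}A\to0\to\cdots\to0\to\Sigma A$ is in $\mathscr{N}$ for every $A$; (c) every morphism $A_1\to A_2$ is the first morphism of some sequence in $\mathscr{N}$. (N2) a sequence is in $\mathscr{N}$ iff its left rotation is. (N3) given $A_\bullet,B_\bullet\in\mathscr{N}$ and $\varphi_1,\varphi_2$ with $\varphi_2\alpha_1=\beta_1\varphi_1$, there exist $\varphi_3,\dots,\varphi_n$ making $(\varphi_1,\dots,\varphi_n)$ a morphism. (N4) in the situation of (N3), $\varphi_3,\dots,\varphi_n$ can be chosen so that the mapping cone is in $\mathscr{N}$. (N4* ): Suppose given $n$-angles $A_1\xrightarrow{\alpha_1}A_2\xrightarrow{\alpha_2}\cdots\xrightarrow{\alpha_n}\Sigma A_1$, $A_1\xrightarrow{\beta_1}B_2\xrightarrow{\beta_2}B_3\to\cdots\xrightarrow{\beta_n}\Sigma A_1$ and $A_2\xrightarrow{\varphi_2}B_2\xrightarrow{\gamma_2}C_3\xrightarrow{\gamma_3}\cdots\xrightarrow{\gamma_{n-1}}C_n\xrightarrow{\gamma_n}\Sigma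 A_2$ with $\varphi_2\alpha_1=\beta_1$. Then there exist morphisms $\varphi_i\colon A_i\to B_i$ ($3\le i\le n$) and $\psi_j$ ($1\le j\le 2n-5$) such that (1) $(1_{A_1},\varphi_2,\dots,\varphi_n)$ is a morphism of $n$-$\Sigma$-sequences; (2) $\gamma_n\circ\psi_{2n-5}=\Sigma\alpha_1\circ\beta_n$, and the following $n$-$\Sigma$-sequence $D_1\xrightarrow{d_1}D_2\to\cdots\to D_n\xrightarrow{d_n}\Sigma D_1$ is in $\mathscr{N}$. Set $A_i=B_i=C_i=0$ for $i>n$ and $C_i=0$ for $i\le2$; let $D_1=A_3$ and $D_{k+1}=A_{k+3}\oplus B_{k+2}\oplus C_{k+1}$ for $1\le k\le n-1$ (so $D_2=A_4\oplus B_3$, $D_n=C_n$); $d_1=\left[\begin{smallmatrix}\alpha_3\\ \varphi_3\end{smallmatrix}\right]$; for $1\le k\le n-2$, $d_{k+1}\colon D_{k+1}\to D_{k+2}$ is the matrix $\left[\begin{smallmatrix}-\alpha_{k+3}&0&0\\ (-1)^{k+1}\varphi_{k+3}&-\beta_{k+2}&0\\ \psi_{2k}&\psi_{2k-1}&\gamma_{k+1}\end{smallmatrix}\right]$ with the rows and columns belonging to zero summands deleted (so $d_2=\left[\begin{smallmatrix}-\alpha_4&0\\ \varphi_4&-\beta_3\\ \psi_2&\psi_1\end{smallmatrix}\right]$, the map $A_n\oplus B_{n-1}\oplus C_{n-2}\to B_n\oplus C_{n-1}$ is $\left[\begin{smallmatrix}(-1)^n\varphi_n&-\beta_{n-1}&0\\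 \psi_{2n-6}&\psi_{2n-7}&\gamma_{n-2}\end{smallmatrix}\right]$, and the map $B_n\oplus C_{n-1}\to C_n$ is $[\psi_{2n-5}\ \gamma_{n-1}]$); and $d_n=\Sigma\alpha_2\circ\gamma_n\colon C_n\to\Sigma A_3$. (For $n=3$ this sequence is $A_3\xrightarrow{\varphi_3}B_3\xrightarrow{\psi_1}C_3\xrightarrow{\Sigma\alpha_2\circ\gamma_3}\Sigma A_3$.) *)

theory Defs
  imports Main
begin

text \<open>A (small-style) category presented by its object set, hom-sets, composition
  (cmp g f = g after f) and identities; additive structure on each hom-set.\<close>

record ('o, 'm) addcat =
  Ob  :: "'o set"
  Hom :: "'o \<Rightarrow> 'o \<Rightarrow> 'm set"
  cmp :: "'m \<Rightarrow> 'm \<Rightarrow> 'm"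
  idm :: "'o \<Rightarrow> 'm"
  add :: "'m \<Rightarrow> 'm \<Rightarrow> 'm"
  zer :: "'o \<Rightarrow> 'o \<Rightarrow> 'm"
  neg :: "'m \<Rightarrow> 'm"

definition is_category :: "('o,'m) addcat \<Rightarrow> bool" where
  "is_category C \<longleftrightarrow>
     (\<forall>A\<in>Ob C. \<forall>B\<in>Ob C. \<forall>D\<in>Ob C. \<forall>f\<in>Hom C A B. \<forall>g\<in>Hom C B D.
        cmp C g f \<in> Hom C A D) \<and>
     (\<forall>A\<in>Ob C. \<forall>B\<in>Ob C. \<forall>D\<in>Ob C. \<forall>E\<in>Ob C.
        \<forall>f\<in>Hom C A B. \<forall>g\<in>Hom C B D. \<forall>h\<in>Hom C D E.
        cmp C h (cmp C g f) = cmp C (cmp C h g) f) \<and>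
     (\<forall>A\<in>Ob C. idm C A \<in> Hom C A A) \<and>
     (\<forall>A\<in>Ob C. \<forall>B\<in>Ob C. \<forall>f\<in>Hom C A B.
        cmp C f (idm C A) = f \<and> cmp C (idm C B) f = f)"

definition is_preadditive :: "('o,'m) addcat \<Rightarrow> bool" where
  "is_preadditive C \<longleftrightarrow> is_category C \<and>
     (\<forall>A\<in>Ob C. \<forall>B\<in>Ob C.
        zer C A B \<in> Hom C A B \<and>
        (\<forall>f\<in>Hom C A B. \<forall>g\<in>Hom C A B. add C f g \<in> Hom C A B) \<and>
        (\<forall>f\<in>Hom C A B. neg C f \<in> Hom C A B) \<and>
        (\<forall>f\<in>Hom C A B. \<forall>g\<in>Hom C A B. \<forall>h\<in>Hom C A B.
            add C (add C f g) h = add C f (add C g h)) \<and>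
        (\<forall>f\<in>Hom C A B. \<forall>g\<in>Hom C A B. add C f g = add C g f) \<and>
        (\<forall>f\<in>Hom C A B. add C (zer C A B) f = f) \<and>
        (\<forall>f\<in>Hom C A B. add C f (neg C f) = zer C A B)) \<and>
     (\<forall>A\<in>Ob C. \<forall>B\<in>Ob C. \<forall>D\<in>Ob C. \<forall>f\<in>Hom C A B. \<forall>f'\<in>Hom C A B. \<forall>g\<in>Hom C B D.
        cmp C g (add C f f') = add C (cmp C g f) (cmp C g f')) \<and>
     (\<forall>A\<in>Ob C. \<forall>B\<in>Ob C. \<forall>D\<in>Ob C. \<forall>f\<in>Hom C A B. \<forall>g\<in>Hom C B D. \<forall>g'\<in>Hom C B D.
        cmp C (add C g g') f = add C (cmp C g f) (cmp C g' f))"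

definition is_zero_obj :: "('o,'m) addcat \<Rightarrow> 'o \<Rightarrow> bool" where
  "is_zero_obj C Z \<longleftrightarrow> Z \<in> Ob C \<and>
     (\<forall>X\<in>Ob C. (\<exists>!f. f \<in> Hom C X Z) \<and> (\<exists>!f. f \<in> Hom C Z X))"

definition is_biproduct ::
  "('o,'m) addcat \<Rightarrow> 'o \<Rightarrow> 'o \<Rightarrow> 'o \<Rightarrow> 'm \<Rightarrow> 'm \<Rightarrow> 'm \<Rightarrow> 'm \<Rightarrow> bool" where
  "is_biproduct C A B S i1 i2 p1 p2 \<longleftrightarrow> S \<in> Ob C \<and>
     i1 \<in> Hom C A S \<and> i2 \<in> Hom C B S \<and> p1 \<in> Hom C S A \<and> p2 \<in> Hom C S B \<and>
     cmp C p1 i1 = idm C A \<and> cmp C p2 i2 = idm C B \<and>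
     cmp C p1 i2 = zer C B A \<and> cmp C p2 i1 = zer C A B \<and>
     add C (cmp C i1 p1) (cmp C i2 p2) = idm C S"

definition additive_category :: "('o,'m) addcat \<Rightarrow> bool" where
  "additive_category C \<longleftrightarrow> is_preadditive C \<and> (\<exists>Z. is_zero_obj C Z) \<and>
     (\<forall>A\<in>Ob C. \<forall>B\<in>Ob C. \<exists>S i1 i2 p1 p2. is_biproduct C A B S i1 i2 p1 p2)"

text \<open>An automorphism of the category: a functor with an inverse functor, i.e. a functor
  bijective on objects and on every hom-set.\<close>

definition is_automorphism :: "('o,'m) addcat \<Rightarrow> ('o \<Rightarrow> 'o) \<Rightarrow> ('m \<Rightarrow> 'm) \<Rightarrow> bool" where
  "is_automorphism C SO SM \<longleftrightarrow>
     bij_betw SO (Ob C) (Ob C) \<and>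
     (\<forall>A\<in>Ob C. \<forall>B\<in>Ob C. bij_betw SM (Hom C A B) (Hom C (SO A) (SO B))) \<and>
     (\<forall>A\<in>Ob C. SM (idm C A) = idm C (SO A)) \<and>
     (\<forall>A\<in>Ob C. \<forall>B\<in>Ob C. \<forall>D\<in>Ob C. \<forall>f\<in>Hom C A B. \<forall>g\<in>Hom C B D.
        SM (cmp C g f) = cmp C (SM g) (SM f))"

definition zobj :: "('o,'m) addcat \<Rightarrow> 'o" where
  "zobj C = (SOME Z. is_zero_obj C Z)"

definition bpd :: "('o,'m) addcat \<Rightarrow> 'o \<Rightarrow> 'o \<Rightarrow> 'o \<times> 'm \<times> 'm \<times> 'm \<times> 'm" where
  "bpd C A B = (SOME t. case t of (S, i1, i2, p1, p2) \<Rightarrow> is_biproduct C A B S i1 i2 p1 p2)"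

definition bpO :: "('o,'m) addcat \<Rightarrow> 'o \<Rightarrow> 'o \<Rightarrow> 'o" where
  "bpO C A B = (case bpd C A B of (S, i1, i2, p1, p2) \<Rightarrow> S)"
definition bpI1 :: "('o,'m) addcat \<Rightarrow> 'o \<Rightarrow> 'o \<Rightarrow> 'm" where
  "bpI1 C A B = (case bpd C A B of (S, i1, i2, p1, p2) \<Rightarrow> i1)"
definition bpI2 :: "('o,'m) addcat \<Rightarrow> 'o \<Rightarrow> 'o \<Rightarrow> 'm" where
  "bpI2 C A B = (case bpd C A B of (S, i1, i2, p1, p2) \<Rightarrow> i2)"
definition bpP1 :: "('o,'m) addcat \<Rightarrow> 'o \<Rightarrow> 'o \<Rightarrow> 'm" where
  "bpP1 C A B = (case bpd C A B of (S, i1, i2, p1, p2) \<Rightarrow> p1)"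
definition bpP2 :: "('o,'m) addcat \<Rightarrow> 'o \<Rightarrow> 'o \<Rightarrow> 'm" where
  "bpP2 C A B = (case bpd C A B of (S, i1, i2, p1, p2) \<Rightarrow> p2)"

text \<open>Direct sum of a (nonempty) list of objects; a singleton list gives the object itself,
  so that summands which are deleted simply do not appear in the list.\<close>

fun lsum :: "('o,'m) addcat \<Rightarrow> 'o list \<Rightarrow> 'o" where
  "lsum C [] = zobj C"
| "lsum C [X] = X"
| "lsum C (X # Y # xs) = bpO C X (lsum C (Y # xs))"

fun linj :: "('o,'m) addcat \<Rightarrow> 'o list \<Rightarrow> nat \<Rightarrow> 'm" where
  "linj C [] i = zer C (zobj C) (zobj C)"
| "linj C [X] i = idm C X"
| "linj C (X # Y # xs) 0 = bpI1 C X (lsum C (Y # xs))"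
| "linj C (X # Y # xs) (Suc i) = cmp C (bpI2 C X (lsum C (Y # xs))) (linj C (Y # xs) i)"

fun lproj :: "('o,'m) addcat \<Rightarrow> 'o list \<Rightarrow> nat \<Rightarrow> 'm" where
  "lproj C [] i = zer C (zobj C) (zobj C)"
| "lproj C [X] i = idm C X"
| "lproj C (X # Y # xs) 0 = bpP1 C X (lsum C (Y # xs))"
| "lproj C (X # Y # xs) (Suc i) = cmp C (lproj C (Y # xs) i) (bpP2 C X (lsum C (Y # xs)))"

fun msum :: "('o,'m) addcat \<Rightarrow> 'o \<Rightarrow> 'o \<Rightarrow> 'm list \<Rightarrow> 'm" where
  "msum C S T [] = zer C S T"
| "msum C S T (f # fs) = add C f (msum C S T fs)"

text \<open>General matrix morphism S -> T, given injections into T (m of them), projections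
  out of S (k of them) and entries M i j (row i = target summand, column j = source summand).\<close>

definition matg :: "('o,'m) addcat \<Rightarrow> 'o \<Rightarrow> 'o \<Rightarrow> (nat \<Rightarrow> 'm) \<Rightarrow> (nat \<Rightarrow> 'm)
    \<Rightarrow> (nat \<Rightarrow> nat \<Rightarrow> 'm) \<Rightarrow> nat \<Rightarrow> nat \<Rightarrow> 'm" where
  "matg C S T ins prs M m k =
     msum C S T [cmp C (ins i) (cmp C (M i j) (prs j)). i \<leftarrow> [0..<m], j \<leftarrow> [0..<k]]"

definition mat :: "('o,'m) addcat \<Rightarrow> 'o list \<Rightarrow> 'o list \<Rightarrow> (nat \<Rightarrow> nat \<Rightarrow> 'm) \<Rightarrow> 'm" where
  "mat C xs ys M = matg C (lsum C xs) (lsum C ys) (linj C ys) (lproj C xs) M (length ys) (length xs)"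

text \<open>Matrix morphism lsum xs -> Sigma (lsum ys), where Sigma(lsum ys) is regarded as the
  direct sum of the Sigma ys!i via the injections Sigma (linj ys i).\<close>
definition matS :: "('o,'m) addcat \<Rightarrow> ('o \<Rightarrow> 'o) \<Rightarrow> ('m \<Rightarrow> 'm) \<Rightarrow> 'o list \<Rightarrow> 'o list
    \<Rightarrow> (nat \<Rightarrow> nat \<Rightarrow> 'm) \<Rightarrow> 'm" where
  "matS C SO SM xs ys M =
     matg C (lsum C xs) (SO (lsum C ys)) (\<lambda>i. SM (linj C ys i)) (lproj C xs) M (length ys) (length xs)"

definition sgnm :: "('o,'m) addcat \<Rightarrow> nat \<Rightarrow> 'm \<Rightarrow> 'm" where
  "sgnm C k f = (if even k then f else neg C f)"

text \<open>An n-Sigma-sequence is a pair (X, a): objects X 1, ..., X n and morphisms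
  a i : X i -> X (i+1) (1 <= i < n), a n : X n -> Sigma (X 1). Values at other indices
  are irrelevant.\<close>

type_synonym ('o,'m) nseq = "(nat \<Rightarrow> 'o) \<times> (nat \<Rightarrow> 'm)"

definition is_seq :: "('o,'m) addcat \<Rightarrow> ('o \<Rightarrow> 'o) \<Rightarrow> nat \<Rightarrow> ('o,'m) nseq \<Rightarrow> bool" where
  "is_seq C SO n S \<longleftrightarrow> (case S of (X, a) \<Rightarrow>
     (\<forall>i. 1 \<le> i \<and> i \<le> n \<longrightarrow> X i \<in> Ob C) \<and>
     (\<forall>i. 1 \<le> i \<and> i < n \<longrightarrow> a i \<in> Hom C (X i) (X (Suc i))) \<and>
     a n \<in> Hom C (X n) (SO (X 1)))"

definition rotl :: "('o,'m) addcat \<Rightarrow> ('o \<Rightarrow> 'o) \<Rightarrow> ('m \<Rightarrow> 'm) \<Rightarrow> nat \<Rightarrow> ('o,'m) nseq \<Rightarrow> ('o,'m) nseq" where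
  "rotl C SO SM n S = (case S of (X, a) \<Rightarrow>
     (\<lambda>i. if i < n then X (Suc i) else SO (X 1),
      \<lambda>i. if i < n then a (Suc i) else sgnm C n (SM (a 1))))"

definition seq_mor :: "('o,'m) addcat \<Rightarrow> ('o \<Rightarrow> 'o) \<Rightarrow> ('m \<Rightarrow> 'm) \<Rightarrow> nat
    \<Rightarrow> ('o,'m) nseq \<Rightarrow> ('o,'m) nseq \<Rightarrow> (nat \<Rightarrow> 'm) \<Rightarrow> bool" where
  "seq_mor C SO SM n S T phi \<longleftrightarrow> (case S of (X, a) \<Rightarrow> case T of (Y, b) \<Rightarrow>
     (\<forall>i. 1 \<le> i \<and> i \<le> n \<longrightarrow> phi i \<in> Hom C (X i) (Y i)) \<and>
     (\<forall>i. 1 \<le> i \<and> i < n \<longrightarrow> cmp C (phi (Suc i)) (a i) = cmp C (b i) (phi i)) \<and>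
     cmp C (SM (phi 1)) (a n) = cmp C (b n) (phi n))"

definition is_iso :: "('o,'m) addcat \<Rightarrow> 'o \<Rightarrow> 'o \<Rightarrow> 'm \<Rightarrow> bool" where
  "is_iso C A B f \<longleftrightarrow> f \<in> Hom C A B \<and>
     (\<exists>g\<in>Hom C B A. cmp C g f = idm C A \<and> cmp C f g = idm C B)"

definition seq_iso :: "('o,'m) addcat \<Rightarrow> ('o \<Rightarrow> 'o) \<Rightarrow> ('m \<Rightarrow> 'm) \<Rightarrow> nat
    \<Rightarrow> ('o,'m) nseq \<Rightarrow> ('o,'m) nseq \<Rightarrow> (nat \<Rightarrow> 'm) \<Rightarrow> bool" where
  "seq_iso C SO SM n S T phi \<longleftrightarrow> seq_mor C SO SM n S T phi \<and>
     (\<forall>i. 1 \<le> i \<and> i \<le> n \<longrightarrow> is_iso C (fst S i) (fst T i) (phi i))"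

definition seq_dsum :: "('o,'m) addcat \<Rightarrow> ('o \<Rightarrow> 'o) \<Rightarrow> ('m \<Rightarrow> 'm) \<Rightarrow> nat
    \<Rightarrow> ('o,'m) nseq \<Rightarrow> ('o,'m) nseq \<Rightarrow> ('o,'m) nseq" where
  "seq_dsum C SO SM n S T = (case S of (X, a) \<Rightarrow> case T of (Y, b) \<Rightarrow>
     (\<lambda>i. lsum C [X i, Y i],
      \<lambda>i. if i < n then
             mat C [X i, Y i] [X (Suc i), Y (Suc i)]
               (\<lambda>r s. if r = 0 \<and> s = 0 then a i
                      else if r = 1 \<and> s = 1 then b i
                      else if r = 0 then zer C (Y i) (X (Suc i))
                      else zer C (X i) (Y (Suc i)))
           else
             matS C SO SM [X n, Y n] [X 1, Y 1]
               (\<lambda>r s. if r = 0 \<and> s = 0 then a n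
                      else if r = 1 \<and> s = 1 then b n
                      else if r = 0 then zer C (Y n) (SO (X 1))
                      else zer C (X n) (SO (Y 1)))))"

definition direct_summand :: "('o,'m) addcat \<Rightarrow> ('o \<Rightarrow> 'o) \<Rightarrow> ('m \<Rightarrow> 'm) \<Rightarrow> nat
    \<Rightarrow> ('o,'m) nseq \<Rightarrow> ('o,'m) nseq \<Rightarrow> bool" where
  "direct_summand C SO SM n S T \<longleftrightarrow>
     (\<exists>phi psi. seq_mor C SO SM n S T phi \<and> seq_mor C SO SM n T S psi \<and>
        (\<forall>i. 1 \<le> i \<and> i \<le> n \<longrightarrow> cmp C (psi i) (phi i) = idm C (fst S i)))"

definition cone_list :: "('o \<Rightarrow> 'o) \<Rightarrow> nat \<Rightarrow> ('o,'m) nseq \<Rightarrow> ('o,'m) nseq \<Rightarrow> nat \<Rightarrow> 'o list" where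
  "cone_list SO n S T i = (if i < n then [fst S (Suc i), fst T i] else [SO (fst S 1), fst T n])"

definition mapping_cone :: "('o,'m) addcat \<Rightarrow> ('o \<Rightarrow> 'o) \<Rightarrow> ('m \<Rightarrow> 'm) \<Rightarrow> nat
    \<Rightarrow> ('o,'m) nseq \<Rightarrow> ('o,'m) nseq \<Rightarrow> (nat \<Rightarrow> 'm) \<Rightarrow> ('o,'m) nseq" where
  "mapping_cone C SO SM n S T phi = (case S of (X, a) \<Rightarrow> case T of (Y, b) \<Rightarrow>
     (\<lambda>i. lsum C (cone_list SO n S T i),
      \<lambda>i. if i < n then
             mat C (cone_list SO n S T i) (cone_list SO n S T (Suc i))
               (\<lambda>r s. if r = 0 \<and> s = 0 then neg C (a (Suc i))
                      else if r = 0 \<and> s = 1 then zer C (Y i) (cone_list SO n S T (Suc i) ! 0)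
                      else if s = 0 then phi (Suc i)
                      else b i)
           else
             matS C SO SM (cone_list SO n S T n) [X 2, Y 1]
               (\<lambda>r s. if r = 0 \<and> s = 0 then neg C (SM (a 1))
                      else if r = 0 \<and> s = 1 then zer C (Y n) (SO (X 2))
                      else if s = 0 then SM (phi 1)
                      else b n)))"

definition N1 :: "('o,'m) addcat \<Rightarrow> ('o \<Rightarrow> 'o) \<Rightarrow> ('m \<Rightarrow> 'm) \<Rightarrow> nat \<Rightarrow> ('o,'m) nseq set \<Rightarrow> bool" where
  "N1 C SO SM n N \<longleftrightarrow>
     \<comment> \<open>(a) closed under direct sums, direct summands and isomorphisms\<close>
     (\<forall>S\<in>N. \<forall>T\<in>N. seq_dsum C SO SM n S T \<in> N) \<and>
     (\<forall>S T. is_seq C SO n S \<and> T \<in> N \<and> direct_summand C SO SM n S T \<longrightarrow> S \<in> N) \<and>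
     (\<forall>S T phi. S \<in> N \<and> is_seq C SO n T \<and> seq_iso C SO SM n S T phi \<longrightarrow> T \<in> N) \<and>
     \<comment> \<open>(b) trivial n-angles\<close>
     (\<forall>A\<in>Ob C.
        ((\<lambda>i. if i \<le> 2 then A else zobj C),
         (\<lambda>i. if i = 1 then idm C A
              else if i < n then zer C (if i \<le> 2 then A else zobj C) (zobj C)
              else zer C (zobj C) (SO A))) \<in> N) \<and>
     \<comment> \<open>(c) every morphism is the first morphism of an n-angle\<close>
     (\<forall>A\<in>Ob C. \<forall>B\<in>Ob C. \<forall>f\<in>Hom C A B.
        \<exists>S\<in>N. fst S 1 = A \<and> fst S 2 = B \<and> snd S 1 = f)"

definition N2 :: "('o,'m) addcat \<Rightarrow> ('o \<Rightarrow> 'o) \<Rightarrow> ('m \<Rightarrow> 'm) \<Rightarrow> nat \<Rightarrow> ('o,'m) nseq set \<Rightarrow> bool" where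
  "N2 C SO SM n N \<longleftrightarrow>
     (\<forall>S. is_seq C SO n S \<longrightarrow> (S \<in> N \<longleftrightarrow> rotl C SO SM n S \<in> N))"

definition N3 :: "('o,'m) addcat \<Rightarrow> ('o \<Rightarrow> 'o) \<Rightarrow> ('m \<Rightarrow> 'm) \<Rightarrow> nat \<Rightarrow> ('o,'m) nseq set \<Rightarrow> bool" where
  "N3 C SO SM n N \<longleftrightarrow>
     (\<forall>S\<in>N. \<forall>T\<in>N. \<forall>f1 f2.
        f1 \<in> Hom C (fst S 1) (fst T 1) \<and> f2 \<in> Hom C (fst S 2) (fst T 2) \<and>
        cmp C f2 (snd S 1) = cmp C (snd T 1) f1 \<longrightarrow>
        (\<exists>phi. phi 1 = f1 \<and> phi 2 = f2 \<and> seq_mor C SO SM n S T phi))"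

definition N4 :: "('o,'m) addcat \<Rightarrow> ('o \<Rightarrow> 'o) \<Rightarrow> ('m \<Rightarrow> 'm) \<Rightarrow> nat \<Rightarrow> ('o,'m) nseq set \<Rightarrow> bool" where
  "N4 C SO SM n N \<longleftrightarrow>
     (\<forall>S\<in>N. \<forall>T\<in>N. \<forall>f1 f2.
        f1 \<in> Hom C (fst S 1) (fst T 1) \<and> f2 \<in> Hom C (fst S 2) (fst T 2) \<and>
        cmp C f2 (snd S 1) = cmp C (snd T 1) f1 \<longrightarrow>
        (\<exists>phi. phi 1 = f1 \<and> phi 2 = f2 \<and> seq_mor C SO SM n S T phi \<and>
               mapping_cone C SO SM n S T phi \<in> N))"

text \<open>The sequence D of axiom (N4*). For 1 <= k <= n-1 the object D (k+1) is the direct sum of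
  the nonzero summands among A (k+3), B (k+2), C (k+1), tagged 0, 1, 2 respectively;
  A i = B i = C i = 0 for i > n and C i = 0 for i <= 2, and zero summands are deleted.\<close>

definition d_pres :: "nat \<Rightarrow> nat \<Rightarrow> nat \<Rightarrow> bool" where
  "d_pres n k t = (if t = 0 then k + 3 \<le> n else if t = 1 then k + 2 \<le> n else 2 \<le> k)"

definition d_tags :: "nat \<Rightarrow> nat \<Rightarrow> nat list" where
  "d_tags n k = filter (d_pres n k) [0, 1, 2]"

definition d_comp :: "(nat \<Rightarrow> 'o) \<Rightarrow> (nat \<Rightarrow> 'o) \<Rightarrow> (nat \<Rightarrow> 'o) \<Rightarrow> nat \<Rightarrow> nat \<Rightarrow> 'o" where
  "d_comp XA XB XC k t = (if t = 0 then XA (k + 3) else if t = 1 then XB (k + 2) else XC (k + 1))"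

definition d_objs :: "nat \<Rightarrow> (nat \<Rightarrow> 'o) \<Rightarrow> (nat \<Rightarrow> 'o) \<Rightarrow> (nat \<Rightarrow> 'o) \<Rightarrow> nat \<Rightarrow> 'o list" where
  "d_objs n XA XB XC k = map (d_comp XA XB XC k) (d_tags n k)"

text \<open>Entry (target tag r, source tag s) of the 3x3 matrix of d (k+1).\<close>
definition d_entry :: "('o,'m) addcat \<Rightarrow> (nat \<Rightarrow> 'o) \<Rightarrow> (nat \<Rightarrow> 'o) \<Rightarrow> (nat \<Rightarrow> 'o)
    \<Rightarrow> (nat \<Rightarrow> 'm) \<Rightarrow> (nat \<Rightarrow> 'm) \<Rightarrow> (nat \<Rightarrow> 'm) \<Rightarrow> (nat \<Rightarrow> 'm) \<Rightarrow> (nat \<Rightarrow> 'm)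
    \<Rightarrow> nat \<Rightarrow> nat \<Rightarrow> nat \<Rightarrow> 'm" where
  "d_entry C XA XB XC a b c phi psi k r s =
     (if r = 0 then (if s = 0 then neg C (a (k + 3)) else zer C (d_comp XA XB XC k s) (XA (k + 4)))
      else if r = 1 then
        (if s = 0 then sgnm C (k + 1) (phi (k + 3))
         else if s = 1 then neg C (b (k + 2))
         else zer C (XC (k + 1)) (XB (k + 3)))
      else (if s = 0 then psi (2 * k) else if s = 1 then psi (2 * k - 1) else c (k + 1)))"

definition D_seq :: "('o,'m) addcat \<Rightarrow> ('o \<Rightarrow> 'o) \<Rightarrow> ('m \<Rightarrow> 'm) \<Rightarrow> nat
    \<Rightarrow> ('o,'m) nseq \<Rightarrow> ('o,'m) nseq \<Rightarrow> ('o,'m) nseq \<Rightarrow> (nat \<Rightarrow> 'm) \<Rightarrow> (nat \<Rightarrow> 'm)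
    \<Rightarrow> ('o,'m) nseq" where
  "D_seq C SO SM n SA SB SC phi psi = (case SA of (XA, a) \<Rightarrow> case SB of (XB, b) \<Rightarrow> case SC of (XC, c) \<Rightarrow>
     (\<lambda>m. if m = 1 then XA 3 else lsum C (d_objs n XA XB XC (m - 1)),
      \<lambda>m. if m = 1 then
             mat C [XA 3] (d_objs n XA XB XC 1)
               (\<lambda>r s. if d_tags n 1 ! r = 0 then a 3 else phi 3)
           else if m < n then
             mat C (d_objs n XA XB XC (m - 1)) (d_objs n XA XB XC m)
               (\<lambda>r s. d_entry C XA XB XC a b c phi psi (m - 1)
                        (d_tags n m ! r) (d_tags n (m - 1) ! s))
           else cmp C (SM (a 2)) (c n)))"

definition N4star :: "('o,'m) addcat \<Rightarrow> ('o \<Rightarrow> 'o) \<Rightarrow> ('m \<Rightarrow> 'm) \<Rightarrow> nat \<Rightarrow> ('o,'m) nseq set \<Rightarrow> bool" where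
  "N4star C SO SM n N \<longleftrightarrow>
     (\<forall>SA\<in>N. \<forall>SB\<in>N. \<forall>SC\<in>N. \<forall>f2.
        fst SB 1 = fst SA 1 \<and> fst SC 1 = fst SA 2 \<and> fst SC 2 = fst SB 2 \<and>
        snd SC 1 = f2 \<and> f2 \<in> Hom C (fst SA 2) (fst SB 2) \<and>
        cmp C f2 (snd SA 1) = snd SB 1 \<longrightarrow>
        (\<exists>phi psi.
           phi 1 = idm C (fst SA 1) \<and> phi 2 = f2 \<and> seq_mor C SO SM n SA SB phi \<and>
           (\<forall>k. 1 \<le> k \<and> 2 * k - 1 \<le> 2 * n - 5 \<longrightarrow>
                psi (2 * k - 1) \<in> Hom C (fst SB (k + 2)) (fst SC (k + 2))) \<and>
           (\<forall>k. 1 \<le> k \<and> 2 * k \<le> 2 * n - 5 \<longrightarrow>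
                psi (2 * k) \<in> Hom C (fst SA (k + 3)) (fst SC (k + 2))) \<and>
           cmp C (snd SC n) (psi (2 * n - 5)) = cmp C (SM (snd SA 1)) (snd SB n) \<and>
           D_seq C SO SM n SA SB SC phi psi \<in> N))"

end

theory Submission
  imports Defs
begin

text \<open>Given \<open>\<phi>1 : A1 \<rightarrow> B1\<close> and \<open>\<phi>2 : A2 \<rightarrow> B2\<close> with \<open>\<phi>2 \<alpha>1 = \<beta>1 \<phi>1\<close>, a single application of (N4*)
  suffices, to the composable pair
  \<open>A1 \<oplus> B1 \<rightarrow> A2 \<oplus> B1 \<oplus> B2 \<rightarrow> B2\<close> with matrices \<open>[\<alpha>1 0; \<phi>1 1; 0 0]\<close> and \<open>[-\<phi>2 \<beta>1 1]\<close>.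
  Up to automorphisms the first map extends to the \<open>n\<close>-angle \<open>A\<close> plus two contractible ones on \<open>B1\<close> and \<open>B2\<close>;
  the composite \<open>[0 \<beta>1]\<close> extends to \<open>B\<close> plus the rotated trivial \<open>n\<close>-angle \<open>A1 \<rightarrow> 0 \<rightarrow> \<dots> \<rightarrow> \<Sigma>A1\<close>;
  and the second map is split epi with kernel \<open>K = A2 \<oplus> B1\<close>, so its third to \<open>(n-1)\<close>-st objects vanish and the last one is \<open>\<Sigma>K\<close>.
  The sequence \<open>D\<close> of (N4*) then reads
  \<open>A3 \<oplus> B2 \<rightarrow> A4 \<oplus> B3 \<rightarrow> \<dots> \<rightarrow> An \<oplus> B(n-1) \<rightarrow> \<Sigma>A1 \<oplus> Bn \<rightarrow> \<Sigma>(A2 \<oplus> B1)\<close>,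
  which up to signs is the left rotation of the mapping cone of the morphism \<open>A \<rightarrow> B\<close> obtained
  by restricting and projecting the morphism that (N4*) provides.\<close>

section \<open>Biproducts and matrices in an additive category\<close>

text \<open>The summands \<open>B 1\<close> and \<open>B 2\<close> are added so that almost nothing
  returned by \<open>N4star\<close> stays unknown. The identity on \<open>B 2\<close> splits the
  second map whatever f2 and b 1 are; hence the middle objects of its n-angle vanish, every \<psi>
  except the last has a zero target, and the last one is forced by its equation because the final
  map of that n-angle is split mono. The copy of \<open>B 1\<close> lets f1 be an entry of the first
  map while the composite no longer contains it. The map \<open>a n\<close> occurs in no matrix of
  D; it comes back as the \<Sigma>(A 1)-component of the n-th map of the morphism, which is
  determined because that morphism starts with an identity. The entry -f2 makes the composite vanish
  on \<open>A 1\<close>; with this sign the restricted morphism starts with (-f1, -f2) and has to be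
  negated.

  The formal obstacle is that direct sums are picked by a choice operator, and \<Sigma> of a picked
  sum need not be a picked sum. All sequences are therefore described by their entries relative to
  arbitrary biproduct data, and membership in \<open>N\<close> is transferred by comparing
  entries.\<close>

locale additive_cat =
  fixes C :: "('o,'m) addcat"
  assumes additive: "additive_category C"
begin

section \<open>Arrows with explicit source and target, hom-groups and signs\<close>

abbreviation comp :: "'m \<Rightarrow> 'm \<Rightarrow> 'm" (infixr "\<cdot>" 70) where "g \<cdot> f \<equiv> cmp C g f"
abbreviation plus :: "'m \<Rightarrow> 'm \<Rightarrow> 'm" (infixl "\<oplus>" 65) where "f \<oplus> g \<equiv> add C f g"
abbreviation opp :: "'m \<Rightarrow> 'm" ("\<ominus> _" [81] 80) where "\<ominus> f \<equiv> neg C f"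
abbreviation ide :: "'o \<Rightarrow> 'm" where "ide \<equiv> idm C"
abbreviation zero :: "'o \<Rightarrow> 'o \<Rightarrow> 'm" where "zero \<equiv> zer C"
abbreviation sg :: "nat \<Rightarrow> 'm \<Rightarrow> 'm" where "sg \<equiv> sgnm C"

text \<open>The hom-sets of an \<open>addcat\<close> need not be disjoint, so an arrow does not
  determine its source and target. With both objects in the predicate, a single typing fact
  discharges the bounded quantifiers of the axioms.\<close>

definition hom :: "'m \<Rightarrow> 'o \<Rightarrow> 'o \<Rightarrow> bool" where
  "hom f A B \<longleftrightarrow> A \<in> Ob C \<and> B \<in> Ob C \<and> f \<in> Hom C A B"

lemma preadditive: "is_preadditive C"
  using additive unfolding additive_category_def by blast

lemma cat: "is_category C"
  using preadditive unfolding is_preadditive_def by blast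

lemma homD: "hom f A B \<Longrightarrow> A \<in> Ob C" "hom f A B \<Longrightarrow> B \<in> Ob C" "hom f A B \<Longrightarrow> f \<in> Hom C A B"
  by (auto simp: hom_def)

lemma hom_comp [intro]: "hom f A B \<Longrightarrow> hom g B D \<Longrightarrow> hom (g \<cdot> f) A D"
  using cat[unfolded is_category_def, THEN conjunct1, rule_format, of A B D f g] unfolding hom_def by simp

lemma comp_assoc: "hom f A B \<Longrightarrow> hom g B D \<Longrightarrow> hom h D E \<Longrightarrow> (h \<cdot> g) \<cdot> f = h \<cdot> g \<cdot> f"
  using cat[unfolded is_category_def, THEN conjunct2, THEN conjunct1, rule_format, of A B D E f g h]
  unfolding hom_def by simp

lemma hom_ide [intro]: "A \<in> Ob C \<Longrightarrow> hom (ide A) A A"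
  using cat unfolding is_category_def hom_def by blast

lemma ide_right: "hom f A B \<Longrightarrow> f \<cdot> ide A = f" and ide_left: "hom f A B \<Longrightarrow> ide B \<cdot> f = f"
  using cat unfolding is_category_def hom_def by blast+

lemma hom_group:
  assumes "A \<in> Ob C" "B \<in> Ob C"
  shows "zero A B \<in> Hom C A B" "\<forall>f\<in>Hom C A B. \<forall>g\<in>Hom C A B. f \<oplus> g \<in> Hom C A B"
    "\<forall>f\<in>Hom C A B. \<ominus> f \<in> Hom C A B"
    "\<forall>f\<in>Hom C A B. \<forall>g\<in>Hom C A B. \<forall>h\<in>Hom C A B. f \<oplus> g \<oplus> h = f \<oplus> (g \<oplus> h)"
    "\<forall>f\<in>Hom C A B. \<forall>g\<in>Hom C A B. f \<oplus> g = g \<oplus> f"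
    "\<forall>f\<in>Hom C A B. zero A B \<oplus> f = f" "\<forall>f\<in>Hom C A B. f \<oplus> \<ominus> f = zero A B"
proof -
  note h = preadditive[unfolded is_preadditive_def, THEN conjunct2, THEN conjunct1, THEN bspec, THEN bspec, OF assms]
  from h show "zero A B \<in> Hom C A B" by (rule conjunct1)
  note h = h[THEN conjunct2]
  from h show "\<forall>f\<in>Hom C A B. \<forall>g\<in>Hom C A B. f \<oplus> g \<in> Hom C A B" by (rule conjunct1)
  note h = h[THEN conjunct2]
  from h show "\<forall>f\<in>Hom C A B. \<ominus> f \<in> Hom C A B" by (rule conjunct1)
  note h = h[THEN conjunct2]
  from h show "\<forall>f\<in>Hom C A B. \<forall>g\<in>Hom C A B. \<forall>h\<in>Hom C A B. f \<oplus> g \<oplus> h = f \<oplus> (g \<oplus> h)"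
    by (rule conjunct1)
  note h = h[THEN conjunct2]
  from h show "\<forall>f\<in>Hom C A B. \<forall>g\<in>Hom C A B. f \<oplus> g = g \<oplus> f" by (rule conjunct1)
  note h = h[THEN conjunct2]
  from h show "\<forall>f\<in>Hom C A B. zero A B \<oplus> f = f" by (rule conjunct1)
  from h show "\<forall>f\<in>Hom C A B. f \<oplus> \<ominus> f = zero A B" by (rule conjunct2)
qed

lemma hom_zero [intro]: "A \<in> Ob C \<Longrightarrow> B \<in> Ob C \<Longrightarrow> hom (zero A B) A B"
  using hom_group(1) unfolding hom_def by blast

lemma hom_add [intro]: "hom f A B \<Longrightarrow> hom g A B \<Longrightarrow> hom (f \<oplus> g) A B"
  using hom_group(2) unfolding hom_def by blast

lemma hom_neg [intro]: "hom f A B \<Longrightarrow> hom (\<ominus> f) A B"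
  using hom_group(3) unfolding hom_def by blast

lemma add_assoc: "hom f A B \<Longrightarrow> hom g A B \<Longrightarrow> hom h A B \<Longrightarrow> f \<oplus> g \<oplus> h = f \<oplus> (g \<oplus> h)"
  using hom_group(4) unfolding hom_def by blast

lemma add_commute: "hom f A B \<Longrightarrow> hom g A B \<Longrightarrow> f \<oplus> g = g \<oplus> f"
  using hom_group(5) unfolding hom_def by blast

lemma add_zero_left: "hom f A B \<Longrightarrow> zero A B \<oplus> f = f"
  using hom_group(6) unfolding hom_def by blast

lemma add_zero_right: "hom f A B \<Longrightarrow> f \<oplus> zero A B = f"
  by (metis add_commute add_zero_left hom_zero homD(1,2))

lemma add_neg_right: "hom f A B \<Longrightarrow> f \<oplus> \<ominus> f = zero A B"
  using hom_group(7) unfolding hom_def by blast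

lemma add_neg_left: "hom f A B \<Longrightarrow> \<ominus> f \<oplus> f = zero A B"
  by (metis add_commute add_neg_right hom_neg)

lemma comp_add_right: "hom f A B \<Longrightarrow> hom f' A B \<Longrightarrow> hom g B D \<Longrightarrow> g \<cdot> (f \<oplus> f') = g \<cdot> f \<oplus> g \<cdot> f'"
  using preadditive[unfolded is_preadditive_def, THEN conjunct2, THEN conjunct2, THEN conjunct1]
  unfolding hom_def by blast

lemma comp_add_left: "hom f A B \<Longrightarrow> hom g B D \<Longrightarrow> hom g' B D \<Longrightarrow> (g \<oplus> g') \<cdot> f = g \<cdot> f \<oplus> g' \<cdot> f"
  using preadditive[unfolded is_preadditive_def, THEN conjunct2, THEN conjunct2, THEN conjunct2]
  unfolding hom_def by blast

lemma add_left_cancel: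
  assumes "hom f A B" "hom g A B" "hom h A B" "f \<oplus> g = f \<oplus> h"
  shows "g = h"
proof -
  have "\<ominus> f \<oplus> (f \<oplus> x) = x" if "hom x A B" for x
    using add_assoc[OF hom_neg[OF assms(1)] assms(1) that] add_neg_left[OF assms(1)] add_zero_left[OF that]
    by simp
  with assms show ?thesis by metis
qed

text \<open>The sign rules for composition, for double negation and later for \<Sigma> all reduce to
  this uniqueness.\<close>

lemma neg_unique:
  assumes "hom f A B" "hom g A B" "f \<oplus> g = zero A B"
  shows "g = \<ominus> f"
  by (rule add_left_cancel[OF assms(1,2) hom_neg[OF assms(1)]]) (simp add: assms add_neg_right[OF assms(1)])

lemma comp_zero_right:
  assumes "hom g B D" "A \<in> Ob C"
  shows "g \<cdot> zero A B = zero A D"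
proof -
  have z: "hom (zero A B) A B" using assms by (auto dest: homD)
  have c: "hom (g \<cdot> zero A B) A D" using z assms by blast
  have "g \<cdot> zero A B \<oplus> g \<cdot> zero A B = g \<cdot> zero A B \<oplus> zero A D"
    using comp_add_right[OF z z assms(1)] add_zero_left[OF z] add_zero_right[OF c] by simp
  then show ?thesis using add_left_cancel c hom_zero homD by metis
qed

lemma comp_zero_left:
  assumes "hom f A B" "D \<in> Ob C"
  shows "zero B D \<cdot> f = zero A D"
proof -
  have z: "hom (zero B D) B D" using assms by (auto dest: homD)
  have c: "hom (zero B D \<cdot> f) A D" using z assms by blast
  have "zero B D \<cdot> f \<oplus> zero B D \<cdot> f = zero B D \<cdot> f \<oplus> zero A D"
    using comp_add_left[OF assms(1) z z] add_zero_left[OF z] add_zero_right[OF c] by simp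
  then show ?thesis using add_left_cancel c hom_zero homD by metis
qed

lemma comp_neg_right:
  assumes "hom f A B" "hom g B D"
  shows "g \<cdot> \<ominus> f = \<ominus> (g \<cdot> f)"
proof (rule neg_unique[of _ A D])
  show "g \<cdot> f \<oplus> g \<cdot> \<ominus> f = zero A D"
    using comp_add_right[OF assms(1) hom_neg[OF assms(1)] assms(2)] add_neg_right[OF assms(1)]
      comp_zero_right[OF assms(2) homD(1)[OF assms(1)]] by simp
qed (use assms in blast)+

lemma comp_neg_left:
  assumes "hom f A B" "hom g B D"
  shows "\<ominus> g \<cdot> f = \<ominus> (g \<cdot> f)"
proof (rule neg_unique[of _ A D])
  show "g \<cdot> f \<oplus> \<ominus> g \<cdot> f = zero A D"
    using comp_add_left[OF assms(1) assms(2) hom_neg[OF assms(2)]] add_neg_right[OF assms(2)]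
      comp_zero_left[OF assms(1) homD(2)[OF assms(2)]] by simp
qed (use assms in blast)+

lemma neg_neg: "hom f A B \<Longrightarrow> \<ominus> (\<ominus> f) = f"
  by (metis neg_unique add_neg_left hom_neg)

lemma neg_zero: "A \<in> Ob C \<Longrightarrow> B \<in> Ob C \<Longrightarrow> \<ominus> zero A B = zero A B"
  by (metis add_zero_left hom_zero neg_unique)

lemma hom_sgn [intro]: "hom f A B \<Longrightarrow> hom (sg e f) A B"
  by (auto simp: sgnm_def)

lemma comp_sgn_left: "hom f A B \<Longrightarrow> hom g B D \<Longrightarrow> sg e g \<cdot> f = sg e (g \<cdot> f)"
  by (auto simp: sgnm_def comp_neg_left)

lemma comp_sgn_right: "hom f A B \<Longrightarrow> hom g B D \<Longrightarrow> g \<cdot> sg e f = sg e (g \<cdot> f)"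
  by (auto simp: sgnm_def comp_neg_right)

text \<open>Exponents are natural numbers of which only the parity counts, so collecting signs means
  adding exponents.\<close>

lemma sgn_sgn: "hom f A B \<Longrightarrow> sg e (sg e' f) = sg (e + e') f"
  by (auto simp: sgnm_def neg_neg)

lemma sgn_zero: "A \<in> Ob C \<Longrightarrow> B \<in> Ob C \<Longrightarrow> sg e (zero A B) = zero A B"
  by (auto simp: sgnm_def neg_zero)

lemma sgn_cong: "even e \<longleftrightarrow> even e' \<Longrightarrow> sg e f = sg e' f"
  by (auto simp: sgnm_def)

section \<open>Zero objects and biproducts\<close>

abbreviation Z :: 'o where "Z \<equiv> zobj C"

lemma zobj_zero: "is_zero_obj C Z"
  using additive unfolding additive_category_def zobj_def by (metis someI_ex)

lemma zobj_Ob: "Z \<in> Ob C"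
  using zobj_zero by (simp add: is_zero_obj_def)

lemma hom_from_zero_unique: "is_zero_obj C W \<Longrightarrow> hom f W B \<Longrightarrow> f = zero W B"
  unfolding is_zero_obj_def by (metis hom_zero hom_def)

lemma hom_to_zero_unique: "is_zero_obj C W \<Longrightarrow> hom f A W \<Longrightarrow> f = zero A W"
  unfolding is_zero_obj_def by (metis hom_zero hom_def)

lemma comp_through_zero:
  assumes "is_zero_obj C W" "hom f A W" "hom g W B"
  shows "g \<cdot> f = zero A B"
  using hom_to_zero_unique[OF assms(1,2)] comp_zero_right[OF assms(3)] assms(2) by (auto dest: homD)

text \<open>Arbitrary biproduct data rather than the ones picked by \<open>bpd\<close>:
  decompositions twisted by a graph, images under \<Sigma> and sums with a zero summand need not be
  picked ones, yet all are handled alike.\<close>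

definition bp :: "'o \<Rightarrow> 'o \<Rightarrow> 'o \<Rightarrow> 'm \<Rightarrow> 'm \<Rightarrow> 'm \<Rightarrow> 'm \<Rightarrow> bool" where
  "bp A B S i1 i2 p1 p2 \<longleftrightarrow> hom i1 A S \<and> hom i2 B S \<and> hom p1 S A \<and> hom p2 S B \<and>
     p1 \<cdot> i1 = ide A \<and> p2 \<cdot> i2 = ide B \<and> p1 \<cdot> i2 = zero B A \<and> p2 \<cdot> i1 = zero A B \<and>
     i1 \<cdot> p1 \<oplus> i2 \<cdot> p2 = ide S"

lemma bpD:
  assumes "bp A B S i1 i2 p1 p2"
  shows "hom i1 A S" "hom i2 B S" "hom p1 S A" "hom p2 S B"
    "p1 \<cdot> i1 = ide A" "p2 \<cdot> i2 = ide B" "p1 \<cdot> i2 = zero B A" "p2 \<cdot> i1 = zero A B"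
    "i1 \<cdot> p1 \<oplus> i2 \<cdot> p2 = ide S"
  using assms by (auto simp: bp_def)

lemma bp_chosen:
  assumes "A \<in> Ob C" "B \<in> Ob C"
  shows "bp A B (bpO C A B) (bpI1 C A B) (bpI2 C A B) (bpP1 C A B) (bpP2 C A B)"
proof -
  have "\<exists>t. case t of (S, i1, i2, p1, p2) \<Rightarrow> is_biproduct C A B S i1 i2 p1 p2"
    using additive assms unfolding additive_category_def by fastforce
  then have "case bpd C A B of (S, i1, i2, p1, p2) \<Rightarrow> is_biproduct C A B S i1 i2 p1 p2"
    unfolding bpd_def by (rule someI_ex)
  then show ?thesis using assms
    by (auto simp: bp_def bpO_def bpI1_def bpI2_def bpP1_def bpP2_def is_biproduct_def hom_def split: prod.splits)
qed

text \<open>Since i1 p1 + i2 p2 is the identity of \<open>S\<close>, an arrow out of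
  \<open>S\<close> is rebuilt from its two restrictions.\<close>

lemma bp_ext_source:
  assumes b: "bp A B S i1 i2 p1 p2" and f: "hom f S T" and g: "hom g S T"
    and 1: "f \<cdot> i1 = g \<cdot> i1" and 2: "f \<cdot> i2 = g \<cdot> i2"
  shows "f = g"
proof -
  have "h = (h \<cdot> i1) \<cdot> p1 \<oplus> (h \<cdot> i2) \<cdot> p2" if "hom h S T" for h
    using bpD[OF b] that comp_add_right[of "i1 \<cdot> p1" S S "i2 \<cdot> p2" h T] ide_right[OF that]
      comp_assoc[of p1 S A i1 S h T] comp_assoc[of p2 S B i2 S h T] hom_comp by metis
  with f g 1 2 show ?thesis by metis
qed

lemma bp_ext_target:
  assumes b: "bp A B S i1 i2 p1 p2" and f: "hom f T S" and g: "hom g T S"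
    and 1: "p1 \<cdot> f = p1 \<cdot> g" and 2: "p2 \<cdot> f = p2 \<cdot> g"
  shows "f = g"
proof -
  have "h = i1 \<cdot> p1 \<cdot> h \<oplus> i2 \<cdot> p2 \<cdot> h" if "hom h T S" for h
    using bpD[OF b] that comp_add_left[of h T S "i1 \<cdot> p1" S "i2 \<cdot> p2"] ide_left[OF that]
      comp_assoc[of h T S p1 A i1 S] comp_assoc[of h T S p2 B i2 S] hom_comp by metis
  with f g 1 2 show ?thesis by metis
qed

lemma comp_cancel_mid:
  assumes "hom f A B" "hom i B S" "hom p S B" "p \<cdot> i = ide B" "hom g B D"
  shows "(g \<cdot> p) \<cdot> i \<cdot> f = g \<cdot> f"
  using comp_assoc[OF hom_comp[OF assms(1,2)] assms(3,5)] comp_assoc[OF assms(1,2,3)] assms(4) ide_left[OF assms(1)]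
  by simp

lemma bp_swap: "bp A B S i1 i2 p1 p2 \<Longrightarrow> bp B A S i2 i1 p2 p1"
  unfolding bp_def by (metis add_commute hom_comp)

lemma bp_zero_right:
  assumes "is_zero_obj C W" "A \<in> Ob C"
  shows "bp A W A (ide A) (zero W A) (ide A) (zero A W)"
proof -
  have W: "W \<in> Ob C" using assms by (simp add: is_zero_obj_def)
  have h: "hom (zero W A) W A" "hom (zero A W) A W" "hom (ide A) A A" using W assms(2) by auto
  have "zero A W \<cdot> zero W A = ide W"
    using hom_from_zero_unique[OF assms(1)] hom_ide[OF W] hom_comp[OF h(1,2)] by metis
  then show ?thesis
    unfolding bp_def using h ide_left[OF h(3)] ide_left[OF h(1)] ide_right[OF h(2)]
      comp_through_zero[OF assms(1) h(2,1)] add_zero_right[OF h(3)] by simp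
qed

lemma bp_zero_left:
  assumes "is_zero_obj C W" "A \<in> Ob C"
  shows "bp W A A (zero W A) (ide A) (zero A W) (ide A)"
  by (rule bp_swap[OF bp_zero_right[OF assms]])

lemma bpI:
  assumes "hom i1 A S" "hom i2 B S" "hom p1 S A" "hom p2 S B"
    "p1 \<cdot> i1 = ide A" "p2 \<cdot> i2 = ide B" "p1 \<cdot> i2 = zero B A" "p2 \<cdot> i1 = zero A B"
    "i1 \<cdot> p1 \<oplus> i2 \<cdot> p2 = ide S"
  shows "bp A B S i1 i2 p1 p2"
  using assms by (simp add: bp_def)

text \<open>A sign is its own inverse, so the inclusion and the projection of a summand receive the
  same one. Rescaling summands in this way absorbs the signs by which D differs from the rotated
  cone.\<close>

lemma bp_sgn:
  assumes b: "bp A B S i1 i2 p1 p2"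
  shows "bp A B S (sg d i1) (sg e i2) (sg d p1) (sg e p2)"
proof -
  note h = bpD[OF b]
  have AB: "A \<in> Ob C" "B \<in> Ob C" using h homD by blast+
  have "sg d p \<cdot> sg e i = sg (d + e) (p \<cdot> i)" if "hom i X Y" "hom p Y W" for d e p i X Y W
    using comp_sgn_left[OF hom_sgn[OF that(1)] that(2)] comp_sgn_right[OF that] sgn_sgn[OF hom_comp[OF that]]
    by simp
  note s = this[OF h(1,3)] this[OF h(2,3)] this[OF h(1,4)] this[OF h(2,4)] this[OF h(3,1)] this[OF h(4,2)]
  show ?thesis
    by (rule bpI) (use h AB in \<open>auto simp: s sgn_zero sgn_cong[of "d + d" 0] sgn_cong[of "e + e" 0] sgnm_def[of _ 0]\<close>)
qed

text \<open>The graph of \<open>-g\<close> as a complement of the second summand.\<close>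
lemma bp_twist:
  assumes b: "bp A B S i1 i2 p1 p2" and g: "hom g A B"
  shows "bp A B S (i1 \<oplus> \<ominus> (i2 \<cdot> g)) i2 p1 (g \<cdot> p1 \<oplus> p2)"
proof -
  note h = bpD[OF b]
  have AB: "A \<in> Ob C" "B \<in> Ob C" using h homD by blast+
  have h2: "hom (i2 \<cdot> g) A S" "hom (g \<cdot> p1) S B" using h g by blast+
  have 1: "p1 \<cdot> (i1 \<oplus> \<ominus> (i2 \<cdot> g)) = ide A"
  proof -
    have "p1 \<cdot> i2 \<cdot> g = zero A A"
      using comp_assoc[OF g h(2,3)] h(7) comp_zero_left[OF g AB(1)] by simp
    then show ?thesis
      using comp_add_right[OF h(1) hom_neg[OF h2(1)] h(3)] h(5) comp_neg_right[OF h2(1) h(3)]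
        neg_zero[OF AB(1) AB(1)] add_zero_right[OF hom_ide[OF AB(1)]] by simp
  qed
  have 2: "(g \<cdot> p1 \<oplus> p2) \<cdot> i2 = ide B"
    using comp_add_left[OF h(2) h2(2) h(4)] comp_assoc[OF h(2,3) g] h(6,7) comp_zero_right[OF g AB(2)]
      add_zero_left[OF hom_ide[OF AB(2)]] by simp
  have gi1: "(g \<cdot> p1 \<oplus> p2) \<cdot> i1 = g"
    using comp_add_left[OF h(1) h2(2) h(4)] comp_assoc[OF h(1,3) g] h(5,8) ide_right[OF g]
      add_zero_right[OF g] by simp
  have q: "hom (g \<cdot> p1 \<oplus> p2) S B" using h2 h by blast
  have 3: "(g \<cdot> p1 \<oplus> p2) \<cdot> (i1 \<oplus> \<ominus> (i2 \<cdot> g)) = zero A B"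
    using comp_add_right[OF h(1) hom_neg[OF h2(1)] q] gi1 comp_neg_right[OF h2(1) q]
      comp_assoc[OF g h(2) q] 2 ide_left[OF g] add_neg_right[OF g] by simp
  have j: "hom (i1 \<oplus> \<ominus> (i2 \<cdot> g)) A S" using h h2 by blast
  let ?e = "(i1 \<oplus> \<ominus> (i2 \<cdot> g)) \<cdot> p1 \<oplus> i2 \<cdot> (g \<cdot> p1 \<oplus> p2)"
  have ip: "hom (i1 \<cdot> p1) S S" "hom (i2 \<cdot> p2) S S" "hom (i2 \<cdot> g \<cdot> p1) S S" using h g by blast+
  have "?e = (i1 \<cdot> p1 \<oplus> \<ominus> (i2 \<cdot> g \<cdot> p1)) \<oplus> (i2 \<cdot> g \<cdot> p1 \<oplus> i2 \<cdot> p2)"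
    using comp_add_left[OF h(3,1) hom_neg[OF h2(1)]] comp_neg_left[OF h(3) h2(1)] comp_assoc[OF h(3) g h(2)]
      comp_add_right[OF h2(2) h(4) h(2)] by simp
  also have "\<dots> = i1 \<cdot> p1 \<oplus> (\<ominus> (i2 \<cdot> g \<cdot> p1) \<oplus> i2 \<cdot> g \<cdot> p1 \<oplus> i2 \<cdot> p2)"
    using add_assoc[OF ip(1) hom_neg[OF ip(3)] hom_add[OF ip(3,2)]] add_assoc[OF hom_neg[OF ip(3)] ip(3,2)]
    by simp
  also have "\<dots> = ide S"
    using add_neg_left[OF ip(3)] add_zero_left[OF ip(2)] h(9) by simp
  finally show ?thesis
    using 1 2 3 h j q by (auto intro: bpI)
qed

lemma bp_iso:
  assumes b: "bp A B S i1 i2 p1 p2" and u: "hom u S T" and v: "hom v T S"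
    and vu: "v \<cdot> u = ide S" and uv: "u \<cdot> v = ide T"
  shows "bp A B T (u \<cdot> i1) (u \<cdot> i2) (p1 \<cdot> v) (p2 \<cdot> v)"
proof -
  note h = bpD[OF b]
  have c: "(p \<cdot> v) \<cdot> u \<cdot> i = p \<cdot> i" if "hom p S Y" "hom i X S" for p i X Y
    by (rule comp_cancel_mid[OF that(2) u v vu that(1)])
  have d: "(u \<cdot> i) \<cdot> p \<cdot> v = u \<cdot> (i \<cdot> p) \<cdot> v" if "hom p S Y" "hom i Y S" for p i Y
    using comp_assoc[OF hom_comp[OF v that(1)] that(2) u] comp_assoc[OF v that] by simp
  have ip: "hom (i1 \<cdot> p1) S S" "hom (i2 \<cdot> p2) S S" using h by blast+
  have "u \<cdot> (i1 \<cdot> p1) \<cdot> v \<oplus> u \<cdot> (i2 \<cdot> p2) \<cdot> v = ide T"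
    using comp_add_left[OF v ip] comp_add_right[OF hom_comp[OF v ip(1)] hom_comp[OF v ip(2)] u] h(9)
      ide_left[OF v] uv by simp
  then show ?thesis
    by (intro bpI) (use h u v in \<open>auto simp: c d\<close>)
qed

lemma bp_absorb_zero:
  assumes b: "bp A B S i1 i2 p1 p2" and c: "bp D W B j1 j2 q1 q2" and W: "is_zero_obj C W"
  shows "bp A D S i1 (i2 \<cdot> j1) p1 (q1 \<cdot> p2)"
proof -
  note h = bpD[OF b] and k = bpD[OF c]
  have Ob: "A \<in> Ob C" "B \<in> Ob C" "D \<in> Ob C" using h k homD by blast+
  have "j1 \<cdot> q1 = ide B"
    using k(9) comp_through_zero[OF W k(4,2)] add_zero_right[OF hom_comp[OF k(3,1)]] by simp
  then have e: "(i2 \<cdot> j1) \<cdot> q1 \<cdot> p2 = i2 \<cdot> p2"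
    by (rule comp_cancel_mid[OF h(4) k(3,1) _ h(2)])
  have 1: "(q1 \<cdot> p2) \<cdot> i2 \<cdot> j1 = ide D"
    using comp_cancel_mid[OF k(1) h(2,4,6) k(3)] k(5) by simp
  have 2: "p1 \<cdot> i2 \<cdot> j1 = zero D A"
    using comp_assoc[OF k(1) h(2,3)] h(7) comp_zero_left[OF k(1) Ob(1)] by simp
  have 3: "(q1 \<cdot> p2) \<cdot> i1 = zero A D"
    using comp_assoc[OF h(1,4) k(3)] h(8) comp_zero_right[OF k(3) Ob(1)] by simp
  show ?thesis
    by (intro bpI) (use h k e 1 2 3 in auto)
qed

lemma bp_zero_inverse:
  assumes b: "bp A W S i1 i2 p1 p2" and W: "is_zero_obj C W"
  shows "i1 \<cdot> p1 = ide S"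
  using bpD(9)[OF b] comp_through_zero[OF W bpD(4,2)[OF b]] add_zero_right[OF hom_comp[OF bpD(3,1)[OF b]]]
  by simp

section \<open>Iterated sums over lists of objects\<close>

lemma lsum_Ob: "set xs \<subseteq> Ob C \<Longrightarrow> lsum C xs \<in> Ob C"
proof (induction xs rule: induct_list012)
  case (3 X Y xs)
  then show ?case using homD(2)[OF bpD(1)[OF bp_chosen[of X "lsum C (Y # xs)"]]] by simp
qed (auto simp: zobj_Ob)

text \<open>Typing and orthogonality go through one induction because the orthogonality step needs
  the typing of the tail. Each step is a binary biproduct identity between the head and the sum of
  the tail.\<close>

lemma linj_lproj:
  assumes "set xs \<subseteq> Ob C"
  shows hom_linj: "i < length xs \<Longrightarrow> hom (linj C xs i) (xs ! i) (lsum C xs)"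
    and hom_lproj: "i < length xs \<Longrightarrow> hom (lproj C xs i) (lsum C xs) (xs ! i)"
    and lproj_linj: "r < length xs \<Longrightarrow> s < length xs \<Longrightarrow>
      lproj C xs r \<cdot> linj C xs s = (if r = s then ide (xs ! s) else zero (xs ! s) (xs ! r))"
proof -
  have "(i < length xs \<longrightarrow> hom (linj C xs i) (xs ! i) (lsum C xs) \<and> hom (lproj C xs i) (lsum C xs) (xs ! i)) \<and>
      (r < length xs \<and> s < length xs \<longrightarrow>
      lproj C xs r \<cdot> linj C xs s = (if r = s then ide (xs ! s) else zero (xs ! s) (xs ! r)))" for i r s
    using assms
  proof (induction xs arbitrary: i r s rule: induct_list012)
    case 1
    then show ?case by simp
  next
    case (2 X)
    then show ?case using ide_left[OF hom_ide[of X]] by auto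
  next
    case (3 X Y xs)
    let ?L = "lsum C (Y # xs)"
    have O: "X \<in> Ob C" "?L \<in> Ob C" "set (Y # xs) \<subseteq> Ob C"
      using 3(3) lsum_Ob[of "Y # xs"] by auto
    note h = bpD[OF bp_chosen[OF O(1,2)]]
    note IH = 3(2)[OF O(3)]
    have hi: "hom (linj C (Y # xs) j) ((Y # xs) ! j) ?L" "hom (lproj C (Y # xs) j) ?L ((Y # xs) ! j)"
      if "j < length (Y # xs)" for j
      using IH[of j] that by auto
    have homs: "hom (linj C (X # Y # xs) i) ((X # Y # xs) ! i) (lsum C (X # Y # xs)) \<and>
        hom (lproj C (X # Y # xs) i) (lsum C (X # Y # xs)) ((X # Y # xs) ! i)" if "i < length (X # Y # xs)"
    proof (cases i)
      case 0
      then show ?thesis using h by simp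
    next
      case (Suc j)
      then have "j < length (Y # xs)" using that by simp
      then show ?thesis using Suc hom_comp[OF hi(1) h(2)] hom_comp[OF h(4) hi(2)] by simp
    qed
    have "lproj C (X # Y # xs) r \<cdot> linj C (X # Y # xs) s =
        (if r = s then ide ((X # Y # xs) ! s) else zero ((X # Y # xs) ! s) ((X # Y # xs) ! r))"
      if lt: "r < length (X # Y # xs)" "s < length (X # Y # xs)"
    proof (cases r; cases s)
      assume "r = 0" "s = 0"
      then show ?thesis using h by simp
    next
      fix s' assume s: "r = 0" "s = Suc s'"
      then have l: "s' < length (Y # xs)" using lt by simp
      show ?thesis using s comp_assoc[OF hi(1)[OF l] h(2,3)] h(7) comp_zero_left[OF hi(1)[OF l] O(1)]
        by simp
    next
      fix r' assume s: "r = Suc r'" "s = 0"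
      then have l: "r' < length (Y # xs)" using lt by simp
      show ?thesis using s comp_assoc[OF h(1,4) hi(2)[OF l]] h(8) comp_zero_right[OF hi(2)[OF l] O(1)]
        by simp
    next
      fix r' s' assume s: "r = Suc r'" "s = Suc s'"
      then have l: "r' < length (Y # xs)" "s' < length (Y # xs)" using lt by simp_all
      have "(lproj C (Y # xs) r' \<cdot> bpP2 C X ?L) \<cdot> bpI2 C X ?L \<cdot> linj C (Y # xs) s' =
          lproj C (Y # xs) r' \<cdot> linj C (Y # xs) s'"
        by (rule comp_cancel_mid[OF hi(1)[OF l(2)] h(2,4,6) hi(2)[OF l(1)]])
      then show ?thesis using s IH[of _ r' s'] l by auto
    qed
    with homs show ?case by (intro conjI[of "_ \<longrightarrow> _"] impI) (rule homs, assumption, elim conjE)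
  qed
  note all = this[of i r s]
  from all show "i < length xs \<Longrightarrow> hom (linj C xs i) (xs ! i) (lsum C xs)" by simp
  from all show "i < length xs \<Longrightarrow> hom (lproj C xs i) (lsum C xs) (xs ! i)" by simp
  from all show "r < length xs \<Longrightarrow> s < length xs \<Longrightarrow>
      lproj C xs r \<cdot> linj C xs s = (if r = s then ide (xs ! s) else zero (xs ! s) (xs ! r))" by simp
qed

lemma bp_lsum2:
  assumes "A \<in> Ob C" "B \<in> Ob C"
  shows "bp A B (lsum C [A, B]) (linj C [A, B] 0) (linj C [A, B] 1) (lproj C [A, B] 0) (lproj C [A, B] 1)"
  using bp_chosen[OF assms] bpD(2,4)[OF bp_chosen[OF assms]] by (simp add: ide_left ide_right)

text \<open>Lists of this shape occur in the middle degrees of D, where the third summand is a zero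
  object that remains in the list.\<close>

lemma bp_lsum3:
  assumes "A \<in> Ob C" "B \<in> Ob C"
  shows "bp A B (lsum C [A, B, Z]) (linj C [A, B, Z] 0) (linj C [A, B, Z] 1)
    (lproj C [A, B, Z] 0) (lproj C [A, B, Z] 1)"
  using bp_absorb_zero[OF bp_chosen bp_chosen[OF assms(2) zobj_Ob] zobj_zero, OF assms(1)]
    lsum_Ob[of "[B, Z]"] assms zobj_Ob by simp

lemma linj_lproj_zero: "A \<in> Ob C \<Longrightarrow> linj C [A, Z] 0 \<cdot> lproj C [A, Z] 0 = ide (lsum C [A, Z])"
  using bp_zero_inverse[OF bp_chosen[OF _ zobj_Ob] zobj_zero] by simp

section \<open>Matrix morphisms and their entries\<close>

lemma hom_msum:
  assumes "S \<in> Ob C" "T \<in> Ob C" "\<forall>f\<in>set fs. hom f S T"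
  shows "hom (msum C S T fs) S T"
  using assms(3) by (induction fs) (use assms in auto)

lemma comp_msum:
  assumes "\<forall>f\<in>set fs. hom f S T" "hom g T T'" "hom e S' S"
  shows "g \<cdot> msum C S T fs \<cdot> e = msum C S' T' (map (\<lambda>f. g \<cdot> f \<cdot> e) fs)"
  using assms(1)
proof (induction fs)
  case Nil
  then show ?case using comp_zero_left[OF assms(3) homD(1)[OF assms(2)]]
      comp_zero_right[OF assms(2) homD(1)[OF assms(3)]] by simp
next
  case (Cons f fs)
  have h: "hom f S T" "hom (msum C S T fs) S T"
    using Cons(2) hom_msum[of S T fs] homD[OF assms(2)] homD[OF assms(3)] by auto
  show ?case
    using Cons comp_add_left[OF assms(3) h] comp_add_right[OF hom_comp[OF assms(3) h(1)] hom_comp[OF assms(3) h(2)] assms(2)]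
    by simp
qed

lemma msum_append:
  assumes "S \<in> Ob C" "T \<in> Ob C" "\<forall>f\<in>set fs. hom f S T" "\<forall>f\<in>set gs. hom f S T"
  shows "msum C S T (fs @ gs) = msum C S T fs \<oplus> msum C S T gs"
  using assms(3)
proof (induction fs)
  case Nil
  then show ?case using add_zero_left[OF hom_msum[OF assms(1,2,4)]] by simp
next
  case (Cons f fs)
  then show ?case using add_assoc[of f S T, OF _ hom_msum[OF assms(1,2), of fs] hom_msum[OF assms(1,2,4)]] by simp
qed

lemma msum_concat:
  assumes "S \<in> Ob C" "T \<in> Ob C" "\<forall>fs\<in>set fss. \<forall>f\<in>set fs. hom f S T"
  shows "msum C S T (concat fss) = msum C S T (map (msum C S T) fss)"
  using assms(3) by (induction fss) (use assms msum_append in auto)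

lemma msum_single:
  assumes "S \<in> Ob C" "T \<in> Ob C" "distinct is" "i \<in> set is" "hom (x i) S T"
    "\<And>j. j \<in> set is \<Longrightarrow> j \<noteq> i \<Longrightarrow> x j = zero S T"
  shows "msum C S T (map x is) = x i"
proof -
  have z: "msum C S T (map x js) = zero S T" if "\<forall>j\<in>set js. x j = zero S T" for js
    using that by (induction js) (use assms(1,2) add_zero_left hom_zero in auto)
  show ?thesis using assms(3,4,6)
  proof (induction "is")
    case (Cons k js)
    show ?case
    proof (cases "k = i")
      case True
      then have "\<forall>j\<in>set js. x j = zero S T" using Cons by auto
      then show ?thesis using z True add_zero_right[OF assms(5)] by simp
    next
      case False
      then show ?thesis using Cons add_zero_left[OF assms(5)] by simp
    qed
  qed simp
qed

text \<open>Inclusions and projections are parameters because the target may be \<Sigma> of a list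
  sum, whose inclusions are images under \<Sigma>. Orthogonality kills every term of the double sum
  except the one at (r, s).\<close>

lemma matg:
  assumes O: "S \<in> Ob C" "T \<in> Ob C"
    and ins: "\<And>i. i < m \<Longrightarrow> hom (ins i) (Y i) T" and out: "\<And>i. i < m \<Longrightarrow> hom (out i) T (Y i)"
    and prs: "\<And>j. j < k \<Longrightarrow> hom (prs j) S (X j)" and inn: "\<And>j. j < k \<Longrightarrow> hom (inn j) (X j) S"
    and M: "\<And>i j. i < m \<Longrightarrow> j < k \<Longrightarrow> hom (M i j) (X j) (Y i)"
    and out_ins: "\<And>i r. i < m \<Longrightarrow> r < m \<Longrightarrow> out r \<cdot> ins i = (if r = i then ide (Y i) else zero (Y i) (Y r))"
    and prs_inn: "\<And>j s. j < k \<Longrightarrow> s < k \<Longrightarrow> prs j \<cdot> inn s = (if j = s then ide (X s) else zero (X s) (X j))"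
  shows hom_matg: "hom (matg C S T ins prs M m k) S T"
    and matg_entry: "r < m \<Longrightarrow> s < k \<Longrightarrow> out r \<cdot> matg C S T ins prs M m k \<cdot> inn s = M r s"
proof -
  let ?f = "\<lambda>i j. ins i \<cdot> M i j \<cdot> prs j"
  let ?fs = "concat (map (\<lambda>i. map (?f i) [0..<k]) [0..<m])"
  have mg: "matg C S T ins prs M m k = msum C S T ?fs"
    by (simp add: matg_def)
  have hf: "hom (?f i j) S T" if "i < m" "j < k" for i j
    using ins prs M that by blast
  have hfs: "\<forall>f\<in>set ?fs. hom f S T"
    using hf by auto
  show "hom (matg C S T ins prs M m k) S T"
    unfolding mg using hom_msum[OF O hfs] .
  show "out r \<cdot> matg C S T ins prs M m k \<cdot> inn s = M r s" if r: "r < m" and s: "s < k"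
  proof -
    let ?e = "\<lambda>i j. out r \<cdot> ?f i j \<cdot> inn s"
    have O': "X s \<in> Ob C" "Y r \<in> Ob C" using inn[OF s] ins[OF r] homD by blast+
    have he: "hom (?e i j) (X s) (Y r)" if "i < m" "j < k" for i j
      using hf[OF that] out[OF r] inn[OF s] by blast
    \<comment> \<open>Regrouping isolates the two Kronecker factors, one for the row and one for the
      column.\<close>
    have e: "?e i j = (out r \<cdot> ins i) \<cdot> M i j \<cdot> (prs j \<cdot> inn s)" if "i < m" "j < k" for i j
      using comp_assoc[OF inn[OF s] hom_comp[OF prs[OF that(2)] M[OF that]] ins[OF that(1)]]
        comp_assoc[OF inn[OF s] prs[OF that(2)] M[OF that]]
        comp_assoc[OF hom_comp[OF hom_comp[OF inn[OF s] prs[OF that(2)]] M[OF that]] ins[OF that(1)] out[OF r]]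
      by simp
    have e0: "?e i j = zero (X s) (Y r)" if "i < m" "j < k" "i \<noteq> r \<or> j \<noteq> s" for i j
    proof (cases "i = r")
      case False
      have "hom (M i j \<cdot> (prs j \<cdot> inn s)) (X s) (Y i)" using M prs inn s that by blast
      then show ?thesis using e[OF that(1,2)] out_ins[OF that(1) r] False comp_zero_left O' by auto
    next
      case True
      then have "M i j \<cdot> (prs j \<cdot> inn s) = zero (X s) (Y i)"
        using prs_inn[OF that(2) s] that(3) comp_zero_right[OF M[OF that(1,2)] O'(1)] by auto
      then show ?thesis using e[OF that(1,2)] True out_ins[OF r r] comp_zero_right[OF hom_ide O'(1)] O' by auto
    qed
    have e1: "?e r s = M r s"
      using e[OF r s] out_ins[OF r r] prs_inn[OF s s] ide_left[OF M[OF r s]] ide_right[OF M[OF r s]] by simp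
    have "out r \<cdot> msum C S T ?fs \<cdot> inn s = msum C (X s) (Y r) (map (\<lambda>f. out r \<cdot> f \<cdot> inn s) ?fs)"
      by (rule comp_msum[OF hfs out[OF r] inn[OF s]])
    also have "\<dots> = msum C (X s) (Y r) (concat (map (\<lambda>i. map (?e i) [0..<k]) [0..<m]))"
      by (simp add: map_concat comp_def)
    also have "\<dots> = msum C (X s) (Y r) (map (msum C (X s) (Y r)) (map (\<lambda>i. map (?e i) [0..<k]) [0..<m]))"
      by (rule msum_concat[OF O']) (use he in auto)
    also have "\<dots> = msum C (X s) (Y r) (map (\<lambda>i. msum C (X s) (Y r) (map (?e i) [0..<k])) [0..<m])"
      by (simp add: comp_def)
    also have "map (\<lambda>i. msum C (X s) (Y r) (map (?e i) [0..<k])) [0..<m] = map (\<lambda>i. ?e i s) [0..<m]"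
    proof (rule map_cong[OF refl])
      fix i assume "i \<in> set [0..<m]"
      then have i: "i < m" by simp
      show "msum C (X s) (Y r) (map (?e i) [0..<k]) = ?e i s"
        by (rule msum_single[OF O']) (use s i he e0 in auto)
    qed
    also have "msum C (X s) (Y r) (map (\<lambda>i. ?e i s) [0..<m]) = ?e r s"
      by (rule msum_single[OF O']) (use s r he e0 in auto)
    finally show ?thesis using mg e1 by simp
  qed
qed

lemma mat:
  assumes "set xs \<subseteq> Ob C" "set ys \<subseteq> Ob C"
    and "\<And>r s. r < length ys \<Longrightarrow> s < length xs \<Longrightarrow> hom (M r s) (xs ! s) (ys ! r)"
  shows hom_mat: "hom (mat C xs ys M) (lsum C xs) (lsum C ys)"
    and mat_entry: "r < length ys \<Longrightarrow> s < length xs \<Longrightarrow> lproj C ys r \<cdot> mat C xs ys M \<cdot> linj C xs s = M r s"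
  unfolding mat_def
  using hom_linj lproj_linj hom_lproj lsum_Ob assms
  by (auto intro!: hom_matg[where out = "lproj C ys" and inn = "linj C xs" and X = "(!) xs" and Y = "(!) ys"]
      matg_entry[where X = "(!) xs" and Y = "(!) ys"])

end

section \<open>Additivity of the automorphism\<close>

locale additive_cat_auto = additive_cat C for C :: "('o,'m) addcat" +
  fixes SO :: "'o \<Rightarrow> 'o" and SM :: "'m \<Rightarrow> 'm"
  assumes auto: "is_automorphism C SO SM"
begin

lemma SO_Ob: "A \<in> Ob C \<Longrightarrow> SO A \<in> Ob C"
  using auto unfolding is_automorphism_def bij_betw_def by blast

lemma SO_surj: "B \<in> Ob C \<Longrightarrow> \<exists>A\<in>Ob C. B = SO A"
  using auto unfolding is_automorphism_def bij_betw_def by blast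

lemma SM_bij: "A \<in> Ob C \<Longrightarrow> B \<in> Ob C \<Longrightarrow> bij_betw SM (Hom C A B) (Hom C (SO A) (SO B))"
  using auto unfolding is_automorphism_def by blast

lemma hom_SM [intro]: "hom f A B \<Longrightarrow> hom (SM f) (SO A) (SO B)"
  using SM_bij SO_Ob unfolding hom_def bij_betw_def by blast

lemma SM_surj: "hom f (SO A) (SO B) \<Longrightarrow> A \<in> Ob C \<Longrightarrow> B \<in> Ob C \<Longrightarrow> \<exists>g. hom g A B \<and> f = SM g"
  using SM_bij unfolding hom_def bij_betw_def by blast

lemma SM_ide: "A \<in> Ob C \<Longrightarrow> SM (ide A) = ide (SO A)"
  using auto unfolding is_automorphism_def by blast

lemma SM_comp: "hom f A B \<Longrightarrow> hom g B D \<Longrightarrow> SM (g \<cdot> f) = SM g \<cdot> SM f"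
  using auto[unfolded is_automorphism_def, THEN conjunct2, THEN conjunct2, THEN conjunct2, rule_format, of A B D f g]
  unfolding hom_def by simp

text \<open>Every object is \<Sigma> of some object, and \<Sigma> is bijective on hom-sets, so the
  hom-sets into and out of \<open>SO Z\<close> are again singletons.\<close>

lemma SO_zero_obj: "is_zero_obj C (SO Z)"
proof -
  have tr: "\<exists>!y. y \<in> B" if bij: "bij_betw F A B" and ex1: "\<exists>!x. x \<in> A"
    for F :: "'m \<Rightarrow> 'm" and A B
  proof -
    obtain a where "A = {a}" using ex1 by blast
    then have "B = {F a}" using bij by (simp add: bij_betw_def)
    then show ?thesis by simp
  qed
  have "(\<exists>!f. f \<in> Hom C X (SO Z)) \<and> (\<exists>!f. f \<in> Hom C (SO Z) X)" if X: "X \<in> Ob C" for X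
  proof -
    obtain Y where Y: "Y \<in> Ob C" "X = SO Y" using SO_surj[OF X] by blast
    have u: "\<exists>!f. f \<in> Hom C Y Z" "\<exists>!f. f \<in> Hom C Z Y"
      using zobj_zero Y unfolding is_zero_obj_def by blast+
    show ?thesis
      using tr[OF SM_bij[OF Y(1) zobj_Ob] u(1)] tr[OF SM_bij[OF zobj_Ob Y(1)] u(2)] unfolding Y(2) by simp
  qed
  then show ?thesis using SO_Ob zobj_Ob unfolding is_zero_obj_def by blast
qed

text \<open>Zero arrows are exactly those that factor through a zero object, and this description is
  preserved by a bare functor that preserves zero objects.\<close>

lemma SM_zero:
  assumes "A \<in> Ob C" "B \<in> Ob C"
  shows "SM (zero A B) = zero (SO A) (SO B)"
proof -
  have h: "hom (zero A Z) A Z" "hom (zero Z B) Z B" using assms zobj_Ob by auto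
  have "zero A B = zero Z B \<cdot> zero A Z" using comp_through_zero[OF zobj_zero h] by simp
  then show ?thesis using SM_comp[OF h] comp_through_zero[OF SO_zero_obj hom_SM[OF h(1)] hom_SM[OF h(2)]] by simp
qed

text \<open>\<open>\<Sigma>\<close> is only assumed to be an automorphism of the bare category. Full faithfulness makes
  \<open>\<Sigma>p1\<close>, \<open>\<Sigma>p2\<close> jointly monic, which forces biproducts, and hence addition, to be preserved.\<close>
lemma bp_SM:
  assumes b: "bp A B S i1 i2 p1 p2"
  shows "bp (SO A) (SO B) (SO S) (SM i1) (SM i2) (SM p1) (SM p2)"
proof -
  note h = bpD[OF b]
  have O: "A \<in> Ob C" "B \<in> Ob C" "S \<in> Ob C" using h homD by blast+
  note S = h(1-4)[THEN hom_SM]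
  have c: "SM p1 \<cdot> SM i1 = ide (SO A)" "SM p2 \<cdot> SM i2 = ide (SO B)"
    "SM p1 \<cdot> SM i2 = zero (SO B) (SO A)" "SM p2 \<cdot> SM i1 = zero (SO A) (SO B)"
    using SM_comp[OF h(1,3)] SM_comp[OF h(2,4)] SM_comp[OF h(2,3)] SM_comp[OF h(1,4)] h(5-8)
      SM_ide SM_zero O by simp_all
  let ?e = "SM i1 \<cdot> SM p1 \<oplus> SM i2 \<cdot> SM p2"
  have ip: "hom (SM i1 \<cdot> SM p1) (SO S) (SO S)" "hom (SM i2 \<cdot> SM p2) (SO S) (SO S)" using S by blast+
  have e: "hom ?e (SO S) (SO S)" using ip by blast
  obtain e' where e': "hom e' S S" "?e = SM e'" using SM_surj[OF e] O by blast
  have 1: "SM p1 \<cdot> ?e = SM p1"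
    using comp_add_right[OF ip S(3)] comp_assoc[OF S(3,1,3)] comp_assoc[OF S(4,2,3)] c
      ide_left[OF S(3)] comp_zero_left[OF S(4) SO_Ob[OF O(1)]] add_zero_right[OF S(3)] by simp
  have 2: "SM p2 \<cdot> ?e = SM p2"
    using comp_add_right[OF ip S(4)] comp_assoc[OF S(3,1,4)] comp_assoc[OF S(4,2,4)] c
      ide_left[OF S(4)] comp_zero_left[OF S(3) SO_Ob[OF O(2)]] add_zero_left[OF S(4)] by simp
  have inj: "f = g" if "SM f = SM g" "hom f X Y" "hom g X Y" for f g X Y
    using that SM_bij[of X Y] unfolding hom_def bij_betw_def inj_on_def by blast
  have "p1 \<cdot> e' = p1" "p2 \<cdot> e' = p2"
    using 1 2 SM_comp[OF e'(1) h(3)] SM_comp[OF e'(1) h(4)] e'(2) inj hom_comp[OF e'(1) h(3)]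
      hom_comp[OF e'(1) h(4)] h(3,4) by metis+
  then have "e' = ide S"
    using bp_ext_target[OF b e'(1) hom_ide[OF O(3)]] ide_right h(3,4) by metis
  then have "?e = ide (SO S)" using e' SM_ide O by simp
  then show ?thesis using S c by (auto intro: bpI)
qed

text \<open>The sum f + g is the codiagonal \<open>?n\<close> after the arrow \<open>?d\<close> with
  components f and g. Both are determined by biproduct data, which \<open>bp_SM\<close>
  transports.\<close>

lemma SM_add:
  assumes f: "hom f A B" and g: "hom g A B"
  shows "SM (f \<oplus> g) = SM f \<oplus> SM g"
proof -
  have O: "A \<in> Ob C" "B \<in> Ob C" using f homD by blast+
  obtain S i1 i2 p1 p2 where b: "bp B B S i1 i2 p1 p2" using bp_chosen[OF O(2,2)] by blast
  note h = bpD[OF b] and S = bpD[OF bp_SM[OF b]]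
  let ?d = "i1 \<cdot> f \<oplus> i2 \<cdot> g" and ?n = "p1 \<oplus> p2"
  have if1: "hom (i1 \<cdot> f) A S" "hom (i2 \<cdot> g) A S" using f g h by blast+
  have d: "hom ?d A S" and n: "hom ?n S B" using if1 h by blast+
  have pd: "p1 \<cdot> ?d = f" "p2 \<cdot> ?d = g"
    using comp_add_right[OF if1 h(3)] comp_add_right[OF if1 h(4)] comp_assoc[OF f h(1,3)] comp_assoc[OF f h(1,4)]
      comp_assoc[OF g h(2,3)] comp_assoc[OF g h(2,4)] h(5-8) comp_zero_left[OF f O(2)] comp_zero_left[OF g O(2)]
      ide_left[OF f] ide_left[OF g] add_zero_left[OF g] add_zero_right[OF f] by simp_all
  have nd: "?n \<cdot> ?d = f \<oplus> g" using comp_add_left[OF d h(3,4)] pd by simp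
  have ni: "?n \<cdot> i1 = ide B" "?n \<cdot> i2 = ide B"
    using comp_add_left[OF h(1,3,4)] comp_add_left[OF h(2,3,4)] h(5-8)
      add_zero_left[OF hom_ide[OF O(2)]] add_zero_right[OF hom_ide[OF O(2)]] by simp_all
  have Sn: "SM ?n = SM p1 \<oplus> SM p2"
  proof (rule bp_ext_source[OF bp_SM[OF b]])
    show "hom (SM ?n) (SO S) (SO B)" "hom (SM p1 \<oplus> SM p2) (SO S) (SO B)" using n S by blast+
    show "SM ?n \<cdot> SM i1 = (SM p1 \<oplus> SM p2) \<cdot> SM i1"
      using SM_comp[OF h(1) n] ni comp_add_left[OF S(1,3,4)] S(5,8) SM_ide[OF O(2)]
        add_zero_right[OF hom_ide[OF SO_Ob[OF O(2)]]] by simp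
    show "SM ?n \<cdot> SM i2 = (SM p1 \<oplus> SM p2) \<cdot> SM i2"
      using SM_comp[OF h(2) n] ni comp_add_left[OF S(2,3,4)] S(6,7) SM_ide[OF O(2)]
        add_zero_left[OF hom_ide[OF SO_Ob[OF O(2)]]] by simp
  qed
  show ?thesis
    using SM_comp[OF d n] nd Sn comp_add_left[OF hom_SM[OF d] S(3,4)] SM_comp[OF d h(3)] SM_comp[OF d h(4)] pd
    by simp
qed

lemma SM_neg:
  assumes f: "hom f A B"
  shows "SM (\<ominus> f) = \<ominus> SM f"
  using neg_unique[OF hom_SM[OF f] hom_SM[OF hom_neg[OF f]]] SM_add[OF f hom_neg[OF f]] add_neg_right[OF f]
    SM_zero homD[OF f] by simp

lemma matS:
  assumes "set xs \<subseteq> Ob C" "set ys \<subseteq> Ob C"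
    and "\<And>r s. r < length ys \<Longrightarrow> s < length xs \<Longrightarrow> hom (M r s) (xs ! s) (SO (ys ! r))"
  shows hom_matS: "hom (matS C SO SM xs ys M) (lsum C xs) (SO (lsum C ys))"
    and matS_entry: "r < length ys \<Longrightarrow> s < length xs \<Longrightarrow>
      SM (lproj C ys r) \<cdot> matS C SO SM xs ys M \<cdot> linj C xs s = M r s"
proof -
  have 1: "SM (lproj C ys r) \<cdot> SM (linj C ys i) =
      (if r = i then ide (SO (ys ! i)) else zero (SO (ys ! i)) (SO (ys ! r)))"
    if "i < length ys" "r < length ys" for i r
    using SM_comp[OF hom_linj hom_lproj, of ys i r] assms(2) that lproj_linj[OF assms(2) that(2,1)]
      SM_ide[of "ys ! i"] SM_zero[of "ys ! i" "ys ! r"]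
    by (cases "r = i") (metis SM_comp hom_linj hom_lproj nth_mem subsetD)+
  show "hom (matS C SO SM xs ys M) (lsum C xs) (SO (lsum C ys))"
    "r < length ys \<Longrightarrow> s < length xs \<Longrightarrow> SM (lproj C ys r) \<cdot> matS C SO SM xs ys M \<cdot> linj C xs s = M r s"
    unfolding matS_def
    using hom_linj lproj_linj hom_lproj lsum_Ob SO_Ob assms 1
    by (auto intro!: hom_matg[where out = "\<lambda>i. SM (lproj C ys i)" and inn = "linj C xs" and X = "(!) xs" and Y = "\<lambda>i. SO (ys ! i)"]
      matg_entry[where out = "\<lambda>i. SM (lproj C ys i)" and X = "(!) xs" and Y = "\<lambda>i. SO (ys ! i)"])
qed

end

section \<open>Sums of n-angles along arbitrary biproducts\<close>

locale n_angles = additive_cat_auto C SO SM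
  for C :: "('o,'m) addcat" and SO SM +
  fixes n :: nat and N :: "('o,'m) nseq set"
  assumes n3: "3 \<le> n" and N_seq: "\<forall>S\<in>N. is_seq C SO n S"
    and N1: "N1 C SO SM n N" and N2: "N2 C SO SM n N"
begin

text \<open>Reading \<open>\<Sigma>X 1\<close> as the object at position \<open>n + 1\<close> treats all \<open>n\<close> maps of a sequence uniformly.\<close>
definition nx :: "(nat \<Rightarrow> 'o) \<Rightarrow> nat \<Rightarrow> 'o" where
  "nx X m = (if m < n then X (Suc m) else SO (X 1))"

definition nxm :: "(nat \<Rightarrow> 'm) \<Rightarrow> nat \<Rightarrow> 'm" where
  "nxm f m = (if m < n then f (Suc m) else SM (f 1))"

abbreviation I :: "nat set" where "I \<equiv> {1..n}"

lemma is_seq_iff: "is_seq C SO n (X, a) \<longleftrightarrow> (\<forall>m\<in>I. hom (a m) (X m) (nx X m))"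
proof
  assume s: "is_seq C SO n (X, a)"
  have Ob: "X m \<in> Ob C" if "1 \<le> m" "m \<le> n" for m using s that by (simp add: is_seq_def)
  show "\<forall>m\<in>I. hom (a m) (X m) (nx X m)"
  proof
    fix m assume m: "m \<in> I"
    show "hom (a m) (X m) (nx X m)"
    proof (cases "m < n")
      case True
      then show ?thesis using s m Ob[of m] Ob[of "Suc m"] by (simp add: is_seq_def hom_def nx_def)
    next
      case False
      then have "m = n" using m by simp
      then show ?thesis using s n3 Ob[of n] SO_Ob[OF Ob[of 1]] by (simp add: is_seq_def hom_def nx_def)
    qed
  qed
next
  assume h: "\<forall>m\<in>I. hom (a m) (X m) (nx X m)"
  have "a m \<in> Hom C (X m) (X (Suc m))" if "1 \<le> m" "m < n" for m
    using h[rule_format, of m] that by (simp add: hom_def nx_def)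
  moreover have "a n \<in> Hom C (X n) (SO (X 1))"
    using h[rule_format, of n] n3 by (simp add: hom_def nx_def)
  moreover have "X m \<in> Ob C" if "1 \<le> m" "m \<le> n" for m
    using h[rule_format, of m] that by (simp add: hom_def)
  ultimately show "is_seq C SO n (X, a)" by (simp add: is_seq_def)
qed

lemma N_hom: "(X, a) \<in> N \<Longrightarrow> m \<in> I \<Longrightarrow> hom (a m) (X m) (nx X m)"
  using N_seq is_seq_iff by blast

lemma N_Ob: "(X, a) \<in> N \<Longrightarrow> m \<in> I \<Longrightarrow> X m \<in> Ob C"
  using N_hom homD(1) by blast

lemma nx_Ob: "\<forall>m\<in>I. X m \<in> Ob C \<Longrightarrow> m \<in> I \<Longrightarrow> nx X m \<in> Ob C"
  using SO_Ob n3 by (auto simp: nx_def)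

lemma hom_nx:
  assumes "\<forall>m\<in>I. hom (f m) (X m) (Y m)" "m \<in> I"
  shows "hom (nxm f m) (nx X m) (nx Y m)"
proof (cases "m < n")
  case True
  then show ?thesis using assms(1)[rule_format, of "Suc m"] by (simp add: nx_def nxm_def)
next
  case False
  then show ?thesis using hom_SM[OF assms(1)[rule_format, of 1]] n3 by (simp add: nx_def nxm_def)
qed

text \<open>Position n + 1 is \<Sigma> of position 1, so the case \<open>m = n\<close> rests on
  \<Sigma> preserving biproducts.\<close>

lemma bp_nx:
  assumes "\<forall>m\<in>I. bp (U m) (V m) (X m) (i1 m) (i2 m) (p1 m) (p2 m)" "m \<in> I"
  shows "bp (nx U m) (nx V m) (nx X m) (nxm i1 m) (nxm i2 m) (nxm p1 m) (nxm p2 m)"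
proof (cases "m < n")
  case True
  then show ?thesis using assms(1)[rule_format, of "Suc m"] by (simp add: nx_def nxm_def)
next
  case False
  then show ?thesis using bp_SM[OF assms(1)[rule_format, of 1]] n3 by (simp add: nx_def nxm_def)
qed

lemma nxm_comp:
  assumes "\<forall>m\<in>I. hom (f m) (X m) (Y m)" "\<forall>m\<in>I. hom (g m) (Y m) (W m)" "m \<in> I"
  shows "nxm (\<lambda>m. g m \<cdot> f m) m = nxm g m \<cdot> nxm f m"
  using SM_comp[OF assms(1)[rule_format, of 1] assms(2)[rule_format, of 1]] n3 by (simp add: nxm_def)

lemma nxm_neg:
  assumes "\<forall>m\<in>I. hom (f m) (X m) (Y m)" "m \<in> I"
  shows "nxm (\<lambda>m. \<ominus> f m) m = \<ominus> nxm f m"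
  using SM_neg[OF assms(1)[rule_format, of 1]] n3 by (simp add: nxm_def)

section \<open>Morphisms of sequences\<close>

definition mor :: "(nat \<Rightarrow> 'o) \<Rightarrow> (nat \<Rightarrow> 'm) \<Rightarrow> (nat \<Rightarrow> 'o) \<Rightarrow> (nat \<Rightarrow> 'm) \<Rightarrow> (nat \<Rightarrow> 'm) \<Rightarrow> bool" where
  "mor X a Y b f \<longleftrightarrow> (\<forall>m\<in>I. hom (f m) (X m) (Y m) \<and> nxm f m \<cdot> a m = b m \<cdot> f m)"

lemma seq_mor_iff:
  assumes "\<forall>m\<in>I. X m \<in> Ob C" "\<forall>m\<in>I. Y m \<in> Ob C"
  shows "seq_mor C SO SM n (X, a) (Y, b) f \<longleftrightarrow> mor X a Y b f"
proof
  assume s: "seq_mor C SO SM n (X, a) (Y, b) f"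
  have "hom (f m) (X m) (Y m) \<and> nxm f m \<cdot> a m = b m \<cdot> f m" if m: "m \<in> I" for m
    using s m assms by (cases "m < n") (auto simp: seq_mor_def hom_def nxm_def)
  then show "mor X a Y b f" by (simp add: mor_def)
next
  assume h: "mor X a Y b f"
  have "f m \<in> Hom C (X m) (Y m)" if "1 \<le> m" "m \<le> n" for m
    using h that by (simp add: mor_def hom_def)
  moreover have "f (Suc m) \<cdot> a m = b m \<cdot> f m" if "1 \<le> m" "m < n" for m
    using h[unfolded mor_def, rule_format, of m] that by (simp add: nxm_def)
  moreover have "SM (f 1) \<cdot> a n = b n \<cdot> f n"
    using h[unfolded mor_def, rule_format, of n] n3 by (simp add: nxm_def)
  ultimately show "seq_mor C SO SM n (X, a) (Y, b) f" by (simp add: seq_mor_def)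
qed

lemma mor_hom: "mor X a Y b f \<Longrightarrow> m \<in> I \<Longrightarrow> hom (f m) (X m) (Y m)"
  and mor_eq: "mor X a Y b f \<Longrightarrow> m \<in> I \<Longrightarrow> nxm f m \<cdot> a m = b m \<cdot> f m"
  by (auto simp: mor_def)

lemma mor_eq_lt: "mor X a Y b f \<Longrightarrow> 1 \<le> m \<Longrightarrow> m < n \<Longrightarrow> f (Suc m) \<cdot> a m = b m \<cdot> f m"
  using mor_eq[of X a Y b f m] by (simp add: nxm_def)

lemma mor_eq_n: "mor X a Y b f \<Longrightarrow> SM (f 1) \<cdot> a n = b n \<cdot> f n"
  using mor_eq[of X a Y b f n] n3 by (simp add: nxm_def)

lemma mor_comp:
  assumes f: "mor X a Y b f" and g: "mor Y b W c g"
    and "\<forall>m\<in>I. hom (a m) (X m) (nx X m)" "\<forall>m\<in>I. hom (b m) (Y m) (nx Y m)" "\<forall>m\<in>I. hom (c m) (W m) (nx W m)"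
  shows "mor X a W c (\<lambda>m. g m \<cdot> f m)"
proof -
  have hf: "\<forall>m\<in>I. hom (f m) (X m) (Y m)" and hg: "\<forall>m\<in>I. hom (g m) (Y m) (W m)"
    using f g mor_hom by blast+
  have "nxm (\<lambda>m. g m \<cdot> f m) m \<cdot> a m = c m \<cdot> g m \<cdot> f m" if m: "m \<in> I" for m
  proof -
    have h: "hom (a m) (X m) (nx X m)" "hom (b m) (Y m) (nx Y m)" "hom (c m) (W m) (nx W m)"
      "hom (f m) (X m) (Y m)" "hom (g m) (Y m) (W m)"
      using assms m hf hg by blast+
    note nf = hom_nx[OF hf m] and ng = hom_nx[OF hg m]
    show ?thesis
      using nxm_comp[OF hf hg m] comp_assoc[OF h(1) nf ng] mor_eq[OF f m] comp_assoc[OF h(4,2) ng]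
        mor_eq[OF g m] comp_assoc[OF h(4,5,3)] by simp
  qed
  then show ?thesis using hf hg unfolding mor_def by blast
qed

lemma mor_neg:
  assumes f: "mor X a Y b f"
    and "\<forall>m\<in>I. hom (a m) (X m) (nx X m)" "\<forall>m\<in>I. hom (b m) (Y m) (nx Y m)"
  shows "mor X a Y b (\<lambda>m. \<ominus> f m)"
proof -
  have hf: "\<forall>m\<in>I. hom (f m) (X m) (Y m)" using f mor_hom by blast
  have "nxm (\<lambda>m. \<ominus> f m) m \<cdot> a m = b m \<cdot> \<ominus> f m" if m: "m \<in> I" for m
    using nxm_neg[OF hf m] comp_neg_left[OF _ hom_nx[OF hf m], of "a m" "X m"] comp_neg_right[of "f m" "X m" "Y m" "b m" "nx Y m"]
      assms m hf mor_eq[OF f m] by simp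
  then show ?thesis using hf unfolding mor_def by blast
qed

section \<open>Membership in \<open>N\<close> by comparison of entries\<close>

lemma bp_diag:
  assumes b: "bp U V S i1 i2 p1 p2" and b': "bp U' V' S' j1 j2 q1 q2"
    and a: "hom a U U'" and c: "hom c V V'"
  shows "\<exists>f. hom f S S' \<and> f \<cdot> i1 = j1 \<cdot> a \<and> f \<cdot> i2 = j2 \<cdot> c \<and> q1 \<cdot> f = a \<cdot> p1 \<and> q2 \<cdot> f = c \<cdot> p2"
proof -
  note h = bpD[OF b] and k = bpD[OF b']
  have Ob: "U \<in> Ob C" "V \<in> Ob C" "S \<in> Ob C" "U' \<in> Ob C" "V' \<in> Ob C" "S' \<in> Ob C" using h k homD by blast+
  let ?a = "j1 \<cdot> a \<cdot> p1" and ?c = "j2 \<cdot> c \<cdot> p2"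
  have ap: "hom (a \<cdot> p1) S U'" "hom (c \<cdot> p2) S V'" using a c h by blast+
  have ac: "hom ?a S S'" "hom ?c S S'" using ap k by blast+
  have ja: "hom (j1 \<cdot> a) U S'" "hom (j2 \<cdot> c) V S'" using a c k by blast+
  have ai: "?a \<cdot> i = (j1 \<cdot> a) \<cdot> p1 \<cdot> i" "?c \<cdot> i = (j2 \<cdot> c) \<cdot> p2 \<cdot> i" if "hom i X S" for i X
    using comp_assoc[OF h(3) a k(1)] comp_assoc[OF that h(3) ja(1)] comp_assoc[OF h(4) c k(2)] comp_assoc[OF that h(4) ja(2)]
    by simp_all
  have 1: "(?a \<oplus> ?c) \<cdot> i1 = j1 \<cdot> a"
    using comp_add_left[OF h(1) ac] ai[OF h(1)] h(5,8) ide_right[OF ja(1)] comp_zero_right[OF ja(2) Ob(1)]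
      add_zero_right[OF ja(1)] by simp
  have 2: "(?a \<oplus> ?c) \<cdot> i2 = j2 \<cdot> c"
    using comp_add_left[OF h(2) ac] ai[OF h(2)] h(6,7) ide_right[OF ja(2)] comp_zero_right[OF ja(1) Ob(2)]
      add_zero_left[OF ja(2)] by simp
  have 3: "q1 \<cdot> (?a \<oplus> ?c) = a \<cdot> p1"
    using comp_add_right[OF ac k(3)] comp_assoc[OF ap(1) k(1,3)] comp_assoc[OF ap(2) k(2,3)] k(5,7)
      ide_left[OF ap(1)] comp_zero_left[OF ap(2) Ob(4)] add_zero_right[OF ap(1)] by simp
  have 4: "q2 \<cdot> (?a \<oplus> ?c) = c \<cdot> p2"
    using comp_add_right[OF ac k(4)] comp_assoc[OF ap(1) k(1,4)] comp_assoc[OF ap(2) k(2,4)] k(6,8)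
      ide_left[OF ap(2)] comp_zero_left[OF ap(1) Ob(5)] add_zero_left[OF ap(2)] by simp
  show ?thesis using 1 2 3 4 hom_add[OF ac] by blast
qed

text \<open>The comparison arrow is the diagonal arrow of two identities; the same construction in
  the other direction is its inverse.\<close>

lemma bp_transfer:
  assumes b: "bp U V S i1 i2 p1 p2" and b': "bp U V T j1 j2 q1 q2"
  shows "\<exists>f. is_iso C S T f \<and> hom f S T \<and> f \<cdot> i1 = j1 \<and> f \<cdot> i2 = j2 \<and> q1 \<cdot> f = p1 \<and> q2 \<cdot> f = p2"
proof -
  note h = bpD[OF b] and k = bpD[OF b']
  have Ob: "U \<in> Ob C" "V \<in> Ob C" "S \<in> Ob C" "T \<in> Ob C" using h k homD by blast+
  note ide' = hom_ide[OF Ob(1)] hom_ide[OF Ob(2)]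
  obtain f where f: "hom f S T" "f \<cdot> i1 = j1" "f \<cdot> i2 = j2" "q1 \<cdot> f = p1" "q2 \<cdot> f = p2"
    using bp_diag[OF b b' ide'] ide_left h(3,4) ide_right k(1,2) by metis
  obtain g where g: "hom g T S" "g \<cdot> j1 = i1" "g \<cdot> j2 = i2"
    using bp_diag[OF b' b ide'] ide_right h(1,2) by metis
  have "g \<cdot> f = ide S"
    by (rule bp_ext_source[OF b hom_comp[OF f(1) g(1)] hom_ide[OF Ob(3)]])
      (use comp_assoc[OF h(1) f(1) g(1)] comp_assoc[OF h(2) f(1) g(1)] f g ide_left[OF h(1)] ide_left[OF h(2)] in simp_all)
  moreover have "f \<cdot> g = ide T"
    by (rule bp_ext_source[OF b' hom_comp[OF g(1) f(1)] hom_ide[OF Ob(4)]])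
      (use comp_assoc[OF k(1) g(1) f(1)] comp_assoc[OF k(2) g(1) f(1)] f g ide_left[OF k(1)] ide_left[OF k(2)] in simp_all)
  ultimately have "is_iso C S T f" using f g unfolding is_iso_def hom_def by blast
  then show ?thesis using f by blast
qed

lemma bp_ext:
  assumes b: "bp U V S i1 i2 p1 p2" and b': "bp U' V' T j1 j2 q1 q2" and f: "hom f S T" and g: "hom g S T"
    and "q1 \<cdot> f \<cdot> i1 = q1 \<cdot> g \<cdot> i1" "q1 \<cdot> f \<cdot> i2 = q1 \<cdot> g \<cdot> i2"
    "q2 \<cdot> f \<cdot> i1 = q2 \<cdot> g \<cdot> i1" "q2 \<cdot> f \<cdot> i2 = q2 \<cdot> g \<cdot> i2"
  shows "f = g"
proof (rule bp_ext_source[OF b f g])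
  note h = bpD[OF b]
  show "f \<cdot> i1 = g \<cdot> i1"
    by (rule bp_ext_target[OF b' hom_comp[OF h(1) f] hom_comp[OF h(1) g]]) (use assms in simp_all)
  show "f \<cdot> i2 = g \<cdot> i2"
    by (rule bp_ext_target[OF b' hom_comp[OF h(2) f] hom_comp[OF h(2) g]]) (use assms in simp_all)
qed

lemma iso_in_N:
  assumes "(X, a) \<in> N" "\<forall>m\<in>I. hom (b m) (Y m) (nx Y m)" "mor X a Y b f" "\<forall>m\<in>I. is_iso C (X m) (Y m) (f m)"
  shows "(Y, b) \<in> N"
proof -
  have "seq_mor C SO SM n (X, a) (Y, b) f"
    using seq_mor_iff[of X Y] N_Ob[OF assms(1)] assms(2,3) homD(1) by blast
  then have "seq_iso C SO SM n (X, a) (Y, b) f" using assms(4) by (simp add: seq_iso_def)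
  moreover have "is_seq C SO n (Y, b)" using is_seq_iff assms(2) by blast
  ultimately show ?thesis using N1 assms(1) unfolding N1_def by blast
qed

text \<open>In each degree the two biproducts of \<open>U m\<close> and \<open>V m\<close> have a
  comparison isomorphism. These form a morphism of sequences as soon as the entries of the structure
  maps agree, because an arrow between biproducts is determined by its four entries. Membership in
  \<open>N\<close> thus becomes a comparison of matrices, independent of the sums chosen.\<close>

lemma entries_in_N:
  assumes N: "(X, a) \<in> N" and b: "\<forall>m\<in>I. hom (b m) (Y m) (nx Y m)"
    and bX: "\<forall>m\<in>I. bp (U m) (V m) (X m) (i1 m) (i2 m) (p1 m) (p2 m)"
    and bY: "\<forall>m\<in>I. bp (U m) (V m) (Y m) (j1 m) (j2 m) (q1 m) (q2 m)"
    and e: "\<And>m. m \<in> I \<Longrightarrow> nxm p1 m \<cdot> a m \<cdot> i1 m = nxm q1 m \<cdot> b m \<cdot> j1 m"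
      "\<And>m. m \<in> I \<Longrightarrow> nxm p1 m \<cdot> a m \<cdot> i2 m = nxm q1 m \<cdot> b m \<cdot> j2 m"
      "\<And>m. m \<in> I \<Longrightarrow> nxm p2 m \<cdot> a m \<cdot> i1 m = nxm q2 m \<cdot> b m \<cdot> j1 m"
      "\<And>m. m \<in> I \<Longrightarrow> nxm p2 m \<cdot> a m \<cdot> i2 m = nxm q2 m \<cdot> b m \<cdot> j2 m"
  shows "(Y, b) \<in> N"
proof -
  have "\<exists>f. \<forall>m\<in>I. is_iso C (X m) (Y m) (f m) \<and> hom (f m) (X m) (Y m) \<and> f m \<cdot> i1 m = j1 m \<and> f m \<cdot> i2 m = j2 m \<and>
      q1 m \<cdot> f m = p1 m \<and> q2 m \<cdot> f m = p2 m"
    using bp_transfer[OF bX[rule_format] bY[rule_format]] by (intro bchoice) blast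
  then obtain f where f: "\<forall>m\<in>I. is_iso C (X m) (Y m) (f m)" "\<forall>m\<in>I. hom (f m) (X m) (Y m)"
    "\<forall>m\<in>I. f m \<cdot> i1 m = j1 m" "\<forall>m\<in>I. f m \<cdot> i2 m = j2 m"
    "\<forall>m\<in>I. q1 m \<cdot> f m = p1 m" "\<forall>m\<in>I. q2 m \<cdot> f m = p2 m"
    by blast
  have "mor X a Y b f" unfolding mor_def
  proof (intro ballI conjI)
    fix m assume m: "m \<in> I"
    show fm: "hom (f m) (X m) (Y m)" using f m by blast
    note am = N_hom[OF N m] and bm = b[rule_format, OF m] and nf = hom_nx[OF f(2) m]
    note h = bpD[OF bX[rule_format, OF m]] and k = bpD[OF bp_nx[OF bY m]]
    have q: "\<forall>m\<in>I. hom (q1 m) (Y m) (U m)" "\<forall>m\<in>I. hom (q2 m) (Y m) (V m)" using bY by (auto simp: bp_def)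
    have nq: "nxm q1 m \<cdot> nxm f m = nxm p1 m" "nxm q2 m \<cdot> nxm f m = nxm p2 m"
      using nxm_comp[OF f(2) q(1) m] nxm_comp[OF f(2) q(2) m] f(5,6) m n3
      by (auto simp: nxm_def)
    have L: "q \<cdot> (nxm f m \<cdot> a m) \<cdot> i = (q \<cdot> nxm f m) \<cdot> a m \<cdot> i" if "hom i A (X m)" "hom q (nx Y m) B" for q i A B
      using comp_assoc[OF that(1) am nf] comp_assoc[OF hom_comp[OF that(1) am] nf that(2)] by simp
    have R: "(b m \<cdot> f m) \<cdot> i = b m \<cdot> f m \<cdot> i" if "hom i A (X m)" for i A
      by (rule comp_assoc[OF that fm bm])
    show "nxm f m \<cdot> a m = b m \<cdot> f m"
      by (rule bp_ext[OF bX[rule_format, OF m] bp_nx[OF bY m] hom_comp[OF am nf] hom_comp[OF fm bm]])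
        (use L[OF h(1) k(3)] L[OF h(1) k(4)] L[OF h(2) k(3)] L[OF h(2) k(4)] R[OF h(1)] R[OF h(2)] nq e[OF m] f m in simp_all)
  qed
  then show ?thesis using iso_in_N[OF N b _ f(1)] by blast
qed

text \<open>The closure axiom speaks only about the sums picked by \<open>lsum\<close>; through
  \<open>entries_in_N\<close> any degreewise biproduct serves. This freedom is used to prescribe
  objects and inclusions, and the four morphisms are the handle by which the otherwise anonymous
  maps \<open>b\<close> are computed later.\<close>

lemma dsum_in_N:
  assumes N: "(X, a) \<in> N" "(X', a') \<in> N"
    and bY: "\<forall>m\<in>I. bp (X m) (X' m) (Y m) (i1 m) (i2 m) (p1 m) (p2 m)"
  shows "\<exists>b. (Y, b) \<in> N \<and> mor X a Y b i1 \<and> mor X' a' Y b i2 \<and> mor Y b X a p1 \<and> mor Y b X' a' p2"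
proof -
  have "\<exists>b. \<forall>m\<in>I. hom (b m) (Y m) (nx Y m) \<and> b m \<cdot> i1 m = nxm i1 m \<cdot> a m \<and> b m \<cdot> i2 m = nxm i2 m \<cdot> a' m \<and>
      nxm p1 m \<cdot> b m = a m \<cdot> p1 m \<and> nxm p2 m \<cdot> b m = a' m \<cdot> p2 m"
    using bp_diag[OF bY[rule_format] bp_nx[OF bY] N_hom[OF N(1)] N_hom[OF N(2)]] by (intro bchoice) blast
  then obtain b where b: "\<forall>m\<in>I. hom (b m) (Y m) (nx Y m)"
    "\<forall>m\<in>I. b m \<cdot> i1 m = nxm i1 m \<cdot> a m" "\<forall>m\<in>I. b m \<cdot> i2 m = nxm i2 m \<cdot> a' m"
    "\<forall>m\<in>I. nxm p1 m \<cdot> b m = a m \<cdot> p1 m" "\<forall>m\<in>I. nxm p2 m \<cdot> b m = a' m \<cdot> p2 m"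
    by blast
  have hs: "\<forall>m\<in>I. hom (i1 m) (X m) (Y m)" "\<forall>m\<in>I. hom (i2 m) (X' m) (Y m)"
    "\<forall>m\<in>I. hom (p1 m) (Y m) (X m)" "\<forall>m\<in>I. hom (p2 m) (Y m) (X' m)"
    using bY by (auto simp: bp_def)
  have mors: "mor X a Y b i1" "mor X' a' Y b i2" "mor Y b X a p1" "mor Y b X' a' p2"
    unfolding mor_def using hs b by auto
  let ?D = "\<lambda>m. lsum C [X m, X' m]" and ?xs = "\<lambda>m. [X m, X' m]"
  obtain d where d: "seq_dsum C SO SM n (X, a) (X', a') = (?D, d)"
    by (simp add: seq_dsum_def)
  have dN: "(?D, d) \<in> N"
    using N1 N d unfolding N1_def by metis
  have Ob: "X m \<in> Ob C" "X' m \<in> Ob C" if "m \<in> I" for m using N_Ob N that by blast+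
  have bD: "\<forall>m\<in>I. bp (X m) (X' m) (?D m) (linj C (?xs m) 0) (linj C (?xs m) 1) (lproj C (?xs m) 0) (lproj C (?xs m) 1)"
    using bp_lsum2 Ob by blast
  have ent: "nxm (\<lambda>m. lproj C (?xs m) r) m \<cdot> d m \<cdot> linj C (?xs m) s =
     (if r = 0 \<and> s = 0 then a m else if r = 1 \<and> s = 1 then a' m else if r = 0 then zero (X' m) (nx X m)
      else zero (X m) (nx X' m))" if m: "m \<in> I" and rs: "r < 2" "s < 2" for r s m
  proof (cases "m < n")
    case True
    note h = N_hom[OF N(1) m] N_hom[OF N(2) m]
    have h': "hom (a m) (X m) (X (Suc m))" "hom (a' m) (X' m) (X' (Suc m))" using h True by (auto simp: nx_def)
    have O': "X (Suc m) \<in> Ob C" "X' (Suc m) \<in> Ob C" using Ob[of "Suc m"] True by auto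
    let ?M = "\<lambda>r s. if r = 0 \<and> s = 0 then a m else if r = 1 \<and> s = 1 then a' m else if r = 0 then zero (X' m) (X (Suc m))
      else zero (X m) (X' (Suc m))"
    have "lproj C (?xs (Suc m)) r \<cdot> mat C (?xs m) (?xs (Suc m)) ?M \<cdot> linj C (?xs m) s = ?M r s"
    proof (rule mat_entry)
      show "hom (?M r s) (?xs m ! s) (?xs (Suc m) ! r)" if "r < length (?xs (Suc m))" "s < length (?xs m)" for r s
        using that h' O' Ob[OF m] by (auto simp: less_2_cases_iff less_Suc_eq)
    qed (use Ob[OF m] O' rs in auto)
    moreover have "d m = mat C (?xs m) (?xs (Suc m)) ?M" using d True by (auto simp: seq_dsum_def)
    ultimately show ?thesis using True by (simp add: nxm_def nx_def)
  next
    case False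
    then have mn: "m = n" using m by simp
    note h = N_hom[OF N(1) m] N_hom[OF N(2) m]
    have h': "hom (a n) (X n) (SO (X 1))" "hom (a' n) (X' n) (SO (X' 1))" using h mn by (auto simp: nx_def)
    have O': "X 1 \<in> Ob C" "X' 1 \<in> Ob C" using Ob[of 1] n3 by auto
    let ?M = "\<lambda>r s. if r = 0 \<and> s = 0 then a n else if r = 1 \<and> s = 1 then a' n else if r = 0 then zero (X' n) (SO (X 1))
      else zero (X n) (SO (X' 1))"
    have "SM (lproj C (?xs 1) r) \<cdot> matS C SO SM (?xs n) (?xs 1) ?M \<cdot> linj C (?xs n) s = ?M r s"
    proof (rule matS_entry)
      show "hom (?M r s) (?xs n ! s) (SO (?xs 1 ! r))" if "r < length (?xs 1)" "s < length (?xs n)" for r s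
        using that h' SO_Ob[OF O'(1)] SO_Ob[OF O'(2)] Ob[OF m] mn by (auto simp: less_2_cases_iff less_Suc_eq)
    qed (use Ob[OF m] O' rs mn in auto)
    moreover have "d n = matS C SO SM (?xs n) (?xs 1) ?M" using d by (auto simp: seq_dsum_def)
    ultimately show ?thesis using mn by (simp add: nxm_def nx_def)
  qed
  have "(Y, b) \<in> N"
  proof (rule entries_in_N[OF dN b(1) bD bY])
    fix m assume m: "m \<in> I"
    note h = bpD[OF bY[rule_format, OF m]] and k = bpD[OF bp_nx[OF bY m]]
      and am = N_hom[OF N(1) m] and am' = N_hom[OF N(2) m]
    note bs = b(2-5)[rule_format, OF m]
    show "nxm (\<lambda>m. lproj C (?xs m) 0) m \<cdot> d m \<cdot> linj C (?xs m) 0 = nxm p1 m \<cdot> b m \<cdot> i1 m"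
      using ent[OF m, of 0 0] bs(1) comp_assoc[OF am k(1,3)] k(5) ide_left[OF am] by simp
    show "nxm (\<lambda>m. lproj C (?xs m) 0) m \<cdot> d m \<cdot> linj C (?xs m) 1 = nxm p1 m \<cdot> b m \<cdot> i2 m"
      using ent[OF m, of 0 1] bs(2) comp_assoc[OF am' k(2,3)] k(7) comp_zero_left[OF am' homD(2)[OF am]] by simp
    show "nxm (\<lambda>m. lproj C (?xs m) 1) m \<cdot> d m \<cdot> linj C (?xs m) 0 = nxm p2 m \<cdot> b m \<cdot> i1 m"
      using ent[OF m, of 1 0] bs(1) comp_assoc[OF am k(1,4)] k(8) comp_zero_left[OF am homD(2)[OF am']] by simp
    show "nxm (\<lambda>m. lproj C (?xs m) 1) m \<cdot> d m \<cdot> linj C (?xs m) 1 = nxm p2 m \<cdot> b m \<cdot> i2 m"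
      using ent[OF m, of 1 1] bs(2) comp_assoc[OF am' k(2,4)] k(6) ide_left[OF am'] by simp
  qed
  then show ?thesis using mors by blast
qed


section \<open>Trivial n-angles and their rotations\<close>

lemma triv_in_N:
  assumes "A \<in> Ob C"
  obtains t where "((\<lambda>m. if m \<le> 2 then A else Z), t) \<in> N" "t 1 = ide A"
proof -
  have "((\<lambda>i. if i \<le> 2 then A else Z),
      (\<lambda>i. if i = 1 then ide A else if i < n then zero (if i \<le> 2 then A else Z) Z else zero Z (SO A))) \<in> N"
    using N1[unfolded N1_def, THEN conjunct2, THEN conjunct2, THEN conjunct2, THEN conjunct1] assms by blast
  then show ?thesis by (rule that) simp
qed

text \<open>The factor (-1)^n that the left rotation puts on \<open>g n\<close> is the origin of
  every \<open>sg n\<close> in the entries of D: once through the summand on \<open>A 1\<close>,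
  once through the one on \<open>K\<close>.\<close>

lemma rot_triv_in_N:
  assumes "A \<in> Ob C"
  obtains g where "((\<lambda>m. if m \<le> 1 then A else if m < n then Z else SO A), g) \<in> N" "g n = sg n (ide (SO A))"
proof -
  obtain t where t: "((\<lambda>m. if m \<le> 2 then A else Z), t) \<in> N" "t 1 = ide A"
    using triv_in_N[OF assms] .
  let ?S = "rotl C SO SM n ((\<lambda>m. if m \<le> 2 then A else Z), t)"
  have "(fst ?S, snd ?S) \<in> N"
    using N2 N_seq t(1) unfolding N2_def prod.collapse by blast
  moreover have "fst ?S = (\<lambda>m. if m \<le> 1 then A else if m < n then Z else SO A)"
    using n3 by (auto simp: rotl_def fun_eq_iff)
  moreover have "snd ?S n = sg n (ide (SO A))"
    using t(2) SM_ide[OF assms] by (simp add: rotl_def)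
  ultimately show ?thesis using that[of "snd ?S"] by simp
qed

lemma zero_iso:
  assumes "is_zero_obj C U" "is_zero_obj C V"
  shows "is_iso C U V (zero U V)"
proof -
  have O: "U \<in> Ob C" "V \<in> Ob C" using assms by (auto simp: is_zero_obj_def)
  have h: "hom (zero U V) U V" "hom (zero V U) V U" using O by auto
  have "zero V U \<cdot> zero U V = ide U" "zero U V \<cdot> zero V U = ide V"
    using hom_from_zero_unique[OF assms(1)] hom_from_zero_unique[OF assms(2)] hom_comp[OF h] hom_comp[OF h(2,1)]
      hom_ide[OF O(1)] hom_ide[OF O(2)] by metis+
  then show ?thesis using h unfolding is_iso_def hom_def by blast
qed

lemma ide_iso: "U \<in> Ob C \<Longrightarrow> is_iso C U U (ide U)"
  using ide_left[OF hom_ide] hom_ide unfolding is_iso_def hom_def by blast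

text \<open>Axiom N2 is used backwards. The left rotation of this sequence ends in
  \<open>SO Z\<close> where the trivial n-angle on \<open>B\<close> ends in \<open>Z\<close>; these
  zero objects need not coincide, so an isomorphism has to mediate.\<close>

lemma unrot_triv_in_N:
  assumes B: "B \<in> Ob C"
  obtains r where "((\<lambda>m. if m = 2 \<or> m = 3 then B else Z), r) \<in> N" "r 2 = ide B"
proof -
  obtain t where t: "((\<lambda>m. if m \<le> 2 then B else Z), t) \<in> N" "t 1 = ide B"
    using triv_in_N[OF B] .
  let ?T = "\<lambda>m::nat. if m \<le> 2 then B else Z"
  let ?R = "\<lambda>m::nat. if m = 2 \<or> m = 3 then B else Z"
  let ?r = "\<lambda>m. if m = 2 then ide B else zero (?R m) (nx ?R m)"
  have OR: "\<forall>m\<in>I. ?R m \<in> Ob C" using B zobj_Ob by auto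
  have hr: "\<forall>m\<in>I. hom (?r m) (?R m) (nx ?R m)"
  proof
    fix m assume m: "m \<in> I"
    show "hom (?r m) (?R m) (nx ?R m)"
    proof (cases "m = 2")
      case True
      then show ?thesis using hom_ide[OF B] n3 by (simp add: nx_def)
    next
      case False
      then show ?thesis using hom_zero[OF OR[rule_format, OF m] nx_Ob[OF OR m]] by simp
    qed
  qed
  then have seq: "is_seq C SO n (?R, ?r)" using is_seq_iff by blast
  obtain Y c where Yc: "rotl C SO SM n (?R, ?r) = (Y, c)" by fastforce
  have Y: "Y m = (if m < n then ?R (Suc m) else SO Z)" for m
    using Yc by (auto simp: rotl_def)
  have c: "c m = (if m < n then ?r (Suc m) else sg n (SM (?r 1)))" for m
    using Yc by (auto simp: rotl_def)
  have r1: "hom (?r 1) Z B" using hr[rule_format, of 1] n3 by (simp add: nx_def numeral_2_eq_2)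
  have hc: "\<forall>m\<in>I. hom (c m) (Y m) (nx Y m)"
  proof
    fix m assume m: "m \<in> I"
    consider "Suc m < n" | "Suc m = n" | "m = n" using m by fastforce
    then show "hom (c m) (Y m) (nx Y m)"
    proof cases
      case 1
      then show ?thesis using hr[rule_format, of "Suc m"] unfolding c Y by (simp add: nx_def Y)
    next
      case 2
      then show ?thesis using hr[rule_format, of "Suc m"] unfolding c Y by (simp add: nx_def Y)
    next
      case 3
      have "nx Y n = SO B" using n3 by (simp add: nx_def Y numeral_2_eq_2)
      then show ?thesis using 3 hom_sgn[OF hom_SM[OF r1], of n] unfolding c Y by simp
    qed
  qed
  have YZ: "is_zero_obj C (Y m)" if "3 \<le> m" "m \<le> n" for m
    using that zobj_zero SO_zero_obj by (simp add: Y)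
  let ?f = "\<lambda>m. if m \<le> 2 then ide B else zero Z (Y m)"
  have Y12: "Y 1 = B" "Y 2 = B" using n3 by (simp_all add: Y numeral_2_eq_2 numeral_3_eq_3)
  have iso: "\<forall>m\<in>I. is_iso C (?T m) (Y m) (?f m)"
  proof
    fix m assume m: "m \<in> I"
    then consider "m = 1" | "m = 2" | "3 \<le> m" by fastforce
    then show "is_iso C (?T m) (Y m) (?f m)"
      by cases (use Y12 ide_iso[OF B] zero_iso[OF zobj_zero YZ] m in auto)
  qed
  have hf: "\<forall>m\<in>I. hom (?f m) (?T m) (Y m)"
  proof
    fix m assume m: "m \<in> I"
    have "?T m \<in> Ob C" "Y m \<in> Ob C" using N_Ob[OF t(1) m] homD(1)[OF hc[rule_format, OF m]] by simp_all
    then show "hom (?f m) (?T m) (Y m)" using iso[rule_format, OF m] unfolding is_iso_def hom_def by blast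
  qed
  have "mor ?T t Y c ?f" unfolding mor_def
  proof (intro ballI conjI)
    fix m assume m: "m \<in> I"
    show fm: "hom (?f m) (?T m) (Y m)" using hf m by blast
    have L: "hom (nxm ?f m \<cdot> t m) (?T m) (nx Y m)" using hom_nx[OF hf m] N_hom[OF t(1) m] by blast
    have R: "hom (c m \<cdot> ?f m) (?T m) (nx Y m)" using hc m fm by blast
    \<comment> \<open>Beyond the first degree both composites end in a zero object, or start in one
      when \<open>m = n\<close>, so they agree without computation.\<close>
    consider "m = 1" | "2 \<le> m" "m < n" | "m = n" using m by fastforce
    then show "nxm ?f m \<cdot> t m = c m \<cdot> ?f m"
    proof cases
      case 1
      have "c 1 = ide B" using n3 by (simp add: c numeral_2_eq_2)
      then show ?thesis using 1 t(2) n3 by (simp add: nxm_def)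
    next
      case 2
      then have z: "is_zero_obj C (nx Y m)" using YZ[of "Suc m"] by (simp add: nx_def)
      show ?thesis by (rule trans[OF hom_to_zero_unique[OF z L] hom_to_zero_unique[OF z R, symmetric]])
    next
      case 3
      then have z: "is_zero_obj C (?T m)" using n3 zobj_zero by simp
      show ?thesis by (rule trans[OF hom_from_zero_unique[OF z L] hom_from_zero_unique[OF z R, symmetric]])
    qed
  qed
  then have "(Y, c) \<in> N" using iso_in_N[OF t(1) hc _ iso] by blast
  then have "(?R, ?r) \<in> N" using N2[unfolded N2_def, rule_format, OF seq] Yc by simp
  then show ?thesis by (rule that) simp
qed

end

section \<open>The three n-angles entering (N4*)\<close>

locale square = n_angles C SO SM n N
  for C :: "('o,'m) addcat" and SO SM n N +
  fixes A a B b f1 f2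
  assumes SA: "(A, a) \<in> N" and SB: "(B, b) \<in> N"
    and f1: "hom f1 (A 1) (B 1)" and f2: "hom f2 (A 2) (B 2)" and sq: "f2 \<cdot> a 1 = b 1 \<cdot> f1"
    and N4s: "N4star C SO SM n N"
begin

lemma ObA: "m \<in> I \<Longrightarrow> A m \<in> Ob C" and ObB: "m \<in> I \<Longrightarrow> B m \<in> Ob C"
  using N_Ob SA SB by blast+

lemma Ob123: "A 1 \<in> Ob C" "A 2 \<in> Ob C" "A 3 \<in> Ob C" "B 1 \<in> Ob C" "B 2 \<in> Ob C" "B 3 \<in> Ob C" "B n \<in> Ob C"
  "SO (A 1) \<in> Ob C"
  using ObA ObB SO_Ob n3 by auto

section \<open>Objects and maps of the enlarged composable pair\<close>

abbreviation "P \<equiv> bpO C (A 1) (B 1)"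
abbreviation "iP1 \<equiv> bpI1 C (A 1) (B 1)"
abbreviation "iP2 \<equiv> bpI2 C (A 1) (B 1)"
abbreviation "pP1 \<equiv> bpP1 C (A 1) (B 1)"
abbreviation "pP2 \<equiv> bpP2 C (A 1) (B 1)"
abbreviation "K \<equiv> bpO C (A 2) (B 1)"
abbreviation "iK1 \<equiv> bpI1 C (A 2) (B 1)"
abbreviation "iK2 \<equiv> bpI2 C (A 2) (B 1)"
abbreviation "pK1 \<equiv> bpP1 C (A 2) (B 1)"
abbreviation "pK2 \<equiv> bpP2 C (A 2) (B 1)"
abbreviation "Q \<equiv> bpO C K (B 2)"
abbreviation "iQ1 \<equiv> bpI1 C K (B 2)"
abbreviation "iQ2 \<equiv> bpI2 C K (B 2)"
abbreviation "pQ1 \<equiv> bpP1 C K (B 2)"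
abbreviation "pQ2 \<equiv> bpP2 C K (B 2)"
abbreviation "L \<equiv> bpO C (A 3) (B 2)"
abbreviation "iL1 \<equiv> bpI1 C (A 3) (B 2)"
abbreviation "iL2 \<equiv> bpI2 C (A 3) (B 2)"
abbreviation "pL1 \<equiv> bpP1 C (A 3) (B 2)"
abbreviation "pL2 \<equiv> bpP2 C (A 3) (B 2)"
abbreviation "M \<equiv> bpO C (B n) (SO (A 1))"
abbreviation "iM1 \<equiv> bpI1 C (B n) (SO (A 1))"
abbreviation "iM2 \<equiv> bpI2 C (B n) (SO (A 1))"
abbreviation "pM1 \<equiv> bpP1 C (B n) (SO (A 1))"
abbreviation "pM2 \<equiv> bpP2 C (B n) (SO (A 1))"
text \<open>Inclusion of \<open>A 1\<close> as the graph of -f1. Relative to \<open>u1\<close> and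
  \<open>iP2\<close> the first map of the pair is just a 1 \<oplus> 1 followed by the inclusion of
  \<open>K\<close>: its entry f1 has moved into the decomposition of \<open>P\<close>.\<close>

abbreviation "u1 \<equiv> iP1 \<oplus> \<ominus> (iP2 \<cdot> f1)"
text \<open>The row [-f2, b 1] on \<open>K\<close>. On the column [a 1; f1] it gives -f2 a 1 + b 1
  f1 = 0, which leaves [0, b 1] as composite.\<close>

abbreviation "h \<equiv> b 1 \<cdot> pK2 \<oplus> \<ominus> (f2 \<cdot> pK1)"
abbreviation "e2 \<equiv> h \<cdot> pQ1 \<oplus> pQ2"
text \<open>The graph of -h, which is the kernel of \<open>e2\<close> and is split by
  \<open>pQ1\<close>.\<close>

abbreviation "t \<equiv> iQ1 \<oplus> \<ominus> (iQ2 \<cdot> h)"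

lemma bpP: "bp (A 1) (B 1) P iP1 iP2 pP1 pP2" and bpK: "bp (A 2) (B 1) K iK1 iK2 pK1 pK2"
  and bpL: "bp (A 3) (B 2) L iL1 iL2 pL1 pL2" and bpM: "bp (B n) (SO (A 1)) M iM1 iM2 pM1 pM2"
  using bp_chosen Ob123 by blast+

lemma KOb: "K \<in> Ob C" using homD(2)[OF bpD(1)[OF bpK]] .

lemma bpQ: "bp K (B 2) Q iQ1 iQ2 pQ1 pQ2"
  using bp_chosen KOb Ob123 by blast

lemma POb: "P \<in> Ob C"
  using homD(2)[OF bpD(1)[OF bpP]] .

lemma a_hom: "1 \<le> m \<Longrightarrow> m < n \<Longrightarrow> hom (a m) (A m) (A (Suc m))"
  and b_hom: "1 \<le> m \<Longrightarrow> m < n \<Longrightarrow> hom (b m) (B m) (B (Suc m))"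
  and an_hom: "hom (a n) (A n) (SO (A 1))" and bn_hom: "hom (b n) (B n) (SO (B 1))"
  using N_hom[OF SA, of m] N_hom[OF SB, of m] N_hom[OF SA, of n] N_hom[OF SB, of n] n3 by (auto simp: nx_def)

lemma a1: "hom (a 1) (A 1) (A 2)" and b1: "hom (b 1) (B 1) (B 2)"
  using a_hom[of 1] b_hom[of 1] n3 by (auto simp: numeral_2_eq_2)

lemma h_hom: "hom h K (B 2)"
  using bpD[OF bpK] f2 b1 by blast

lemma bpP': "bp (A 1) (B 1) P u1 iP2 pP1 (f1 \<cdot> pP1 \<oplus> pP2)"
  by (rule bp_twist[OF bpP f1])

lemma bpQ': "bp K (B 2) Q t iQ2 pQ1 e2"
  by (rule bp_twist[OF bpQ h_hom])

lemma h_iK: "h \<cdot> iK1 = \<ominus> f2" "h \<cdot> iK2 = b 1"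
proof -
  note k = bpD[OF bpK]
  have x: "hom (b 1 \<cdot> pK2) K (B 2)" "hom (f2 \<cdot> pK1) K (B 2)" using k f2 b1 by blast+
  show "h \<cdot> iK1 = \<ominus> f2"
    using comp_add_left[OF k(1) x(1) hom_neg[OF x(2)]] comp_neg_left[OF k(1) x(2)] comp_assoc[OF k(1,3) f2]
      comp_assoc[OF k(1,4) b1] k(5,8) ide_right[OF f2] comp_zero_right[OF b1 Ob123(2)] add_zero_left[OF hom_neg[OF f2]]
    by simp
  show "h \<cdot> iK2 = b 1"
    using comp_add_left[OF k(2) x(1) hom_neg[OF x(2)]] comp_neg_left[OF k(2) x(2)] comp_assoc[OF k(2,3) f2]
      comp_assoc[OF k(2,4) b1] k(6,7) ide_right[OF b1] comp_zero_right[OF f2 Ob123(4)] add_zero_right[OF b1]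
      neg_zero[OF Ob123(4,5)] by simp
qed

lemma e2_hom: "hom e2 Q (B 2)" using bpD(4)[OF bpQ'] .

lemma e2_iQ1: "e2 \<cdot> iQ1 = h"
proof -
  note k = bpD[OF bpQ]
  show ?thesis
    using comp_add_left[OF k(1) hom_comp[OF k(3) h_hom] k(4)] comp_assoc[OF k(1,3) h_hom] k(5,8) ide_right[OF h_hom]
      add_zero_right[OF h_hom] by simp
qed

definition A' where "A' m = (if m = 1 then P else if m = 2 then Q else if m = 3 then L else A m)"
text \<open>Inclusion \<open>u\<close> and retraction \<open>v\<close> of the summand A. From degree
  4 on the two added n-angles are zero, so no new object is formed there and both are
  identities.\<close>

definition u where "u m = (if m = 1 then u1 else if m = 2 then iQ1 \<cdot> iK1 else if m = 3 then iL1 else ide (A m))"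
definition v where "v m = (if m = 1 then pP1 else if m = 2 then pK1 \<cdot> pQ1 else if m = 3 then pL1 else ide (A m))"

lemma mor_cong: "mor X c Y d f \<Longrightarrow> (\<And>m. m \<in> I \<Longrightarrow> f m = f' m) \<Longrightarrow> mor X c Y d f'"
  using n3 unfolding mor_def nxm_def by auto

text \<open>A direct sum of sequences has diagonal maps; the entry f1 of \<open>a' 1\<close> arises
  only because degree 1 is decomposed by the twisted data \<open>bpP'\<close>. The equations
  exported here are all that is needed about the added summands.\<close>

lemma A'_ex:
  obtains a' where "(A', a') \<in> N" "mor A a A' a' u" "mor A' a' A a v"
    "a' 1 \<cdot> iP2 = iQ1 \<cdot> iK2" "(pK2 \<cdot> pQ1) \<cdot> a' 1 = f1 \<cdot> pP1 \<oplus> pP2"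
    "a' 2 \<cdot> iQ2 = iL2" "pL2 \<cdot> a' 2 = pQ2"
proof -
  obtain tb where tb: "((\<lambda>m. if m \<le> 2 then B 1 else Z), tb) \<in> N" "tb 1 = ide (B 1)"
    using triv_in_N[OF Ob123(4)] .
  \<comment> \<open>Intermediate sequence: A plus the trivial n-angle on \<open>B 1\<close>, with
    \<open>B 2\<close> not yet adjoined.\<close>
  define F where "F m = (if m = 1 then P else if m = 2 then K else A m)" for m
  define i1 where "i1 m = (if m = 1 then u1 else if m = 2 then iK1 else ide (A m))" for m
  define i2 where "i2 m = (if m = 1 then iP2 else if m = 2 then iK2 else zero Z (A m))" for m
  define p1 where "p1 m = (if m = 1 then pP1 else if m = 2 then pK1 else ide (A m))" for m
  define p2 where "p2 m = (if m = 1 then f1 \<cdot> pP1 \<oplus> pP2 else if m = 2 then pK2 else zero (A m) Z)" for m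
  note F_defs = F_def i1_def i2_def p1_def p2_def
  have "\<forall>m\<in>I. bp (A m) (if m \<le> 2 then B 1 else Z) (F m) (i1 m) (i2 m) (p1 m) (p2 m)"
  proof
    fix m assume m: "m \<in> I"
    then consider "m = 1" | "m = 2" | "3 \<le> m" by fastforce
    then show "bp (A m) (if m \<le> 2 then B 1 else Z) (F m) (i1 m) (i2 m) (p1 m) (p2 m)"
      by cases (use bpP' bpK bp_zero_right[OF zobj_zero ObA[OF m]] in \<open>auto simp: F_defs\<close>)
  qed
  from dsum_in_N[OF SA tb(1) this] obtain fm where F: "(F, fm) \<in> N" "mor A a F fm i1"
    "mor (\<lambda>m. if m \<le> 2 then B 1 else Z) tb F fm i2" "mor F fm A a p1"
    "mor F fm (\<lambda>m. if m \<le> 2 then B 1 else Z) tb p2"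
    by blast
  obtain r where r: "((\<lambda>m. if m = 2 \<or> m = 3 then B 2 else Z), r) \<in> N" "r 2 = ide (B 2)"
    using unrot_triv_in_N[OF Ob123(5)] .
  \<comment> \<open>The second sum adjoins \<open>B 2\<close> in degrees 2 and 3; the other degrees
    acquire a zero summand and keep their object.\<close>
  define j1 where "j1 m = (if m = 1 then ide P else if m = 2 then iQ1 else if m = 3 then iL1 else ide (A m))" for m
  define j2 where "j2 m = (if m = 1 then zero Z P else if m = 2 then iQ2 else if m = 3 then iL2 else zero Z (A m))" for m
  define q1 where "q1 m = (if m = 1 then ide P else if m = 2 then pQ1 else if m = 3 then pL1 else ide (A m))" for m
  define q2 where "q2 m = (if m = 1 then zero P Z else if m = 2 then pQ2 else if m = 3 then pL2 else zero (A m) Z)" for m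
  note A_defs = A'_def j1_def j2_def q1_def q2_def F_def
  have "\<forall>m\<in>I. bp (F m) (if m = 2 \<or> m = 3 then B 2 else Z) (A' m) (j1 m) (j2 m) (q1 m) (q2 m)"
  proof
    fix m assume m: "m \<in> I"
    then consider "m = 1" | "m = 2" | "m = 3" | "4 \<le> m" by fastforce
    then show "bp (F m) (if m = 2 \<or> m = 3 then B 2 else Z) (A' m) (j1 m) (j2 m) (q1 m) (q2 m)"
      by cases (use bpQ bpL bp_zero_right[OF zobj_zero ObA[OF m]] bp_zero_right[OF zobj_zero POb] in \<open>auto simp: A_defs\<close>)
  qed
  from dsum_in_N[OF F(1) r(1) this] obtain a' where A': "(A', a') \<in> N" "mor F fm A' a' j1"
    "mor (\<lambda>m. if m = 2 \<or> m = 3 then B 2 else Z) r A' a' j2" "mor A' a' F fm q1"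
    "mor A' a' (\<lambda>m. if m = 2 \<or> m = 3 then B 2 else Z) r q2"
    by blast
  note hA = N_hom[OF SA] and hF = N_hom[OF F(1)] and hA' = N_hom[OF A'(1)]
  have "mor A a A' a' (\<lambda>m. j1 m \<cdot> i1 m)"
    by (rule mor_comp[OF F(2) A'(2)]) (use hA hF hA' in blast)+
  then have u: "mor A a A' a' u"
  proof (rule mor_cong)
    fix m assume m: "m \<in> I"
    show "j1 m \<cdot> i1 m = u m"
      using ide_left[OF bpD(1)[OF bpP']] ide_right[OF bpD(1)[OF bpL]] ide_left[OF hom_ide[OF ObA[OF m]]]
      by (auto simp: j1_def i1_def u_def)
  qed
  have "mor A' a' A a (\<lambda>m. p1 m \<cdot> q1 m)"
    by (rule mor_comp[OF A'(4) F(4)]) (use hA hF hA' in blast)+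
  then have v: "mor A' a' A a v"
  proof (rule mor_cong)
    fix m assume m: "m \<in> I"
    show "p1 m \<cdot> q1 m = v m"
      using ide_right[OF bpD(3)[OF bpP']] ide_left[OF bpD(3)[OF bpL]] ide_left[OF hom_ide[OF ObA[OF m]]]
      by (auto simp: q1_def p1_def v_def)
  qed
  have fm1: "hom (fm 1) P K" using hF[of 1] n3 by (simp add: F_def nx_def)
  have a'1: "hom (a' 1) P Q" using hA'[of 1] n3 by (simp add: A'_def nx_def)
  have x: "a' 1 = iQ1 \<cdot> fm 1"
    using mor_eq_lt[OF A'(2), of 1] n3 ide_right[OF a'1] by (simp add: j1_def)
  have y: "fm 1 \<cdot> iP2 = iK2"
    using mor_eq_lt[OF F(3), of 1] n3 tb(2) ide_right[OF bpD(2)[OF bpK]] by (simp add: i2_def)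
  have 1: "a' 1 \<cdot> iP2 = iQ1 \<cdot> iK2"
    using x y comp_assoc[OF bpD(2)[OF bpP] fm1 bpD(1)[OF bpQ]] by simp
  have z: "pQ1 \<cdot> a' 1 = fm 1"
    using mor_eq_lt[OF A'(4), of 1] n3 ide_right[OF fm1] by (simp add: q1_def)
  have w: "pK2 \<cdot> fm 1 = f1 \<cdot> pP1 \<oplus> pP2"
    using mor_eq_lt[OF F(5), of 1] n3 tb(2) ide_left[OF bpD(4)[OF bpP']] by (simp add: p2_def)
  have 2: "(pK2 \<cdot> pQ1) \<cdot> a' 1 = f1 \<cdot> pP1 \<oplus> pP2"
    using comp_assoc[OF a'1 bpD(3)[OF bpQ] bpD(4)[OF bpK]] z w by simp
  have 3: "a' 2 \<cdot> iQ2 = iL2"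
    using mor_eq_lt[OF A'(3), of 2] n3 r(2) ide_right[OF bpD(2)[OF bpL]] by (simp add: j2_def)
  have 4: "pL2 \<cdot> a' 2 = pQ2"
    using mor_eq_lt[OF A'(5), of 2] n3 r(2) ide_left[OF bpD(4)[OF bpQ]] by (simp add: q2_def)
  show ?thesis using that[OF A'(1) u v 1 2 3 4] .
qed

text \<open>Only degrees 1 and n differ from B. The pairs \<open>x\<close>, \<open>y\<close> and
  \<open>x'\<close>, \<open>y'\<close> are the inclusions and projections of the summands B and
  \<open>G\<close>.\<close>

definition B' where "B' m = (if m \<le> 1 then P else if m < n then B m else M)"
definition x where "x m = (if m \<le> 1 then iP2 else if m < n then ide (B m) else iM1)"
definition y where "y m = (if m \<le> 1 then pP2 else if m < n then ide (B m) else pM1)"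
definition G where "G m = (if m \<le> 1 then A 1 else if m < n then Z else SO (A 1))"
definition x' where "x' m = (if m \<le> 1 then iP1 else if m < n then zero Z (B m) else iM2)"
definition y' where "y' m = (if m \<le> 1 then pP1 else if m < n then zero (B m) Z else pM2)"

lemma bpB': "m \<in> I \<Longrightarrow> bp (B m) (G m) (B' m) (x m) (x' m) (y m) (y' m)"
  using bp_swap[OF bpP] bpM bp_zero_right[OF zobj_zero ObB[of m]] n3
  by (cases "m = 1"; cases "m < n") (auto simp: B'_def x_def y_def G_def x'_def y'_def)

lemma B'_ex:
  obtains b' g where "(B', b') \<in> N" "mor B b B' b' x" "mor B' b' B b y" "mor G g B' b' x'" "mor B' b' G g y'"
    "(G, g) \<in> N" "g n = sg n (ide (SO (A 1)))"
proof -
  obtain g where g: "(G, g) \<in> N" "g n = sg n (ide (SO (A 1)))"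
    using rot_triv_in_N[OF Ob123(1)] unfolding G_def[abs_def] .
  show ?thesis using dsum_in_N[OF SB g(1), of B' x x' y y'] bpB' that g by blast
qed

definition C' where "C' m = (if m \<le> 1 then Q else if m = 2 then B 2 else if m < n then Z else SO K)"

text \<open>Degree 1 uses the twisted decomposition of \<open>Q\<close>. Its projection to
  \<open>B 2\<close> is \<open>e2\<close>, so the trivial n-angle on \<open>B 2\<close> contributes
  \<open>e2\<close> as first map; its inclusion of \<open>K\<close> is \<open>t\<close>, so the
  rotated n-angle on \<open>K\<close> contributes \<Sigma>t, with its sign, as last map.\<close>

lemma C'_ex:
  obtains c where "(C', c) \<in> N" "c 1 = e2" "c n = sg n (SM t)"
proof -
  obtain tb where tb: "((\<lambda>m. if m \<le> 2 then B 2 else Z), tb) \<in> N" "tb 1 = ide (B 2)"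
    using triv_in_N[OF Ob123(5)] .
  obtain g where g: "((\<lambda>m. if m \<le> 1 then K else if m < n then Z else SO K), g) \<in> N" "g n = sg n (ide (SO K))"
    using rot_triv_in_N[OF KOb] .
  define i1 where "i1 m = (if m \<le> 1 then iQ2 else if m = 2 then ide (B 2) else if m < n then ide Z else zero Z (SO K))" for m
  define i2 where "i2 m = (if m \<le> 1 then t else if m = 2 then zero Z (B 2) else if m < n then zero Z Z else ide (SO K))" for m
  define p1 where "p1 m = (if m \<le> 1 then e2 else if m = 2 then ide (B 2) else if m < n then ide Z else zero (SO K) Z)" for m
  define p2 where "p2 m = (if m \<le> 1 then pQ1 else if m = 2 then zero (B 2) Z else if m < n then zero Z Z else ide (SO K))" for m
  have bps: "\<forall>m\<in>I. bp (if m \<le> 2 then B 2 else Z) (if m \<le> 1 then K else if m < n then Z else SO K) (C' m)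
    (i1 m) (i2 m) (p1 m) (p2 m)"
  proof
    fix m assume m: "m \<in> I"
    then consider "m = 1" | "m = 2" | "3 \<le> m" "m < n" | "m = n" by fastforce
    then show "bp (if m \<le> 2 then B 2 else Z) (if m \<le> 1 then K else if m < n then Z else SO K) (C' m)
      (i1 m) (i2 m) (p1 m) (p2 m)"
      by cases (use n3 bp_swap[OF bpQ'] bp_zero_right[OF zobj_zero Ob123(5)] bp_zero_right[OF zobj_zero zobj_Ob]
        bp_zero_left[OF zobj_zero SO_Ob[OF KOb]] in \<open>auto simp: C'_def i1_def i2_def p1_def p2_def\<close>)
  qed
  obtain c where c: "(C', c) \<in> N" "mor (\<lambda>m. if m \<le> 1 then K else if m < n then Z else SO K) g C' c i2"
    "mor C' c (\<lambda>m. if m \<le> 2 then B 2 else Z) tb p1"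
    using dsum_in_N[OF tb(1) g(1) bps] by blast
  have c1: "hom (c 1) Q (B 2)" and cn: "hom (c n) (SO K) (SO Q)"
    using N_hom[OF c(1), of 1] N_hom[OF c(1), of n] n3 by (auto simp: C'_def nx_def)
  have "c 1 = e2"
    using mor_eq_lt[OF c(3), of 1] n3 tb(2) ide_left[OF c1] ide_left[OF e2_hom] by (simp add: p1_def)
  moreover have "c n = sg n (SM t)"
  proof -
    note tS = hom_SM[OF bpD(1)[OF bpQ']]
    have "SM t \<cdot> sg n (ide (SO K)) = c n \<cdot> ide (SO K)"
      using mor_eq_n[OF c(2)] n3 g(2) by (simp add: i2_def)
    then show ?thesis using comp_sgn_right[OF hom_ide[OF SO_Ob[OF KOb]] tS] ide_right[OF tS] ide_right[OF cn] by simp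
  qed
  ultimately show ?thesis using that c(1) by blast
qed

text \<open>Both sides are tested on the decomposition by \<open>u1\<close> and \<open>iP2\<close>.
  On \<open>u1\<close> they give -f2 a 1 and -b 1 f1, where the commuting square enters; on
  \<open>iP2\<close> both give b 1.\<close>

lemma e2_a'1:
  assumes A': "(A', a') \<in> N" "mor A a A' a' u" "a' 1 \<cdot> iP2 = iQ1 \<cdot> iK2"
    and B': "(B', b') \<in> N" "mor B b B' b' x" "mor G g B' b' x'" "(G, g) \<in> N"
  shows "e2 \<cdot> a' 1 = b' 1"
proof -
  have a'1: "hom (a' 1) P Q" using N_hom[OF A'(1), of 1] n3 by (simp add: A'_def nx_def)
  have b'1: "hom (b' 1) P (B 2)" using N_hom[OF B'(1), of 1] n3 by (simp add: B'_def nx_def numeral_2_eq_2)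
  have g1: "hom (g 1) (A 1) Z" using N_hom[OF B'(4), of 1] n3 by (simp add: G_def nx_def)
  note k = bpD[OF bpK] and q = bpD[OF bpQ] and p = bpD[OF bpP] and p' = bpD[OF bpP']
  have b'i2: "b' 1 \<cdot> iP2 = b 1"
    using mor_eq_lt[OF B'(2), of 1] n3 ide_left[OF b1] by (simp add: x_def numeral_2_eq_2)
  have b'i1: "b' 1 \<cdot> iP1 = zero (A 1) (B 2)"
    using mor_eq_lt[OF B'(3), of 1] n3 comp_through_zero[OF zobj_zero g1 hom_zero[OF zobj_Ob Ob123(5)]]
    by (simp add: x'_def numeral_2_eq_2)
  have ip: "hom (iP2 \<cdot> f1) (A 1) P" using p f1 by blast
  have 1: "b' 1 \<cdot> u1 = \<ominus> (b 1 \<cdot> f1)"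
    using comp_add_right[OF p(1) hom_neg[OF ip] b'1] b'i1 comp_neg_right[OF ip b'1] comp_assoc[OF f1 p(2) b'1] b'i2
      add_zero_left[OF hom_neg[OF hom_comp[OF f1 b1]]] by simp
  have "a' 1 \<cdot> u1 = (iQ1 \<cdot> iK1) \<cdot> a 1"
    using mor_eq_lt[OF A'(2), of 1] n3 by (simp add: u_def)
  then have 2: "(e2 \<cdot> a' 1) \<cdot> u1 = \<ominus> (f2 \<cdot> a 1)"
    using comp_assoc[OF p'(1) a'1 e2_hom] comp_assoc[OF a1 k(1) q(1)] comp_assoc[OF hom_comp[OF a1 k(1)] q(1) e2_hom] e2_iQ1
      comp_assoc[OF a1 k(1) h_hom] h_iK(1) comp_neg_left[OF a1 f2] by simp
  have 3: "(e2 \<cdot> a' 1) \<cdot> iP2 = b 1"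
    by (simp only: comp_assoc[OF p(2) a'1 e2_hom] A'(3) comp_assoc[OF k(2) q(1) e2_hom, symmetric] e2_iQ1 h_iK(2))
  show ?thesis
    by (rule bp_ext_source[OF bpP' hom_comp[OF a'1 e2_hom] b'1]) (simp_all only: 1 2 3 b'i2 sq)
qed

end

section \<open>Comparison of D with the rotated mapping cone\<close>

text \<open>\<open>ph\<close> and \<open>ps\<close> are the families that \<open>N4star\<close>
  returns for the three n-angles, and nothing beyond its conclusion is assumed of them.\<close>

locale n4_data = square C SO SM n N A a B b f1 f2
  for C :: "('o,'m) addcat" and SO SM n N A a B b f1 f2 +
  fixes a' b' g c ph ps
  assumes A'N: "(A', a') \<in> N" and u_mor: "mor A a A' a' u" and v_mor: "mor A' a' A a v"
    and a'1_iP2: "a' 1 \<cdot> iP2 = iQ1 \<cdot> iK2" and a'1_proj: "(pK2 \<cdot> pQ1) \<cdot> a' 1 = f1 \<cdot> pP1 \<oplus> pP2"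
    and a'2_iQ2: "a' 2 \<cdot> iQ2 = iL2" and pL2_a'2: "pL2 \<cdot> a' 2 = pQ2"
    and B'N: "(B', b') \<in> N" and x_mor: "mor B b B' b' x" and y_mor: "mor B' b' B b y"
    and x'_mor: "mor G g B' b' x'" and y'_mor: "mor B' b' G g y'"
    and gn: "g n = sg n (ide (SO (A 1)))"
    and C'N: "(C', c) \<in> N" and cn: "c n = sg n (SM t)"
    and ph1: "ph 1 = ide P" and ph2: "ph 2 = e2" and ph_mor: "mor A' a' B' b' ph"
    and ps_odd: "\<And>k. 1 \<le> k \<Longrightarrow> 2 * k - 1 \<le> 2 * n - 5 \<Longrightarrow> hom (ps (2 * k - 1)) (B' (k + 2)) (C' (k + 2))"
    and ps_even: "\<And>k. 1 \<le> k \<Longrightarrow> 2 * k \<le> 2 * n - 5 \<Longrightarrow> hom (ps (2 * k)) (A' (k + 3)) (C' (k + 2))"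
    and ps_eq: "c n \<cdot> ps (2 * n - 5) = SM (a' 1) \<cdot> b' n"
    and DN: "D_seq C SO SM n (A', a') (B', b') (C', c) ph ps \<in> N"
begin

text \<open>The sign is forced: \<open>u 1\<close> is the graph of -f1 and \<open>e2\<close>
  restricts to -f2 on \<open>A 2\<close>, so the plain restriction of \<open>ph\<close> starts with
  (-f1, -f2).\<close>

definition phi where "phi m = \<ominus> (y m \<cdot> ph m \<cdot> u m)"

lemma hA: "\<forall>m\<in>I. hom (a m) (A m) (nx A m)" and hB: "\<forall>m\<in>I. hom (b m) (B m) (nx B m)"
  and hA': "\<forall>m\<in>I. hom (a' m) (A' m) (nx A' m)" and hB': "\<forall>m\<in>I. hom (b' m) (B' m) (nx B' m)"
  using N_hom SA SB A'N B'N by blast+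

lemma phi_mor: "mor A a B b phi"
  using mor_neg[OF mor_comp[OF mor_comp[OF u_mor ph_mor hA hA' hB'] y_mor hA hB' hB] hA hB]
  unfolding phi_def[abs_def] .

lemma phi1: "phi 1 = f1"
proof -
  note p = bpD[OF bpP]
  have ip: "hom (iP2 \<cdot> f1) (A 1) P" using p f1 by blast
  have "pP2 \<cdot> u1 = \<ominus> f1"
    using comp_add_right[OF p(1) hom_neg[OF ip] p(4)] comp_neg_right[OF ip p(4)] comp_assoc[OF f1 p(2,4)] p(6,8)
      ide_left[OF f1] add_zero_left[OF hom_neg[OF f1]] by simp
  then show ?thesis
    using ide_left[OF bpD(1)[OF bpP']] ph1 neg_neg[OF f1] by (simp add: phi_def y_def u_def)
qed

lemma phi2: "phi 2 = f2"
proof -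
  note k = bpD[OF bpK] and q = bpD[OF bpQ]
  have "e2 \<cdot> iQ1 \<cdot> iK1 = \<ominus> f2"
    by (simp only: comp_assoc[OF k(1) q(1) e2_hom, symmetric] e2_iQ1 h_iK(1))
  then show ?thesis
    using ide_left[OF hom_neg[OF f2]] ph2 neg_neg[OF f2] n3 by (simp add: phi_def y_def u_def)
qed

lemma u_hom: "m \<in> I \<Longrightarrow> hom (u m) (A m) (A' m)"
  and ph_hom: "m \<in> I \<Longrightarrow> hom (ph m) (A' m) (B' m)" and phi_hom: "m \<in> I \<Longrightarrow> hom (phi m) (A m) (B m)"
  using u_mor ph_mor phi_mor mor_hom by blast+

lemma y_ph_u:
  assumes "m \<in> I"
  shows "y m \<cdot> ph m \<cdot> u m = \<ominus> phi m"
  using neg_neg[OF hom_comp[OF hom_comp[OF u_hom ph_hom] mor_hom[OF y_mor]], OF assms assms assms]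
  by (simp add: phi_def)

text \<open>Since \<open>ph 1\<close> is an identity, \<open>a' n\<close> equals \<open>b' n\<close>
  after \<open>ph n\<close>. Projecting with \<Sigma>(pP1) gives \<open>a n\<close> on one side and,
  on the other, \<open>g n\<close> = (-1)^n times the \<Sigma>(A 1)-component of
  \<open>ph n\<close>. This is how \<open>a n\<close> enters D.\<close>

lemma y'_ph_u: "y' n \<cdot> ph n \<cdot> u n = sg n (a n)"
proof -
  have n: "n \<in> I" "1 \<in> I" using n3 by auto
  note un = u_hom[OF n(1)] and phn = ph_hom[OF n(1)] and y'n = mor_hom[OF y'_mor n(1)]
  have Gn: "G n = SO (A 1)" using n3 by (simp add: G_def)
  have b'n: "hom (b' n) (B' n) (SO P)" using hB'[rule_format, OF n(1)] n3 by (simp add: nx_def B'_def)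
  have a'n: "hom (a' n) (A' n) (SO P)" using hA'[rule_format, OF n(1)] n3 by (simp add: nx_def A'_def)
  note p' = bpD[OF bpP'] and S = bpD[OF bp_SM[OF bpP']]
  have e: "hom (y' n \<cdot> ph n \<cdot> u n) (A n) (SO (A 1))" using hom_comp[OF hom_comp[OF un phn] y'n] Gn by simp
  have 1: "a' n = b' n \<cdot> ph n"
    using mor_eq_n[OF ph_mor] ph1 SM_ide[OF POb] ide_left[OF a'n] by simp
  have 2: "SM pP1 \<cdot> b' n = g n \<cdot> y' n"
    using mor_eq_n[OF y'_mor] by (simp add: y'_def)
  have 3: "a' n \<cdot> u n = SM u1 \<cdot> a n"
    using mor_eq_n[OF u_mor] by (simp add: u_def)
  have g: "hom (g n) (G n) (SO (A 1))" using gn hom_sgn[OF hom_ide[OF Ob123(8)]] Gn by simp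
  have "a n = SM pP1 \<cdot> SM u1 \<cdot> a n"
    using comp_assoc[OF an_hom S(1,3)] S(5) ide_left[OF an_hom] by simp
  also have "\<dots> = (SM pP1 \<cdot> b' n) \<cdot> ph n \<cdot> u n"
    using 3[symmetric] 1 comp_assoc[OF un phn b'n] comp_assoc[OF hom_comp[OF un phn] b'n S(3)] by simp
  also have "\<dots> = g n \<cdot> y' n \<cdot> ph n \<cdot> u n"
    using 2 comp_assoc[OF hom_comp[OF un phn] y'n g] by simp
  also have "\<dots> = sg n (y' n \<cdot> ph n \<cdot> u n)"
    using gn comp_sgn_left[OF e hom_ide[OF Ob123(8)]] ide_left[OF e] by simp
  finally have "sg n (a n) = sg (n + n) (y' n \<cdot> ph n \<cdot> u n)"
    using sgn_sgn[OF e] by simp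
  then show ?thesis by (simp add: sgnm_def)
qed

text \<open>The inclusion \<open>iL2\<close> is \<open>a' 2\<close> after \<open>iQ2\<close>, and
  \<open>e2\<close> splits \<open>iQ2\<close>. Commutation of \<open>ph\<close> with the second maps
  therefore leaves \<open>b' 2\<close>, which yields b 2 in the \<open>B 2\<close>-column of the
  first map of D.\<close>

lemma ph3_iL2: "ph 3 \<cdot> iL2 = x 3 \<cdot> b 2"
proof -
  have I: "2 \<in> I" "3 \<in> I" using n3 by auto
  note q = bpD[OF bpQ] and q' = bpD[OF bpQ']
  have ph3: "hom (ph 3) L (B' 3)" using ph_hom[OF I(2)] by (simp add: A'_def)
  have a'2: "hom (a' 2) Q L" using hA'[rule_format, OF I(1)] n3 by (simp add: nx_def A'_def)
  have b'2: "hom (b' 2) (B 2) (B' 3)" using hB'[rule_format, OF I(1)] n3 by (simp add: nx_def B'_def)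
  have 1: "ph 3 \<cdot> a' 2 = b' 2 \<cdot> e2"
    using mor_eq_lt[OF ph_mor, of 2] ph2 n3 by simp
  have 2: "x 3 \<cdot> b 2 = b' 2"
    using mor_eq_lt[OF x_mor, of 2] n3 ide_right[OF b'2] by (simp add: x_def)
  show ?thesis
    using a'2_iQ2 comp_assoc[OF q(2) a'2 ph3] 1 comp_assoc[OF q(2) e2_hom b'2] q'(6) ide_right[OF b'2] 2 by simp
qed

lemma a'_eq: "4 \<le> m \<Longrightarrow> m < n \<Longrightarrow> a' m = a m"
  using mor_eq_lt[OF v_mor, of m] ide_left[of "a' m" "A m" "A (Suc m)"] ide_right[OF a_hom, of m] hA'[rule_format, of m]
  by (simp add: v_def nx_def A'_def)

lemma a'3_eq: "4 \<le> n \<Longrightarrow> a' 3 = a 3 \<cdot> pL1"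
  using mor_eq_lt[OF v_mor, of 3] ide_left[of "a' 3" L "A 4"] hA'[rule_format, of 3]
  by (simp add: v_def nx_def A'_def)

lemma b'_eq: "2 \<le> m \<Longrightarrow> m < n \<Longrightarrow> b' m = x (Suc m) \<cdot> b m"
  using mor_eq_lt[OF x_mor, of m] ide_right[of "b' m" "B m" "B' (Suc m)"] hB'[rule_format, of m]
  by (simp add: x_def nx_def B'_def)

lemma b'_eq': "2 \<le> m \<Longrightarrow> Suc m < n \<Longrightarrow> b' m = b m"
  using b'_eq[of m] ide_left[OF b_hom, of m] by (simp add: x_def)

lemma ph_eq:
  assumes "4 \<le> m" "m < n"
  shows "ph m = \<ominus> phi m"
proof -
  have m: "m \<in> I" using assms by simp
  have "hom (ph m) (A m) (B m)" using ph_hom[OF m] assms by (simp add: A'_def B'_def)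
  then show ?thesis using y_ph_u[OF m] assms ide_left[of "ph m" "A m" "B m"] ide_right[of "ph m" "A m" "B m"]
    by (simp add: y_def u_def)
qed

section \<open>The last connecting map \<psi>(2n-5)\<close>

abbreviation "psi \<equiv> ps (2 * n - 5)"

lemma psi_hom: "hom psi M (SO K)"
proof -
  \<comment> \<open>The instance k = n - 2 has index 2n - 5 and target degree n, the only target
    among the \<psi> that need not be zero.\<close>
  have "n - 2 + 2 = n" "2 * (n - 2) - 1 = 2 * n - 5" "1 \<le> n - 2" using n3 by simp_all
  then show ?thesis using ps_odd[of "n - 2"] n3 by (simp add: B'_def C'_def)
qed

lemma xn: "x n = iM1" and x'n: "x' n = iM2" and yn: "y n = pM1" and y'n: "y' n = pM2"
  using n3 by (simp_all add: x_def x'_def y_def y'_def)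

lemma b'n_hom: "hom (b' n) M (SO P)"
  using hB'[rule_format, of n] n3 by (simp add: nx_def B'_def)

lemma a'1_hom: "hom (a' 1) P Q"
  using hA'[rule_format, of 1] n3 by (simp add: nx_def A'_def)

lemma a'2_hom: "hom (a' 2) Q L"
  using hA'[rule_format, of 2] n3 by (simp add: nx_def A'_def)

text \<open>The equation \<open>ps_eq\<close> determines the map: the last map of C' is (-1)^n
  \<Sigma>t, and \<Sigma>(pQ1) is a left inverse of \<Sigma>t.\<close>

lemma psi_eq: "psi = sg n (SM (pQ1 \<cdot> a' 1) \<cdot> b' n)"
proof -
  note q = bpD[OF bpQ] and q' = bpD[OF bpQ'] and S = bpD[OF bp_SM[OF bpQ']]
  have "SM pQ1 \<cdot> sg n (SM t) \<cdot> psi = SM pQ1 \<cdot> SM (a' 1) \<cdot> b' n" using ps_eq cn by simp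
  moreover have "SM pQ1 \<cdot> sg n (SM t) \<cdot> psi = sg n psi"
    using comp_sgn_left[OF psi_hom S(1)] comp_sgn_right[OF hom_comp[OF psi_hom S(1)] S(3)]
      comp_assoc[OF psi_hom S(1,3)] S(5) ide_left[OF psi_hom] by simp
  moreover have "SM pQ1 \<cdot> SM (a' 1) \<cdot> b' n = SM (pQ1 \<cdot> a' 1) \<cdot> b' n"
    using SM_comp[OF a'1_hom q(3)] comp_assoc[OF b'n_hom hom_SM[OF a'1_hom] S(3)] by simp
  ultimately have "sg (n + n) psi = sg n (SM (pQ1 \<cdot> a' 1) \<cdot> b' n)"
    using sgn_sgn[OF psi_hom, of n n] by simp
  then show ?thesis by (simp add: sgnm_def)
qed

lemma psi_iM1: "psi \<cdot> iM1 = sg n (SM iK2 \<cdot> b n)"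
proof -
  note q = bpD[OF bpQ] and m = bpD[OF bpM] and p = bpD[OF bpP] and k = bpD[OF bpK]
  have qa: "hom (pQ1 \<cdot> a' 1) P K" using q a'1_hom by blast
  note h = hom_comp[OF b'n_hom hom_SM[OF qa]]
  have 1: "b' n \<cdot> iM1 = SM iP2 \<cdot> b n" using mor_eq_n[OF x_mor] xn by (simp add: x_def)
  have "(pQ1 \<cdot> a' 1) \<cdot> iP2 = iK2"
    using comp_assoc[OF p(2) a'1_hom q(3)] a'1_iP2 comp_assoc[OF k(2) q(1,3)] q(5) ide_left[OF k(2)] by simp
  then have "(SM (pQ1 \<cdot> a' 1) \<cdot> b' n) \<cdot> iM1 = SM iK2 \<cdot> b n"
    using comp_assoc[OF m(1) b'n_hom hom_SM[OF qa]] 1 comp_assoc[OF bn_hom hom_SM[OF p(2)] hom_SM[OF qa]]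
      SM_comp[OF p(2) qa] by simp
  then show ?thesis using psi_eq comp_sgn_left[OF m(1) h] by simp
qed

text \<open>Two factors (-1)^n cancel, one from \<open>c n\<close> and one from \<open>g n\<close>.
  On \<open>iM1\<close> only the first is present, whence the sign in
  \<open>psi_iM1\<close>.\<close>

lemma psi_iM2: "psi \<cdot> iM2 = SM ((pQ1 \<cdot> a' 1) \<cdot> iP1)"
proof -
  note q = bpD[OF bpQ] and m = bpD[OF bpM] and p = bpD[OF bpP]
  have qa: "hom (pQ1 \<cdot> a' 1) P K" using q a'1_hom by blast
  note h = hom_comp[OF b'n_hom hom_SM[OF qa]] and S = hom_SM[OF p(1)]
  have 1: "b' n \<cdot> iM2 = sg n (SM iP1)"
    using mor_eq_n[OF x'_mor] x'n gn comp_sgn_right[OF hom_ide[OF Ob123(8)] S] ide_right[OF S]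
    by (simp add: x'_def)
  have 2: "(SM (pQ1 \<cdot> a' 1) \<cdot> b' n) \<cdot> iM2 = sg n (SM ((pQ1 \<cdot> a' 1) \<cdot> iP1))"
    using comp_assoc[OF m(2) b'n_hom hom_SM[OF qa]] 1 comp_sgn_right[OF S hom_SM[OF qa]] SM_comp[OF p(1) qa] by simp
  have "psi \<cdot> iM2 = sg (n + n) (SM ((pQ1 \<cdot> a' 1) \<cdot> iP1))"
    using psi_eq comp_sgn_left[OF m(2) h] 2 sgn_sgn[OF hom_SM[OF hom_comp[OF p(1) qa]], of n n] by simp
  then show ?thesis by (simp add: sgnm_def)
qed

text \<open>The zero objects \<open>C' m\<close> for \<open>3 \<le> m < n\<close> are not deleted from these lists.\<close>
abbreviation "Dl m \<equiv> d_objs n A' B' C' (m - 1)"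
abbreviation "DX \<equiv> fst (D_seq C SO SM n (A', a') (B', b') (C', c) ph ps)"
abbreviation "dd \<equiv> snd (D_seq C SO SM n (A', a') (B', b') (C', c) ph ps)"

section \<open>Summands and matrices of D\<close>

lemma D_hom: "m \<in> I \<Longrightarrow> hom (dd m) (DX m) (nx DX m)"
  using N_hom[of DX dd] DN by simp

lemma DX1: "DX 1 = L" and DX: "2 \<le> m \<Longrightarrow> DX m = lsum C (Dl m)"
  by (simp_all add: D_seq_def A'_def)

text \<open>Degree m of D has matrix index k = m - 1. Tag 2 is missing for m = 2, tag 0 from degree
  n - 1 on, and tag 1 in degree n; hence the division into low, penultimate and last degree. For n =
  3 degree 2 is already the penultimate one.\<close>

lemma tags_low: "2 \<le> m \<Longrightarrow> m + 2 \<le> n \<Longrightarrow> d_tags n (m - 1) = (if m = 2 then [0,1] else [0,1,2])"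
  by (auto simp: d_tags_def d_pres_def)

lemma tags_pen: "d_tags n (n - 2) = (if n = 3 then [1] else [1,2])"
  using n3 by (auto simp: d_tags_def d_pres_def)

lemma tags_last: "d_tags n (n - 1) = [2]"
  using n3 by (auto simp: d_tags_def d_pres_def)

lemma Dl_low: "2 \<le> m \<Longrightarrow> m + 2 \<le> n \<Longrightarrow>
    Dl m = (if m = 2 then [A (m + 2), B (m + 1)] else [A (m + 2), B (m + 1), Z])"
  unfolding d_objs_def using tags_low[of m] by (auto simp: d_comp_def A'_def B'_def C'_def numeral_3_eq_3)

lemma Dl_pen: "Dl (n - 1) = (if n = 3 then [M] else [M, Z])"
proof -
  have e: "n - 1 - 1 = n - 2" "n - 2 + 2 = n" "n - 2 + 1 = n - 1" using n3 by simp_all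
  have "d_comp A' B' C' (n - 2) 1 = M" using e n3 by (simp add: d_comp_def B'_def)
  moreover have "d_comp A' B' C' (n - 2) 2 = Z" if "n \<noteq> 3"
  proof -
    have "n - 1 \<noteq> 2" "\<not> n - 1 \<le> 1" using that n3 by arith+
    then show ?thesis unfolding d_comp_def e(3) using n3 by (simp add: C'_def)
  qed
  ultimately have "map (d_comp A' B' C' (n - 2)) [1] = [M]"
    "n \<noteq> 3 \<longrightarrow> map (d_comp A' B' C' (n - 2)) [1, 2] = [M, Z]" by simp_all
  then show ?thesis unfolding d_objs_def e(1) tags_pen by presburger
qed

lemma Dl_last: "Dl n = [SO K]"
  using n3 tags_last unfolding d_objs_def by (simp add: d_comp_def C'_def)

lemma d_comp_Ob: "t' \<in> set (d_tags n k) \<Longrightarrow> 1 \<le> k \<Longrightarrow> k < n \<Longrightarrow> d_comp A' B' C' k t' \<in> Ob C"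
  using N_Ob[OF A'N, of "k + 3"] N_Ob[OF B'N, of "k + 2"] N_Ob[OF C'N, of "k + 1"]
  by (auto simp: d_tags_def d_pres_def d_comp_def split: if_splits)

lemma d_entry_hom:
  assumes r: "r \<in> set (d_tags n (Suc k))" and s: "s \<in> set (d_tags n k)" and k: "1 \<le> k" "Suc k < n"
  shows "hom (d_entry C A' B' C' a' b' c ph ps k r s) (d_comp A' B' C' k s) (d_comp A' B' C' (Suc k) r)"
proof -
  have Ob: "d_comp A' B' C' k s \<in> Ob C" "d_comp A' B' C' (Suc k) r \<in> Ob C"
    using d_comp_Ob[OF s] d_comp_Ob[OF r] k by auto
  note z = hom_zero[OF Ob]
  have rs: "r = 0 \<or> r = 1 \<or> r = 2" "s = 0 \<or> s = 1 \<or> s = 2" "d_pres n (Suc k) r" "d_pres n k s"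
    using r s by (auto simp: d_tags_def split: if_splits)
  have aa: "hom (a' (k + 3)) (A' (k + 3)) (A' (k + 4))" if "k + 4 \<le> n"
    using hA'[rule_format, of "k + 3"] that by (simp add: nx_def add.commute)
  have pp: "hom (ph (k + 3)) (A' (k + 3)) (B' (k + 3))" if "k + 3 \<le> n"
    using ph_hom[of "k + 3"] that by simp
  have bb: "hom (b' (k + 2)) (B' (k + 2)) (B' (k + 3))" if "k + 3 \<le> n"
    using hB'[rule_format, of "k + 2"] that by (simp add: nx_def eval_nat_numeral)
  have cc: "hom (c (k + 1)) (C' (k + 1)) (C' (k + 2))"
    using N_hom[OF C'N, of "k + 1"] k by (simp add: nx_def add.commute)
  have p1: "hom (ps (2 * k)) (A' (k + 3)) (C' (k + 2))" if "k + 3 \<le> n"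
    using ps_even[of k] that k by simp
  have p2: "hom (ps (2 * k - 1)) (B' (k + 2)) (C' (k + 2))" if "k + 2 \<le> n"
    using ps_odd[of k] that k by simp
  have c0: "d_comp A' B' C' k 0 = A' (k + 3)" "d_comp A' B' C' k 1 = B' (k + 2)" "d_comp A' B' C' k 2 = C' (k + 1)"
    "d_comp A' B' C' (Suc k) 0 = A' (k + 4)" "d_comp A' B' C' (Suc k) 1 = B' (k + 3)" "d_comp A' B' C' (Suc k) 2 = C' (k + 2)"
    by (simp_all add: d_comp_def eval_nat_numeral)
  consider "r = 0" "s = 0" | "r = 0" "s = 1" | "r = 0" "s = 2" | "r = 1" "s = 0" | "r = 1" "s = 1" | "r = 1" "s = 2"
    | "r = 2" "s = 0" | "r = 2" "s = 1" | "r = 2" "s = 2" using rs by blast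
  then show ?thesis
  proof cases
    case 1 with rs k show ?thesis using hom_neg[OF aa] unfolding 1 c0 by (simp add: d_entry_def d_pres_def)
  next
    case 2 with z show ?thesis unfolding 2 c0 by (simp add: d_entry_def c0[simplified])
  next
    case 3 with z show ?thesis unfolding 3 c0 by (simp add: d_entry_def c0)
  next
    case 4 with rs k show ?thesis using hom_sgn[OF pp] unfolding 4 c0 by (simp add: d_entry_def d_pres_def)
  next
    case 5 with rs k show ?thesis using hom_neg[OF bb] unfolding 5 c0 by (simp add: d_entry_def d_pres_def)
  next
    case 6 with z show ?thesis unfolding 6 c0 by (simp add: d_entry_def)
  next
    case 7 with rs k show ?thesis using p1 unfolding 7 c0 by (simp add: d_entry_def d_pres_def)
  next
    case 8 with rs k show ?thesis using p2 unfolding 8 c0 by (simp add: d_entry_def d_pres_def)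
  next
    case 9 with rs k show ?thesis using cc unfolding 9 c0 by (simp add: d_entry_def)
  qed
qed

lemma Dl_Ob: "2 \<le> m \<Longrightarrow> m \<le> n \<Longrightarrow> set (Dl m) \<subseteq> Ob C"
  using d_comp_Ob[of _ "m - 1"] by (auto simp: d_objs_def)

lemma D_entry:
  assumes m: "2 \<le> m" "m < n" and r: "r < length (d_tags n m)" and s: "s < length (d_tags n (m - 1))"
  shows "lproj C (Dl (Suc m)) r \<cdot> dd m \<cdot> linj C (Dl m) s =
    d_entry C A' B' C' a' b' c ph ps (m - 1) (d_tags n m ! r) (d_tags n (m - 1) ! s)"
proof -
  have "dd m = mat C (Dl m) (Dl (Suc m)) (\<lambda>r s. d_entry C A' B' C' a' b' c ph ps (m - 1)
      (d_tags n m ! r) (d_tags n (m - 1) ! s))"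
    using m by (simp add: D_seq_def)
  moreover have "hom (d_entry C A' B' C' a' b' c ph ps (m - 1) (d_tags n m ! r) (d_tags n (m - 1) ! s))
      (Dl m ! s) (Dl (Suc m) ! r)" if "r < length (Dl (Suc m))" "s < length (Dl m)" for r s
    using d_entry_hom[of "d_tags n m ! r" "m - 1" "d_tags n (m - 1) ! s"] m that by (simp add: d_objs_def)
  ultimately show ?thesis
    using mat_entry[of "Dl m" "Dl (Suc m)"] Dl_Ob[of m] Dl_Ob[of "Suc m"] m r s by (simp add: d_objs_def)
qed


text \<open>The A-part and the B-part of degree m, lined up with the rotated cone, whose parts there
  are \<open>nx (nx A) m\<close> and \<open>nx B m\<close>. In degree n - 1 both lie inside
  \<open>M\<close>, the sum of \<open>B n\<close> and \<Sigma>(A 1), in the opposite order.\<close>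

definition di1 where "di1 m = (if m = 1 then iL1 else if m + 2 \<le> n then linj C (Dl m) 0
  else if m < n then linj C (Dl m) 0 \<cdot> iM2 else SM iK1)"
definition di2 where "di2 m = (if m = 1 then iL2 else if m + 2 \<le> n then linj C (Dl m) 1
  else if m < n then linj C (Dl m) 0 \<cdot> iM1 else SM iK2)"
definition dp1 where "dp1 m = (if m = 1 then pL1 else if m + 2 \<le> n then lproj C (Dl m) 0
  else if m < n then pM2 \<cdot> lproj C (Dl m) 0 else SM pK1)"
definition dp2 where "dp2 m = (if m = 1 then pL2 else if m + 2 \<le> n then lproj C (Dl m) 1
  else if m < n then pM1 \<cdot> lproj C (Dl m) 0 else SM pK2)"

text \<open>The list in degree n - 1 is [M, Z] for n > 3 and [M] for n = 3; either way inclusion and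
  projection of the first entry are inverse isomorphisms.\<close>

lemma pen:
  shows J_hom: "hom (linj C (Dl (n - 1)) 0) M (DX (n - 1))" and J'_hom: "hom (lproj C (Dl (n - 1)) 0) (DX (n - 1)) M"
    and J'J: "lproj C (Dl (n - 1)) 0 \<cdot> linj C (Dl (n - 1)) 0 = ide M"
    and JJ': "linj C (Dl (n - 1)) 0 \<cdot> lproj C (Dl (n - 1)) 0 = ide (DX (n - 1))"
proof -
  have l: "0 < length (Dl (n - 1))" "Dl (n - 1) ! 0 = M" unfolding Dl_pen by simp_all
  have Ob: "set (Dl (n - 1)) \<subseteq> Ob C" using Dl_Ob[of "n - 1"] n3 by simp
  have d: "DX (n - 1) = lsum C (Dl (n - 1))" using DX[of "n - 1"] n3 by simp
  show "hom (linj C (Dl (n - 1)) 0) M (DX (n - 1))" using hom_linj[OF Ob l(1)] unfolding l(2) d .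
  show "hom (lproj C (Dl (n - 1)) 0) (DX (n - 1)) M" using hom_lproj[OF Ob l(1)] unfolding l(2) d .
  show "lproj C (Dl (n - 1)) 0 \<cdot> linj C (Dl (n - 1)) 0 = ide M"
    using lproj_linj[OF Ob l(1) l(1)] unfolding l(2) by simp
  have MO: "M \<in> Ob C" using homD(2)[OF bpD(1)[OF bpM]] .
  have "linj C [M] 0 \<cdot> lproj C [M] 0 = ide (lsum C [M])" using ide_left[OF hom_ide[OF MO]] by simp
  then show "linj C (Dl (n - 1)) 0 \<cdot> lproj C (Dl (n - 1)) 0 = ide (DX (n - 1))"
    using linj_lproj_zero[OF MO] unfolding d Dl_pen by presburger
qed

lemma pen_maps: "di1 (n - 1) = linj C (Dl (n - 1)) 0 \<cdot> iM2" "di2 (n - 1) = linj C (Dl (n - 1)) 0 \<cdot> iM1"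
    "dp1 (n - 1) = pM2 \<cdot> lproj C (Dl (n - 1)) 0" "dp2 (n - 1) = pM1 \<cdot> lproj C (Dl (n - 1)) 0"
proof -
  have "n - 1 \<noteq> 1" "\<not> n - 1 + 2 \<le> n" "n - 1 < n" using n3 by arith+
  then show "di1 (n - 1) = linj C (Dl (n - 1)) 0 \<cdot> iM2" "di2 (n - 1) = linj C (Dl (n - 1)) 0 \<cdot> iM1"
    "dp1 (n - 1) = pM2 \<cdot> lproj C (Dl (n - 1)) 0" "dp2 (n - 1) = pM1 \<cdot> lproj C (Dl (n - 1)) 0"
    unfolding di1_def di2_def dp1_def dp2_def by presburger+
qed

lemma n_cases:
  assumes "m \<in> I"
  obtains "m = 1" | "2 \<le> m" "m + 2 \<le> n" | "m = n - 1" "2 \<le> m" | "m = n"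
  using assms by fastforce

lemma bp_DX:
  assumes "m \<in> I"
  shows "bp (nx (nx A) m) (nx B m) (DX m) (di1 m) (di2 m) (dp1 m) (dp2 m)"
  using assms
proof (cases rule: n_cases)
  case 1
  have "nx (nx A) m = A 3" "nx B m = B 2" using 1 n3 by (simp_all add: nx_def eval_nat_numeral)
  then show ?thesis using bpL 1 DX1 by (simp add: di1_def di2_def dp1_def dp2_def)
next
  case 2
  have e: "nx (nx A) m = A (m + 2)" "nx B m = B (m + 1)" using 2 by (simp_all add: nx_def)
  have O: "A (m + 2) \<in> Ob C" "B (m + 1) \<in> Ob C" using ObA ObB 2 by simp_all
  have "bp (A (m + 2)) (B (m + 1)) (lsum C (Dl m)) (linj C (Dl m) 0) (linj C (Dl m) 1) (lproj C (Dl m) 0) (lproj C (Dl m) 1)"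
    using bp_lsum2[OF O] bp_lsum3[OF O] unfolding Dl_low[OF 2] by presburger
  then show ?thesis using 2 DX[of m] e by (simp add: di1_def di2_def dp1_def dp2_def)
next
  case 3
  have e: "nx (nx A) m = SO (A 1)" "nx B m = B n" using 3 n3 by (simp_all add: nx_def)
  \<comment> \<open>The swap puts \<Sigma>(A 1) before \<open>B n\<close>, as in the rotated
    cone.\<close>
  show ?thesis using bp_iso[OF bp_swap[OF bpM] J_hom J'_hom J'J JJ'] e unfolding 3(1) pen_maps by simp
next
  case 4
  have e: "nx (nx A) m = SO (A 2)" "nx B m = SO (B 1)" using 4 n3 by (simp_all add: nx_def eval_nat_numeral)
  have "DX m = SO K" using DX[of n] n3 4 unfolding Dl_last by simp
  then show ?thesis using bp_SM[OF bpK] 4 e n3 by (simp add: di1_def di2_def dp1_def dp2_def)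
qed

section \<open>The four entries of each map of D\<close>

lemma d1_hom: "hom (dd 1) L (DX 2)"
  using D_hom[of 1] n3 DX1 by (simp add: nx_def numeral_2_eq_2)

lemma D_first:
  assumes "r < length (d_tags n 1)"
  shows "lproj C (Dl 2) r \<cdot> dd 1 = (if d_tags n 1 ! r = 0 then a' 3 else ph 3)"
proof -
  let ?M = "\<lambda>r s::nat. if d_tags n 1 ! r = 0 then a' 3 else ph 3"
  have LO: "L \<in> Ob C" using homD(2)[OF bpD(1)[OF bpL]] .
  have A3: "A' 3 = L" by (simp add: A'_def)
  have h: "hom (?M r s) ([L] ! s) (Dl 2 ! r)" if "r < length (Dl 2)" "s < length [L]" for r s
  proof -
    have r: "r < length (d_tags n 1)" using that by (simp add: d_objs_def)
    then have "d_tags n 1 ! r \<in> set (d_tags n 1)" by (rule nth_mem)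
    then have mem: "d_pres n 1 (d_tags n 1 ! r)" "d_tags n 1 ! r \<in> {0, 1, 2}"
      unfolding d_tags_def set_filter by simp_all
    have dl: "Dl 2 ! r = d_comp A' B' C' 1 (d_tags n 1 ! r)" using r by (simp add: d_objs_def)
    show ?thesis
    proof (cases "d_tags n 1 ! r = 0")
      case True
      then have n4: "4 \<le> n" using mem by (simp add: d_pres_def)
      then have "hom (a' 3) L (A' 4)" using hA'[rule_format, of 3] A3 by (simp add: nx_def)
      then show ?thesis using True dl that by (simp add: d_comp_def)
    next
      case False
      \<comment> \<open>Tag 2 requires k \<ge> 2, so only tags 0 and 1 can occur for k = 1.\<close>
      then have "d_tags n 1 ! r = 1" using mem by (auto simp: d_pres_def)
      then show ?thesis using dl that ph_hom[of 3] A3 n3 by (simp add: d_comp_def numeral_3_eq_3)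
    qed
  qed
  have "dd 1 = mat C [L] (Dl 2) ?M" by (simp add: D_seq_def A3)
  then have "lproj C (Dl 2) r \<cdot> dd 1 \<cdot> linj C [L] 0 = ?M r 0"
    using mat_entry[of "[L]" "Dl 2" ?M r 0] h LO Dl_Ob[of 2] n3 assms by (simp add: d_objs_def)
  then show ?thesis using ide_right[OF d1_hom] by simp
qed

lemma entries_1_ge4:
  assumes n: "4 \<le> n"
  shows "nxm dp1 1 \<cdot> dd 1 \<cdot> di1 1 = a 3" "nxm dp1 1 \<cdot> dd 1 \<cdot> di2 1 = zero (B 2) (A 4)"
    "nxm dp2 1 \<cdot> dd 1 \<cdot> di1 1 = \<ominus> phi 3" "nxm dp2 1 \<cdot> dd 1 \<cdot> di2 1 = b 2"
proof -
  have tg: "d_tags n 1 = [0, 1]" using tags_low[of 2] n by simp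
  have Ob: "set (Dl 2) \<subseteq> Ob C" using Dl_Ob[of 2] n by simp
  have len: "length (Dl 2) = 2" by (simp add: d_objs_def tg[simplified])
  have dx: "DX 2 = lsum C (Dl 2)" by (rule DX) simp
  have l0: "hom (lproj C (Dl 2) 0) (DX 2) (Dl 2 ! 0)" "hom (lproj C (Dl 2) 1) (DX 2) (Dl 2 ! 1)"
    unfolding dx by (rule hom_lproj[OF Ob]; unfold len; simp)+
  have np: "nxm dp1 1 = lproj C (Dl 2) 0" "nxm dp2 1 = lproj C (Dl 2) 1"
    using n by (simp_all add: nxm_def dp1_def dp2_def numeral_2_eq_2)
  note l = bpD[OF bpL]
  have a3: "hom (a 3) (A 3) (A 4)" using a_hom[of 3] n by simp
  have 0: "lproj C (Dl 2) 0 \<cdot> dd 1 = a 3 \<cdot> pL1" "lproj C (Dl 2) 1 \<cdot> dd 1 = ph 3"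
    using D_first[of 0] D_first[of 1] a'3_eq[OF n] unfolding tg by simp_all
  have c: "nxm dp1 1 \<cdot> dd 1 \<cdot> i = (a 3 \<cdot> pL1) \<cdot> i" "nxm dp2 1 \<cdot> dd 1 \<cdot> i = ph 3 \<cdot> i" if "hom i X L" for i X
    unfolding np using comp_assoc[OF that d1_hom l0(1)] comp_assoc[OF that d1_hom l0(2)] 0 by simp_all
  have di: "di1 1 = iL1" "di2 1 = iL2" by (simp_all add: di1_def di2_def)
  show "nxm dp1 1 \<cdot> dd 1 \<cdot> di1 1 = a 3"
    using c(1)[OF l(1)] comp_assoc[OF l(1,3) a3] l(5) ide_right[OF a3] di by simp
  show "nxm dp1 1 \<cdot> dd 1 \<cdot> di2 1 = zero (B 2) (A 4)"
    using c(1)[OF l(2)] comp_assoc[OF l(2,3) a3] l(7) comp_zero_right[OF a3 Ob123(5)] di by simp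
  have I3: "3 \<in> I" using n by simp
  have "hom (ph 3 \<cdot> iL1) (A 3) (B 3)" using ph_hom[OF I3] l(1) n by (auto simp: A'_def B'_def)
  then have "ph 3 \<cdot> iL1 = \<ominus> phi 3"
    using y_ph_u[OF I3] n ide_left[of "ph 3 \<cdot> iL1"] by (simp add: u_def y_def)
  then show "nxm dp2 1 \<cdot> dd 1 \<cdot> di1 1 = \<ominus> phi 3"
    using c(2)[OF l(1)] di by simp
  have b2: "hom (b 2) (B 2) (B 3)" using b_hom[of 2] n by simp
  show "nxm dp2 1 \<cdot> dd 1 \<cdot> di2 1 = b 2"
    using c(2)[OF l(2)] ph3_iL2 n di ide_left[OF b2] by (simp add: x_def)
qed

text \<open>For n = 3 the first map already lands in degree n - 1, where tag 0 is absent. The row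
  towards \<Sigma>(A 1) is then a component of \<open>ph 3\<close>, computed by
  \<open>y'_ph_u\<close>; hence the sign.\<close>

lemma entries_1_eq3:
  assumes n: "n = 3"
  shows "nxm dp1 1 \<cdot> dd 1 \<cdot> di1 1 = sg n (a 3)" "nxm dp1 1 \<cdot> dd 1 \<cdot> di2 1 = zero (B 2) (SO (A 1))"
    "nxm dp2 1 \<cdot> dd 1 \<cdot> di1 1 = \<ominus> phi 3" "nxm dp2 1 \<cdot> dd 1 \<cdot> di2 1 = b 2"
proof -
  have tg: "d_tags n 1 = [1]" using tags_pen n by simp
  have e: "n - 1 = 2" using n by simp
  note J' = J'_hom[unfolded e]
  have np: "nxm dp1 1 = pM2 \<cdot> lproj C (Dl 2) 0" "nxm dp2 1 = pM1 \<cdot> lproj C (Dl 2) 0"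
    using pen_maps(3,4) n3 unfolding e by (simp_all add: nxm_def numeral_2_eq_2)
  note l = bpD[OF bpL] and m = bpD[OF bpM]
  have 0: "lproj C (Dl 2) 0 \<cdot> dd 1 = ph 3"
    using D_first[of 0] unfolding tg by simp
  have c: "(p \<cdot> lproj C (Dl 2) 0) \<cdot> dd 1 \<cdot> i = p \<cdot> ph 3 \<cdot> i" if "hom i X L" "hom p M Y" for i X p Y
    using comp_assoc[OF hom_comp[OF that(1) d1_hom] J' that(2)] comp_assoc[OF that(1) d1_hom J'] 0 by simp
  have di: "di1 1 = iL1" "di2 1 = iL2" by (simp_all add: di1_def di2_def)
  have I3: "3 \<in> I" using n by simp
  have u3: "u 3 = iL1" by (simp add: u_def)
  have n': "3 = n" "Suc 2 = n" using n by simp_all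
  have b2: "hom (b 2) (B 2) (B n)" using b_hom[of 2] n3 unfolding n'(2) by simp
  have x3: "x 3 = iM1" unfolding n' by (rule xn)
  have y3: "y 3 = pM1" "y' 3 = pM2" unfolding n' by (rule yn, rule y'n)
  have yp: "y' 3 \<cdot> ph 3 \<cdot> u 3 = sg n (a 3)" unfolding n' by (rule y'_ph_u)
  show "nxm dp1 1 \<cdot> dd 1 \<cdot> di1 1 = sg n (a 3)"
    using c[OF l(1) m(4)] yp np di u3 y3 by simp
  show "nxm dp2 1 \<cdot> dd 1 \<cdot> di1 1 = \<ominus> phi 3"
    using c[OF l(1) m(3)] y_ph_u[OF I3] np di u3 y3 by simp
  show "nxm dp1 1 \<cdot> dd 1 \<cdot> di2 1 = zero (B 2) (SO (A 1))"
    using c[OF l(2) m(4)] ph3_iL2 np di x3 comp_assoc[OF b2 m(1,4)] m(8) comp_zero_left[OF b2 Ob123(8)] by simp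
  show "nxm dp2 1 \<cdot> dd 1 \<cdot> di2 1 = b 2"
    using c[OF l(2) m(3)] ph3_iL2 np di x3 comp_assoc[OF b2 m(1,3)] m(5) ide_left[OF b2] by simp
qed

text \<open>In these degrees the maps involved are untouched by the added n-angles: a' and b' agree
  with a and b, and \<open>ph\<close> with the negative of \<open>phi\<close>. The entries are those
  of \<open>d_entry\<close> with k = m - 1, so its sign (-1)^(k+1) becomes (-1)^m.\<close>

lemma entries_mid:
  assumes m: "2 \<le> m" "m + 3 \<le> n"
  shows "nxm dp1 m \<cdot> dd m \<cdot> di1 m = \<ominus> a (m + 2)" "nxm dp1 m \<cdot> dd m \<cdot> di2 m = zero (B (m + 1)) (A (m + 3))"
    "nxm dp2 m \<cdot> dd m \<cdot> di1 m = sg m (\<ominus> phi (m + 2))" "nxm dp2 m \<cdot> dd m \<cdot> di2 m = \<ominus> b (m + 1)"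
proof -
  have tg: "d_tags n (m - 1) = (if m = 2 then [0,1] else [0,1,2])" "d_tags n m = [0,1,2]"
    using tags_low[of m] tags_low[of "Suc m"] m by simp_all
  have nth: "d_tags n (m - 1) ! 0 = 0" "d_tags n (m - 1) ! 1 = 1" "d_tags n m ! 0 = 0" "d_tags n m ! 1 = 1"
    "length (d_tags n (m - 1)) > 1" "length (d_tags n m) > 1"
    unfolding tg by simp_all
  have mn: "m < n" using m by simp
  note E = D_entry[OF m(1) mn]
  have e: "m - 1 + 3 = m + 2" "m - 1 + 4 = m + 3" "m - 1 + 2 = m + 1" "m - 1 + 1 = m" using m by simp_all
  have np: "nxm dp1 m = lproj C (Dl (Suc m)) 0" "nxm dp2 m = lproj C (Dl (Suc m)) 1"
    "di1 m = linj C (Dl m) 0" "di2 m = linj C (Dl m) 1"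
    using m by (simp_all add: nxm_def dp1_def dp2_def di1_def di2_def)
  have l: "0 < length (d_tags n m)" "0 < length (d_tags n (m - 1))" using nth(5,6) by linarith+
  show "nxm dp1 m \<cdot> dd m \<cdot> di1 m = \<ominus> a (m + 2)"
    using E[OF l] a'_eq[of "m + 2"] m unfolding np nth d_entry_def e by simp
  show "nxm dp1 m \<cdot> dd m \<cdot> di2 m = zero (B (m + 1)) (A (m + 3))"
    using E[OF l(1) nth(5)] m unfolding np nth d_entry_def d_comp_def e by (simp add: A'_def B'_def)
  show "nxm dp2 m \<cdot> dd m \<cdot> di1 m = sg m (\<ominus> phi (m + 2))"
    using E[OF nth(6) l(2)] ph_eq[of "m + 2"] m unfolding np nth d_entry_def e by simp
  show "nxm dp2 m \<cdot> dd m \<cdot> di2 m = \<ominus> b (m + 1)"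
    using E[OF nth(6,5)] b'_eq'[of "m + 1"] m unfolding np nth d_entry_def e by simp
qed

text \<open>The target is degree n - 1, so the A-row comes out of the \<Sigma>(A 1)-component of
  \<open>ph n\<close>. Its sign (-1)^n cancels the (-1)^m of the matrix because m + 2 = n.\<close>

lemma entries_pre:
  assumes m: "2 \<le> m" "m + 2 = n"
  shows "nxm dp1 m \<cdot> dd m \<cdot> di1 m = a n" "nxm dp1 m \<cdot> dd m \<cdot> di2 m = zero (B (m + 1)) (SO (A 1))"
    "nxm dp2 m \<cdot> dd m \<cdot> di1 m = sg m (\<ominus> phi n)" "nxm dp2 m \<cdot> dd m \<cdot> di2 m = \<ominus> b (m + 1)"
proof -
  have em: "m = n - 2" "Suc m = n - 1" "n \<noteq> 3" using m by simp_all
  have tg: "d_tags n (m - 1) = (if m = 2 then [0,1] else [0,1,2])" "d_tags n m = [1,2]"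
    using tags_low[of m] tags_pen m em by simp_all
  have nth: "d_tags n (m - 1) ! 0 = 0" "d_tags n (m - 1) ! 1 = 1" "d_tags n m ! 0 = 1"
    "length (d_tags n (m - 1)) > 1" "length (d_tags n m) > 0" "length (d_tags n (m - 1)) > 0"
    unfolding tg by simp_all
  have mn: "m < n" using m by simp
  have e: "m - 1 + 3 = n" "m - 1 + 2 = m + 1" "m - 1 + 1 = m" using m by simp_all
  have E: "lproj C (Dl (n - 1)) 0 \<cdot> dd m \<cdot> linj C (Dl m) 0 = sg m (ph n)"
    "lproj C (Dl (n - 1)) 0 \<cdot> dd m \<cdot> linj C (Dl m) 1 = \<ominus> b' (m + 1)"
    using D_entry[OF m(1) mn nth(5,6)] D_entry[OF m(1) mn nth(5,4)] unfolding nth d_entry_def e em(2) by simp_all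
  have np: "nxm dp1 m = pM2 \<cdot> lproj C (Dl (n - 1)) 0" "nxm dp2 m = pM1 \<cdot> lproj C (Dl (n - 1)) 0"
    "di1 m = linj C (Dl m) 0" "di2 m = linj C (Dl m) 1"
    using m mn em(2) pen_maps(3,4) by (simp_all add: nxm_def di1_def di2_def)
  note q = bpD[OF bpM]
  have mI: "m \<in> I" "n \<in> I" using m by simp_all
  have dm: "hom (dd m) (DX m) (DX (n - 1))" using D_hom[OF mI(1)] mn em(2) by (simp add: nx_def)
  have i: "hom (linj C (Dl m) 0) (A n) (DX m)" "hom (linj C (Dl m) 1) (B (m + 1)) (DX m)"
    using bpD(1,2)[OF bp_DX[OF mI(1)]] np m by (simp_all add: nx_def)
  have c: "(p \<cdot> lproj C (Dl (n - 1)) 0) \<cdot> dd m \<cdot> i = p \<cdot> lproj C (Dl (n - 1)) 0 \<cdot> dd m \<cdot> i"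
    if "hom i X (DX m)" "hom p M Y" for i X p Y
    by (rule comp_assoc[OF hom_comp[OF that(1) dm] J'_hom that(2)])
  have phn: "hom (ph n) (A n) M" using ph_hom[OF mI(2)] m n3 by (simp add: A'_def B'_def)
  have un: "ph n \<cdot> u n = ph n" using ide_right[OF phn] m by (simp add: u_def)
  have b': "b' (m + 1) = iM1 \<cdot> b (m + 1)" using b'_eq[of "m + 1"] m xn by simp
  have bm: "hom (b (m + 1)) (B (m + 1)) (B n)" using b_hom[of "m + 1"] m by simp
  have ib: "hom (iM1 \<cdot> b (m + 1)) (B (m + 1)) M" using bm q by blast
  have "nxm dp1 m \<cdot> dd m \<cdot> di1 m = sg m (sg n (a n))"
    using c[OF i(1) q(4)] E(1) comp_sgn_right[OF phn q(4)] y'_ph_u un y'n np by simp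
  also have "\<dots> = sg (m + n) (a n)" by (rule sgn_sgn[OF an_hom])
  also have "\<dots> = a n" using m by (auto simp: sgnm_def)
  finally show "nxm dp1 m \<cdot> dd m \<cdot> di1 m = a n" .
  show "nxm dp2 m \<cdot> dd m \<cdot> di1 m = sg m (\<ominus> phi n)"
    using c[OF i(1) q(3)] E(1) comp_sgn_right[OF phn q(3)] y_ph_u[OF mI(2)] un yn np by simp
  show "nxm dp1 m \<cdot> dd m \<cdot> di2 m = zero (B (m + 1)) (SO (A 1))"
    using c[OF i(2) q(4)] E(2) b' comp_neg_right[OF ib q(4)] comp_assoc[OF bm q(1,4)] q(8)
      comp_zero_left[OF bm Ob123(8)] neg_zero[OF homD(1)[OF bm] Ob123(8)] np by simp
  show "nxm dp2 m \<cdot> dd m \<cdot> di2 m = \<ominus> b (m + 1)"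
    using c[OF i(2) q(3)] E(2) b' comp_neg_right[OF ib q(3)] comp_assoc[OF bm q(1,3)] q(5) ide_left[OF bm] np by simp
qed

text \<open>Up to the identification of degree n - 1 with \<open>M\<close> the map is
  \<open>psi\<close> alone. On \<Sigma>(A 1) it is \<Sigma> of the first column [a 1; f1] of
  \<open>a' 1\<close>; on \<open>B n\<close> it is b n with the sign left over in
  \<open>psi_iM1\<close>.\<close>

lemma entries_pen:
  assumes m: "m = n - 1"
  shows "nxm dp1 m \<cdot> dd m \<cdot> di1 m = SM (a 1)" "nxm dp1 m \<cdot> dd m \<cdot> di2 m = zero (B n) (SO (A 2))"
    "nxm dp2 m \<cdot> dd m \<cdot> di1 m = SM f1" "nxm dp2 m \<cdot> dd m \<cdot> di2 m = sg n (b n)"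
proof -
  have em: "2 \<le> m" "m < n" "Suc m = n" "m - 1 = n - 2" using m n3 by simp_all
  have tg: "d_tags n (m - 1) ! 0 = 1" "d_tags n m ! 0 = 2" "0 < length (d_tags n m)" "0 < length (d_tags n (m - 1))"
    using tags_pen tags_last unfolding em(4) unfolding m by simp_all
  have e: "2 * (m - 1) - 1 = 2 * n - 5" using em by simp
  have "lproj C (Dl n) 0 \<cdot> dd m \<cdot> linj C (Dl m) 0 = psi"
    using D_entry[OF em(1,2) tg(3,4)] unfolding tg d_entry_def e em(3) by simp
  moreover have dm: "hom (dd m) (DX m) (SO K)"
    using D_hom[of m] em DX[of n] n3 unfolding Dl_last by (simp add: nx_def)
  note J = J_hom[folded m]
  ultimately have E: "dd m \<cdot> linj C (Dl m) 0 = psi"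
    unfolding Dl_last using ide_left[OF hom_comp[OF J dm]] by simp
  have np: "nxm dp1 m = SM pK1" "nxm dp2 m = SM pK2"
    "di1 m = linj C (Dl m) 0 \<cdot> iM2" "di2 m = linj C (Dl m) 0 \<cdot> iM1"
    using em n3 pen_maps(1,2) m by (simp_all add: nxm_def dp1_def dp2_def)
  note q = bpD[OF bpM] and k = bpD[OF bpK] and S = bpD[OF bp_SM[OF bpK]] and p = bpD[OF bpP]
  have di: "dd m \<cdot> di1 m = psi \<cdot> iM2" "dd m \<cdot> di2 m = psi \<cdot> iM1"
    unfolding np using comp_assoc[OF q(2) J dm] comp_assoc[OF q(1) J dm] E by simp_all
  note pq = bpD(3)[OF bpQ]
  have qa: "hom (pQ1 \<cdot> a' 1) P K" using pq a'1_hom by blast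
  have r: "pK \<cdot> (pQ1 \<cdot> a' 1) \<cdot> iP1 = ((pK \<cdot> pQ1) \<cdot> a' 1) \<cdot> iP1" if "hom pK K X" for pK X
    using comp_assoc[OF p(1) qa that] comp_assoc[OF a'1_hom pq that] by simp
  have "(pK1 \<cdot> pQ1) \<cdot> a' 1 = a 1 \<cdot> pP1"
    using mor_eq_lt[OF v_mor, of 1] n3 by (simp add: v_def)
  then have "pK1 \<cdot> (pQ1 \<cdot> a' 1) \<cdot> iP1 = a 1"
    using r[OF k(3)] comp_assoc[OF p(1,3) a1] p(5) ide_right[OF a1] by simp
  then show "nxm dp1 m \<cdot> dd m \<cdot> di1 m = SM (a 1)"
    using di np psi_iM2 SM_comp[OF hom_comp[OF p(1) qa] k(3)] by simp
  have "pK2 \<cdot> (pQ1 \<cdot> a' 1) \<cdot> iP1 = f1"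
    using r[OF k(4)] a'1_proj comp_add_left[OF p(1) hom_comp[OF p(3) f1] p(4)] comp_assoc[OF p(1,3) f1] p(5,8)
      ide_right[OF f1] add_zero_right[OF f1] by simp
  then show "nxm dp2 m \<cdot> dd m \<cdot> di1 m = SM f1"
    using di np psi_iM2 SM_comp[OF hom_comp[OF p(1) qa] k(4)] by simp
  note kb = hom_comp[OF bn_hom S(2)]
  have OO: "SO (A 2) \<in> Ob C" "SO (B 1) \<in> Ob C" using SO_Ob Ob123 by blast+
  show "nxm dp1 m \<cdot> dd m \<cdot> di2 m = zero (B n) (SO (A 2))"
    using di np psi_iM1 comp_sgn_right[OF kb S(3)] comp_assoc[OF bn_hom S(2,3)] S(7) comp_zero_left[OF bn_hom OO(1)]
      sgn_zero[OF Ob123(7) OO(1)] by simp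
  show "nxm dp2 m \<cdot> dd m \<cdot> di2 m = sg n (b n)"
    using di np psi_iM1 comp_sgn_right[OF kb S(4)] comp_assoc[OF bn_hom S(2,4)] S(6) ide_left[OF bn_hom] by simp
qed

text \<open>The last map of D is \<Sigma>(a' 2) after (-1)^n \<Sigma>t. As \<open>t\<close> is the
  graph of -h, its \<open>B 2\<close>-component is -h = [f2, -b 1], which supplies the second row;
  the first row uses that \<open>pQ1\<close> splits \<open>t\<close>.\<close>

lemma entries_last:
  shows "nxm dp1 n \<cdot> dd n \<cdot> di1 n = sg n (SM (a 2))" "nxm dp1 n \<cdot> dd n \<cdot> di2 n = zero (SO (B 1)) (SO (A 3))"
    "nxm dp2 n \<cdot> dd n \<cdot> di1 n = sg n (SM f2)" "nxm dp2 n \<cdot> dd n \<cdot> di2 n = sg n (\<ominus> SM (b 1))"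
proof -
  note q = bpD[OF bpQ] and q' = bpD[OF bpQ'] and k = bpD[OF bpK] and l = bpD[OF bpL]
  have np: "nxm dp1 n = SM pL1" "nxm dp2 n = SM pL2" "di1 n = SM iK1" "di2 n = SM iK2"
    using n3 by (simp_all add: nxm_def dp1_def dp2_def di1_def di2_def)
  have dn: "dd n = SM (a' 2) \<cdot> sg n (SM t)" using n3 cn by (simp add: D_seq_def)
  have E: "SM p \<cdot> dd n \<cdot> SM i = sg n (SM ((p \<cdot> a' 2) \<cdot> t \<cdot> i))" if i: "hom i X K" and p: "hom p L Y" for i p X Y
  proof -
    note hs = hom_SM[OF i] hom_SM[OF q'(1)] hom_SM[OF a'2_hom] hom_SM[OF p]
    have "dd n \<cdot> SM i = sg n (SM (a' 2) \<cdot> SM t \<cdot> SM i)"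
      using dn comp_sgn_right[OF hs(2,3)] comp_sgn_left[OF hs(1) hom_comp[OF hs(2,3)]] comp_assoc[OF hs(1-3)] by simp
    then have "SM p \<cdot> dd n \<cdot> SM i = sg n (SM p \<cdot> SM (a' 2) \<cdot> SM t \<cdot> SM i)"
      using comp_sgn_right[OF hom_comp[OF hom_comp[OF hs(1,2)] hs(3)] hs(4)] by simp
    also have "SM p \<cdot> SM (a' 2) \<cdot> SM t \<cdot> SM i = SM (p \<cdot> a' 2 \<cdot> t \<cdot> i)"
      using SM_comp[OF i q'(1)] SM_comp[OF hom_comp[OF i q'(1)] a'2_hom]
        SM_comp[OF hom_comp[OF hom_comp[OF i q'(1)] a'2_hom] p] by simp
    finally show ?thesis using comp_assoc[OF hom_comp[OF i q'(1)] a'2_hom p] by simp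
  qed
  have a2: "hom (a 2) (A 2) (A 3)" using a_hom[of 2] n3 by simp
  have va: "pL1 \<cdot> a' 2 = a 2 \<cdot> pK1 \<cdot> pQ1"
    using mor_eq_lt[OF v_mor, of 2] n3 by (simp add: v_def)
  have pt: "(a 2 \<cdot> pK1 \<cdot> pQ1) \<cdot> t \<cdot> i = a 2 \<cdot> pK1 \<cdot> i" if i: "hom i X K" for i X
    using comp_assoc[OF q(3) k(3) a2] comp_cancel_mid[OF i q'(1,3,5) hom_comp[OF k(3) a2]] comp_assoc[OF i k(3) a2] by simp
  have iqh: "hom (iQ2 \<cdot> h) K Q" using h_hom q by blast
  have "pQ2 \<cdot> t = \<ominus> h"
    using comp_add_right[OF q(1) hom_neg[OF iqh] q(4)] comp_neg_right[OF iqh q(4)] comp_assoc[OF h_hom q(2,4)] q(6,8)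
      ide_left[OF h_hom] add_zero_left[OF hom_neg[OF h_hom]] by simp
  then have qt: "pQ2 \<cdot> t \<cdot> i = \<ominus> (h \<cdot> i)" if i: "hom i X K" for i X
    using comp_assoc[OF i q'(1) q(4)] comp_neg_left[OF i h_hom] by simp
  show "nxm dp1 n \<cdot> dd n \<cdot> di1 n = sg n (SM (a 2))"
    unfolding np E[OF k(1) l(3)] va pt[OF k(1)] k(5) ide_right[OF a2] ..
  have OO: "SO (A 3) \<in> Ob C" "SO (B 1) \<in> Ob C" using SO_Ob Ob123 by blast+
  show "nxm dp1 n \<cdot> dd n \<cdot> di2 n = zero (SO (B 1)) (SO (A 3))"
    unfolding np E[OF k(2) l(3)] va pt[OF k(2)] k(7) comp_zero_right[OF a2 Ob123(4)] SM_zero[OF Ob123(4,3)]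
    by (rule sgn_zero[OF OO(2,1)])
  show "nxm dp2 n \<cdot> dd n \<cdot> di1 n = sg n (SM f2)"
    unfolding np E[OF k(1) l(4)] pL2_a'2 qt[OF k(1)] h_iK neg_neg[OF f2] ..
  show "nxm dp2 n \<cdot> dd n \<cdot> di2 n = sg n (\<ominus> SM (b 1))"
    unfolding np E[OF k(2) l(4)] pL2_a'2 qt[OF k(2)] h_iK SM_neg[OF b1] ..
qed


section \<open>Entries of the mapping cone and of its rotation\<close>

abbreviation "cl m \<equiv> cone_list SO n (A, a) (B, b) m"
abbreviation "CX m \<equiv> lsum C (cl m)"
abbreviation "cd \<equiv> snd (mapping_cone C SO SM n (A, a) (B, b) phi)"
abbreviation "Cj s m \<equiv> linj C (cl m) s"
abbreviation "Cq r m \<equiv> lproj C (cl m) r"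

lemma cone_eq: "mapping_cone C SO SM n (A, a) (B, b) phi = (\<lambda>m. CX m, cd)"
  by (simp add: mapping_cone_def)

lemma cl_eq: "m \<in> I \<Longrightarrow> cl m = [nx A m, B m]"
  by (auto simp: cone_list_def nx_def)

lemma nxA_Ob: "m \<in> I \<Longrightarrow> nx A m \<in> Ob C"
  using nx_Ob ObA by blast

lemma cl_Ob: "m \<in> I \<Longrightarrow> set (cl m) \<subseteq> Ob C"
  using nxA_Ob ObB by (simp add: cl_eq)

lemma bp_CX: "m \<in> I \<Longrightarrow> bp (nx A m) (B m) (CX m) (Cj 0 m) (Cj 1 m) (Cq 0 m) (Cq 1 m)"
  using bp_lsum2[OF nxA_Ob ObB] cl_eq by metis

text \<open>Entries of the cone maps in all degrees at once: in degree n the shifted families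
  \<open>nxm a\<close> and \<open>nxm phi\<close> become \<Sigma>(a 1) and \<Sigma>(phi 1).\<close>

definition cm where "cm m r s = (if r = 0 \<and> s = 0 then \<ominus> nxm a m else if r = 0 \<and> s = 1 then zero (B m) (nx (nx A) m)
  else if s = 0 then nxm phi m else b m)" for m and r s :: nat

lemma nxa_hom: "m \<in> I \<Longrightarrow> hom (nxm a m) (nx A m) (nx (nx A) m)"
  using hom_nx[of a A "nx A"] hA by blast

lemma cm_hom:
  assumes m: "m \<in> I" and "r < 2" "s < 2"
  shows "hom (cm m r s) ([nx A m, B m] ! s) ([nx (nx A) m, nx B m] ! r)"
proof -
  have "hom (nxm phi m) (nx A m) (nx B m)" using hom_nx[of phi A B m] phi_hom m by blast
  moreover have "hom (zero (B m) (nx (nx A) m)) (B m) (nx (nx A) m)"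
    using hom_zero[OF ObB[OF m] homD(2)[OF nxa_hom[OF m]]] .
  ultimately show ?thesis
    using hom_neg[OF nxa_hom[OF m]] hB[rule_format, OF m] assms(2,3) by (auto simp: cm_def less_2_cases_iff)
qed

lemma cone:
  assumes m: "m \<in> I"
  shows cone_hom: "hom (cd m) (CX m) (nx CX m)"
    and cone_entry: "r < 2 \<Longrightarrow> s < 2 \<Longrightarrow> nxm (Cq r) m \<cdot> cd m \<cdot> Cj s m = cm m r s"
proof -
  have "hom (cd m) (CX m) (nx CX m) \<and> (r < 2 \<longrightarrow> s < 2 \<longrightarrow> nxm (Cq r) m \<cdot> cd m \<cdot> Cj s m = cm m r s)" for r s
  proof (cases "m < n")
    case True
    then have Sm: "Suc m \<in> I" by simp
    have cs: "cl (Suc m) = [nx (nx A) m, nx B m]" using cl_eq[OF Sm] True by (simp add: nx_def)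
    have h: "hom (cm m r s) (cl m ! s) (cl (Suc m) ! r)" if "r < length (cl (Suc m))" "s < length (cl m)" for r s
      using cm_hom[OF m, of r s] that unfolding cs cl_eq[OF m] by simp
    have cd: "cd m = mat C (cl m) (cl (Suc m)) (cm m)"
      using True by (simp add: mapping_cone_def)
        (intro arg_cong[where f = "mat C (cl m) (cl (Suc m))"] ext, simp add: cm_def nxm_def cs)
    have "hom (cd m) (CX m) (nx CX m)"
      using hom_mat[OF cl_Ob[OF m] cl_Ob[OF Sm] h] cd True by (simp add: nx_def)
    moreover have "lproj C (cl (Suc m)) r \<cdot> cd m \<cdot> Cj s m = cm m r s" if "r < 2" "s < 2"
      unfolding cd by (rule mat_entry[OF cl_Ob[OF m] cl_Ob[OF Sm] h]) (use that cs cl_eq[OF m] in simp_all)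
    ultimately show ?thesis using True by (simp add: nxm_def)
  next
    case False
    then have mn: "m = n" using m by simp
    have m1: "1 \<in> I" using n3 by simp
    have c1: "cl 1 = [A 2, B 1]" using cl_eq[OF m1] n3 by (simp add: nx_def eval_nat_numeral)
    have e: "nx (nx A) n = SO (A 2)" "nx B n = SO (B 1)" using n3 by (simp_all add: nx_def eval_nat_numeral)
    have h: "hom (cm n r s) (cl n ! s) (SO (cl 1 ! r))" if "r < length (cl 1)" "s < length (cl n)" for r s
      using cm_hom[OF m, of r s] that unfolding c1 cl_eq[OF m] mn cl_eq[OF m[unfolded mn]] e
      by (auto simp: less_2_cases_iff less_Suc_eq)
    have cd: "cd n = matS C SO SM (cl n) (cl 1) (cm n)"
      unfolding c1 by (simp add: mapping_cone_def)
        (intro arg_cong[where f = "matS C SO SM (cl n) [A 2, B 1]", unfolded One_nat_def] ext, simp add: cm_def nxm_def e)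
    have "hom (cd n) (CX n) (nx CX n)"
      using hom_matS[OF cl_Ob[OF m[unfolded mn]] cl_Ob[OF m1] h] cd by (simp add: nx_def)
    moreover have "SM (lproj C (cl 1) r) \<cdot> cd n \<cdot> Cj s n = cm n r s" if "r < 2" "s < 2"
      unfolding cd by (rule matS_entry[OF cl_Ob[OF m[unfolded mn]] cl_Ob[OF m1] h])
        (use that c1 cl_eq[OF m[unfolded mn]] in simp_all)
    ultimately show ?thesis using mn by (simp add: nxm_def)
  qed
  then show "hom (cd m) (CX m) (nx CX m)" "r < 2 \<Longrightarrow> s < 2 \<Longrightarrow> nxm (Cq r) m \<cdot> cd m \<cdot> Cj s m = cm m r s"
    by blast+
qed

definition rc where "rc m = (if m < n then cd (Suc m) else sg n (SM (cd 1)))"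

lemma rotl_cone: "rotl C SO SM n (mapping_cone C SO SM n (A, a) (B, b) phi) = (nx CX, rc)"
  by (subst cone_eq) (simp add: rotl_def nx_def[abs_def] rc_def[abs_def])

lemma nx_nx: "m < n \<Longrightarrow> nx (nx X) m = nx X (Suc m)" "m < n \<Longrightarrow> nxm (nxm f) m = nxm f (Suc m)"
  "nx (nx X) n = SO (nx X 1)" "nxm (nxm f) n = SM (nxm f 1)"
  by (simp_all add: nx_def nxm_def)

text \<open>Below degree n rotation merely shifts the entries. In degree n it applies \<Sigma> and
  the sign (-1)^n to the first map, and both operations pass to the individual entries.\<close>

lemma rc:
  assumes m: "m \<in> I"
  shows rc_hom: "hom (rc m) (nx CX m) (nx (nx CX) m)"
    and rc_entry: "r < 2 \<Longrightarrow> s < 2 \<Longrightarrow> nxm (nxm (Cq r)) m \<cdot> rc m \<cdot> nxm (Cj s) m =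
      (if m < n then cm (Suc m) r s else sg n (SM (cm 1 r s)))"
proof -
  have "hom (rc m) (nx CX m) (nx (nx CX) m) \<and> (r < 2 \<longrightarrow> s < 2 \<longrightarrow> nxm (nxm (Cq r)) m \<cdot> rc m \<cdot> nxm (Cj s) m =
      (if m < n then cm (Suc m) r s else sg n (SM (cm 1 r s))))" for r s
  proof (cases "m < n")
    case True
    then have Sm: "Suc m \<in> I" by simp
    show ?thesis using cone_hom[OF Sm] cone_entry[OF Sm, of r s] True
      unfolding nx_nx(1,2)[OF True] by (simp add: rc_def nx_def[of _ m] nxm_def[of _ m])
  next
    case False
    then have mn: "m = n" using m by simp
    have m1: "1 \<in> I" using n3 by simp
    note h = cone_hom[OF m1]
    have rn: "rc n = sg n (SM (cd 1))" by (simp add: rc_def)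
    have "hom (rc n) (SO (CX 1)) (SO (nx CX 1))" unfolding rn using hom_sgn[OF hom_SM[OF h]] .
    moreover have "SM (nxm (Cq r) 1) \<cdot> rc n \<cdot> SM (Cj s 1) = sg n (SM (cm 1 r s))" if rs: "r < 2" "s < 2"
    proof -
      have "\<forall>m\<in>I. bp (nx A m) (B m) (CX m) (Cj 0 m) (Cj 1 m) (Cq 0 m) (Cq 1 m)" using bp_CX by blast
      note bp1 = bp_nx[OF this m1]
      have "\<exists>X. hom (Cj s 1) X (CX 1)" "\<exists>Y. hom (nxm (Cq r) 1) (nx CX 1) Y"
        using bpD(1,2)[OF bp_CX[OF m1]] bpD(3,4)[OF bp1] rs by (auto simp: less_2_cases_iff)
      then obtain X Y where j: "hom (Cj s 1) X (CX 1)" and q: "hom (nxm (Cq r) 1) (nx CX 1) Y" by blast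
      note S = hom_SM[OF j] hom_SM[OF h] hom_SM[OF q]
      show ?thesis
        using rn comp_sgn_left[OF S(1,2)] comp_sgn_right[OF hom_comp[OF S(1,2)] S(3)] SM_comp[OF j h]
          SM_comp[OF hom_comp[OF j h] q] cone_entry[OF m1 rs] by simp
    qed
    ultimately show ?thesis unfolding mn nx_nx by (simp add: nx_def[of _ n] nxm_def[of _ n])
  qed
  then show "hom (rc m) (nx CX m) (nx (nx CX) m)" "r < 2 \<Longrightarrow> s < 2 \<Longrightarrow> nxm (nxm (Cq r)) m \<cdot> rc m \<cdot> nxm (Cj s) m =
      (if m < n then cm (Suc m) r s else sg n (SM (cm 1 r s)))"
    by blast+
qed

text \<open>Signs by which the two families of summands of \<open>D\<close> have to be rescaled
  to match the rotated mapping cone.\<close>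
definition s1 :: "nat \<Rightarrow> nat" where "s1 m = (if m = 1 then 0 else if m + 2 \<le> n then 1 else if m < n then 0 else 1)"
definition s2 :: "nat \<Rightarrow> nat" where "s2 m = (if m = 1 then 1 else if m < n then m - 1 else 0)"
definition ns :: "(nat \<Rightarrow> nat) \<Rightarrow> nat \<Rightarrow> nat" where "ns s m = (if m < n then s (Suc m) else s 1)"

lemma nxm_sgn:
  assumes "\<forall>m\<in>I. hom (f m) (X m) (Y m)" "m \<in> I"
  shows "nxm (\<lambda>m. sg (s m) (f m)) m = sg (ns s m) (nxm f m)"
  using SM_neg[OF assms(1)[rule_format, of 1]] n3 by (simp add: nxm_def ns_def sgnm_def)

lemma sgn_entry:
  assumes "hom i X Y" "hom d Y Y'" "hom p Y' X'"
  shows "sg e p \<cdot> d \<cdot> sg e' i = sg (e + e') (p \<cdot> d \<cdot> i)"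
  using comp_sgn_right[OF assms(1,2)] comp_sgn_left[OF hom_sgn[OF hom_comp[OF assms(1,2)]] assms(3)]
    comp_sgn_right[OF hom_comp[OF assms(1,2)] assms(3)] sgn_sgn[OF hom_comp[OF hom_comp[OF assms(1,2)] assms(3)]]
  by simp

text \<open>In the middle range the entry -a (m + 2) already agrees with the cone, so
  \<open>s1\<close> is constant there. The entry -b (m + 1) has the wrong sign, so \<open>s2\<close>
  has to alternate, the exponent m + (m - 1) being odd; this alternation also cancels the (-1)^m in
  front of \<open>phi\<close>. The values at the two ends are adjusted to the boundary
  entries.\<close>

lemma entries_match:
  assumes m: "m \<in> I"
  shows "sg (ns s1 m + s1 m) (nxm dp1 m \<cdot> dd m \<cdot> di1 m) = (if m < n then cm (Suc m) 0 0 else sg n (SM (cm 1 0 0)))"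
    "sg (ns s1 m + s2 m) (nxm dp1 m \<cdot> dd m \<cdot> di2 m) = (if m < n then cm (Suc m) 0 1 else sg n (SM (cm 1 0 1)))"
    "sg (ns s2 m + s1 m) (nxm dp2 m \<cdot> dd m \<cdot> di1 m) = (if m < n then cm (Suc m) 1 0 else sg n (SM (cm 1 1 0)))"
    "sg (ns s2 m + s2 m) (nxm dp2 m \<cdot> dd m \<cdot> di2 m) = (if m < n then cm (Suc m) 1 1 else sg n (SM (cm 1 1 1)))"
proof -
  have Ob3: "A 3 \<in> Ob C" "SO (A 3) \<in> Ob C" "SO (B 1) \<in> Ob C" "SO (A 2) \<in> Ob C" using Ob123 SO_Ob by blast+
  \<comment> \<open>For n = 3 degree 1 is also the one just before the penultimate degree, so it
    needs its own case.\<close>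
  consider "m = 1" "4 \<le> n" | "m = 1" "n = 3" | "2 \<le> m" "m + 3 \<le> n" | "2 \<le> m" "m + 2 = n"
    | "2 \<le> m" "m = n - 1" | "m = n" using m n3 by fastforce
  then have "sg (ns s1 m + s1 m) (nxm dp1 m \<cdot> dd m \<cdot> di1 m) = (if m < n then cm (Suc m) 0 0 else sg n (SM (cm 1 0 0))) \<and>
    sg (ns s1 m + s2 m) (nxm dp1 m \<cdot> dd m \<cdot> di2 m) = (if m < n then cm (Suc m) 0 1 else sg n (SM (cm 1 0 1))) \<and>
    sg (ns s2 m + s1 m) (nxm dp2 m \<cdot> dd m \<cdot> di1 m) = (if m < n then cm (Suc m) 1 0 else sg n (SM (cm 1 1 0))) \<and>
    sg (ns s2 m + s2 m) (nxm dp2 m \<cdot> dd m \<cdot> di2 m) = (if m < n then cm (Suc m) 1 1 else sg n (SM (cm 1 1 1)))"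
  proof cases
    case 1
    have s: "ns s1 m = 1" "s1 m = 0" "ns s2 m = 1" "s2 m = 1" "m < n"
      using 1 by (simp_all add: ns_def s1_def s2_def)
    have c: "cm (Suc m) 0 0 = \<ominus> a 3" "cm (Suc m) 0 1 = zero (B 2) (A 4)" "cm (Suc m) 1 0 = phi 3" "cm (Suc m) 1 1 = b 2"
      using 1 by (simp_all add: cm_def nxm_def nx_def eval_nat_numeral)
    have "A 4 \<in> Ob C" using ObA[of 4] 1 by simp
    then show ?thesis
      using entries_1_ge4[OF 1(2)] neg_zero[OF Ob123(5)] neg_neg[OF phi_hom[of 3]] 1(2) c s
      unfolding 1(1) by (simp add: sgnm_def)
  next
    case 2
    have n': "\<not> 3 < n" "2 < n" "1 < n" "\<not> 4 \<le> n" "odd n" using 2(2) by simp_all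
    have s: "ns s1 m = 0" "s1 m = 0" "ns s2 m = 1" "s2 m = 1" "m < n"
      unfolding 2(1) using n' by (simp_all add: ns_def s1_def s2_def)
    have c: "cm (Suc m) 0 0 = \<ominus> a 3" "cm (Suc m) 0 1 = zero (B 2) (SO (A 1))" "cm (Suc m) 1 0 = phi 3" "cm (Suc m) 1 1 = b 2"
      unfolding 2(1) using n' by (simp_all add: cm_def nxm_def nx_def eval_nat_numeral)
    have 3: "3 \<in> I" using n3 by simp
    show ?thesis
      using entries_1_eq3[OF 2(2)] neg_zero[OF Ob123(5,8)] neg_neg[OF phi_hom[OF 3]] c s n'(5)
      unfolding 2(1) by (simp add: sgnm_def)
  next
    case 3
    have s: "ns s1 m = 1" "s1 m = 1" "ns s2 m = m" "s2 m = m - 1" "m < n"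
      using 3 by (simp_all add: ns_def s1_def s2_def)
    have c: "cm (Suc m) 0 0 = \<ominus> a (m + 2)" "cm (Suc m) 0 1 = zero (B (m + 1)) (A (m + 3))"
      "cm (Suc m) 1 0 = phi (m + 2)" "cm (Suc m) 1 1 = b (m + 1)"
      using 3 by (simp_all add: cm_def nxm_def nx_def eval_nat_numeral)
    have O: "B (m + 1) \<in> Ob C" "A (m + 3) \<in> Ob C" using ObA ObB 3 by simp_all
    have nn: "\<ominus> (\<ominus> phi (m + 2)) = phi (m + 2)" "\<ominus> (\<ominus> b (m + 1)) = b (m + 1)"
      using neg_neg[OF phi_hom[of "m + 2"]] neg_neg[OF b_hom[of "m + 1"]] 3 by simp_all
    have "odd (m + (m - 1))" using 3 by auto
    then show ?thesis
      using entries_mid[OF 3] neg_zero[OF O] nn c s by (auto simp: sgnm_def)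
  next
    case 4
    have s: "ns s1 m = 0" "s1 m = 1" "ns s2 m = m" "s2 m = m - 1" "m < n"
      using 4 by (simp_all add: ns_def s1_def s2_def)
    have c: "cm (Suc m) 0 0 = \<ominus> a n" "cm (Suc m) 0 1 = zero (B (m + 1)) (SO (A 1))"
      "cm (Suc m) 1 0 = phi n" "cm (Suc m) 1 1 = b (m + 1)"
      using 4 by (auto simp: cm_def nxm_def nx_def)
    have O: "B (m + 1) \<in> Ob C" using ObB 4 by simp
    have nn: "\<ominus> (\<ominus> phi n) = phi n" "\<ominus> (\<ominus> b (m + 1)) = b (m + 1)"
      using neg_neg[OF phi_hom[of n]] neg_neg[OF b_hom[of "m + 1"]] 4 by simp_all
    have "odd (m + (m - 1))" using 4 by auto
    then show ?thesis
      using entries_pre[OF 4] neg_zero[OF O Ob123(8)] nn c s by (auto simp: sgnm_def)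
  next
    case 5
    have s: "ns s1 m = 1" "s1 m = 0" "ns s2 m = 0" "s2 m = n - 2" "m < n" "Suc m = n"
      using 5 n3 by (simp_all add: ns_def s1_def s2_def)
    have c: "cm n 0 0 = \<ominus> SM (a 1)" "cm n 0 1 = zero (B n) (SO (A 2))"
      "cm n 1 0 = SM f1" "cm n 1 1 = b n"
      using n3 phi1 by (simp_all add: cm_def nxm_def nx_def eval_nat_numeral)
    have "even n = even (n - 2)" using n3 by simp
    then show ?thesis
      using entries_pen[OF 5(2)] neg_zero[OF Ob123(7) Ob3(4)] c s neg_neg[OF bn_hom] unfolding s(6)
      by (auto simp: sgnm_def)
  next
    case 6
    have s: "ns s1 n = 0" "s1 n = 1" "ns s2 n = 1" "s2 n = 0"
      using n3 by (simp_all add: ns_def s1_def s2_def)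
    have a2: "hom (a 2) (A 2) (A 3)" using a_hom[of 2] n3 by simp
    have c: "cm 1 0 0 = \<ominus> a 2" "cm 1 0 1 = zero (B 1) (A 3)" "cm 1 1 0 = f2" "cm 1 1 1 = b 1"
      using n3 phi2 by (simp_all add: cm_def nxm_def nx_def eval_nat_numeral)
    show ?thesis
      using entries_last c s neg_zero[OF Ob3(3,2)] SM_zero[OF Ob123(4,3)] SM_neg[OF a2]
        neg_neg[OF hom_SM[OF a2]] neg_neg[OF hom_SM[OF f2]] neg_neg[OF hom_SM[OF b1]] unfolding 6
      by (auto simp: sgnm_def)
  qed
  then show "sg (ns s1 m + s1 m) (nxm dp1 m \<cdot> dd m \<cdot> di1 m) = (if m < n then cm (Suc m) 0 0 else sg n (SM (cm 1 0 0)))"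
    "sg (ns s1 m + s2 m) (nxm dp1 m \<cdot> dd m \<cdot> di2 m) = (if m < n then cm (Suc m) 0 1 else sg n (SM (cm 1 0 1)))"
    "sg (ns s2 m + s1 m) (nxm dp2 m \<cdot> dd m \<cdot> di1 m) = (if m < n then cm (Suc m) 1 0 else sg n (SM (cm 1 1 0)))"
    "sg (ns s2 m + s2 m) (nxm dp2 m \<cdot> dd m \<cdot> di2 m) = (if m < n then cm (Suc m) 1 1 else sg n (SM (cm 1 1 1)))"
    by simp_all
qed

text \<open>Relative to the rescaled decompositions D and the rotated cone have equal entries, so
  \<open>entries_in_N\<close> applies; N2 then undoes the rotation.\<close>

lemma cone_in_N: "mapping_cone C SO SM n (A, a) (B, b) phi \<in> N"
proof -
  have bD: "\<forall>m\<in>I. bp (nx (nx A) m) (nx B m) (DX m) (di1 m) (di2 m) (dp1 m) (dp2 m)"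
    using bp_DX by blast
  have bDs: "\<forall>m\<in>I. bp (nx (nx A) m) (nx B m) (DX m) (sg (s1 m) (di1 m)) (sg (s2 m) (di2 m))
      (sg (s1 m) (dp1 m)) (sg (s2 m) (dp2 m))"
    using bp_DX bp_sgn by blast
  have bR: "\<forall>m\<in>I. bp (nx (nx A) m) (nx B m) (nx CX m) (nxm (Cj 0) m) (nxm (Cj 1) m) (nxm (Cq 0) m) (nxm (Cq 1) m)"
    using bp_nx[of "nx A" B CX "Cj 0" "Cj 1" "Cq 0" "Cq 1"] bp_CX by blast
  have hp: "\<forall>m\<in>I. hom (dp1 m) (DX m) (nx (nx A) m)" "\<forall>m\<in>I. hom (dp2 m) (DX m) (nx B m)"
    using bD by (auto simp: bp_def)
  have rh: "\<forall>m\<in>I. hom (rc m) (nx CX m) (nx (nx CX) m)" using rc_hom by blast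
  have S: "nxm (\<lambda>m. sg (s1 m) (dp1 m)) m \<cdot> dd m \<cdot> sg e i = sg (ns s1 m + e) (nxm dp1 m \<cdot> dd m \<cdot> i)"
    "nxm (\<lambda>m. sg (s2 m) (dp2 m)) m \<cdot> dd m \<cdot> sg e i = sg (ns s2 m + e) (nxm dp2 m \<cdot> dd m \<cdot> i)"
    if m: "m \<in> I" and i: "hom i X (DX m)" for m e i X
    using sgn_entry[OF i D_hom[OF m] hom_nx[OF hp(1) m]] sgn_entry[OF i D_hom[OF m] hom_nx[OF hp(2) m]]
      nxm_sgn[OF hp(1) m] nxm_sgn[OF hp(2) m] by simp_all
  have "(DX, dd) \<in> N" using DN by simp
  then have "(nx CX, rc) \<in> N"
  proof (rule entries_in_N[OF _ rh bDs bR])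
    fix m assume m: "m \<in> I"
    note i = bpD(1,2)[OF bp_DX[OF m]]
    show "nxm (\<lambda>m. sg (s1 m) (dp1 m)) m \<cdot> dd m \<cdot> sg (s1 m) (di1 m) = nxm (nxm (Cq 0)) m \<cdot> rc m \<cdot> nxm (Cj 0) m"
      using S(1)[OF m i(1)] entries_match(1)[OF m] rc_entry[OF m, of 0 0] by simp
    show "nxm (\<lambda>m. sg (s1 m) (dp1 m)) m \<cdot> dd m \<cdot> sg (s2 m) (di2 m) = nxm (nxm (Cq 0)) m \<cdot> rc m \<cdot> nxm (Cj 1) m"
      using S(1)[OF m i(2)] entries_match(2)[OF m] rc_entry[OF m, of 0 1] by simp
    show "nxm (\<lambda>m. sg (s2 m) (dp2 m)) m \<cdot> dd m \<cdot> sg (s1 m) (di1 m) = nxm (nxm (Cq 1)) m \<cdot> rc m \<cdot> nxm (Cj 0) m"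
      using S(2)[OF m i(1)] entries_match(3)[OF m] rc_entry[OF m, of 1 0] by simp
    show "nxm (\<lambda>m. sg (s2 m) (dp2 m)) m \<cdot> dd m \<cdot> sg (s2 m) (di2 m) = nxm (nxm (Cq 1)) m \<cdot> rc m \<cdot> nxm (Cj 1) m"
      using S(2)[OF m i(2)] entries_match(4)[OF m] rc_entry[OF m, of 1 1] by simp
  qed
  then have r: "rotl C SO SM n (mapping_cone C SO SM n (A, a) (B, b) phi) \<in> N" unfolding rotl_cone .
  have "is_seq C SO n (mapping_cone C SO SM n (A, a) (B, b) phi)"
    by (subst cone_eq) (use cone_hom is_seq_iff in blast)
  then show ?thesis using N2 r unfolding N2_def by blast
qed

end

section \<open>Application of axiom N4* to the three n-angles\<close>

context square
begin

lemma completion_ex: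
  "\<exists>phi. phi 1 = f1 \<and> phi 2 = f2 \<and> seq_mor C SO SM n (A, a) (B, b) phi \<and>
    mapping_cone C SO SM n (A, a) (B, b) phi \<in> N"
proof -
  obtain a' where A': "(A', a') \<in> N" "mor A a A' a' u" "mor A' a' A a v"
    "a' 1 \<cdot> iP2 = iQ1 \<cdot> iK2" "(pK2 \<cdot> pQ1) \<cdot> a' 1 = f1 \<cdot> pP1 \<oplus> pP2"
    "a' 2 \<cdot> iQ2 = iL2" "pL2 \<cdot> a' 2 = pQ2"
    using A'_ex .
  obtain b' g where B': "(B', b') \<in> N" "mor B b B' b' x" "mor B' b' B b y" "mor G g B' b' x'" "mor B' b' G g y'"
    "(G, g) \<in> N" "g n = sg n (ide (SO (A 1)))"
    using B'_ex .
  obtain c where C': "(C', c) \<in> N" "c 1 = e2" "c n = sg n (SM t)"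
    using C'_ex .
  have obj: "B' 1 = P" "A' 1 = P" "C' 1 = Q" "A' 2 = Q" "C' 2 = B 2" "B' 2 = B 2"
    using n3 by (simp_all add: A'_def B'_def C'_def)
  note ea = e2_a'1[OF A'(1,2,4) B'(1,2,4,6)]
  have "fst (B', b') 1 = fst (A', a') 1 \<and> fst (C', c) 1 = fst (A', a') 2 \<and> fst (C', c) 2 = fst (B', b') 2 \<and>
      snd (C', c) 1 = e2 \<and> e2 \<in> Hom C (fst (A', a') 2) (fst (B', b') 2) \<and> e2 \<cdot> snd (A', a') 1 = snd (B', b') 1"
    unfolding fst_conv snd_conv obj using C'(2) ea homD(3)[OF e2_hom] by blast
  from N4s[unfolded N4star_def, rule_format, OF A'(1) B'(1) C'(1) this]
  obtain ph ps where ph: "ph 1 = ide P" "ph 2 = e2" "seq_mor C SO SM n (A', a') (B', b') ph"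
    and ps: "\<forall>k. 1 \<le> k \<and> 2 * k - 1 \<le> 2 * n - 5 \<longrightarrow> ps (2 * k - 1) \<in> Hom C (B' (k + 2)) (C' (k + 2))"
      "\<forall>k. 1 \<le> k \<and> 2 * k \<le> 2 * n - 5 \<longrightarrow> ps (2 * k) \<in> Hom C (A' (k + 3)) (C' (k + 2))"
      "c n \<cdot> ps (2 * n - 5) = SM (a' 1) \<cdot> b' n"
    and D: "D_seq C SO SM n (A', a') (B', b') (C', c) ph ps \<in> N"
    unfolding fst_conv snd_conv obj by blast
  have mor: "mor A' a' B' b' ph"
    using ph(3) seq_mor_iff[of A' B'] N_Ob[OF A'(1)] N_Ob[OF B'(1)] by blast
  interpret n4_data C SO SM n N A a B b f1 f2 a' b' g c ph ps
  proof
    fix k :: nat assume k: "1 \<le> k"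
    show "hom (ps (2 * k - 1)) (B' (k + 2)) (C' (k + 2))" if "2 * k - 1 \<le> 2 * n - 5"
    proof -
      have "k + 2 \<in> I" using k that n3 by simp
      then show ?thesis using ps(1) k that N_Ob[OF B'(1)] N_Ob[OF C'(1)] unfolding hom_def by blast
    qed
    show "hom (ps (2 * k)) (A' (k + 3)) (C' (k + 2))" if "2 * k \<le> 2 * n - 5"
    proof -
      \<comment> \<open>Parity matters: 2k is even and 2n - 5 is odd, so the bound gives k + 3 \<le>
        n.\<close>
      have "k + 2 \<in> I" "k + 3 \<in> I" using k that n3 by simp_all
      then show ?thesis using ps(2) k that N_Ob[OF A'(1)] N_Ob[OF C'(1)] unfolding hom_def by blast
    qed
  qed (fact A' B' C' ph mor ps(3) D)+
  have "seq_mor C SO SM n (A, a) (B, b) phi"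
    using phi_mor seq_mor_iff[of A B] ObA ObB by blast
  then show ?thesis using phi1 phi2 cone_in_N by blast
qed

end

theorem theorem4p3:
  fixes C :: "('o, 'm) addcat" and SO :: "'o \<Rightarrow> 'o" and SM :: "'m \<Rightarrow> 'm"
    and n :: nat and N :: "('o, 'm) nseq set"
  assumes "additive_category C"
    and "is_automorphism C SO SM"
    and "3 \<le> n"
    and "\<forall>S\<in>N. is_seq C SO n S"
    and "N1 C SO SM n N"
    and "N2 C SO SM n N"
    and "N3 C SO SM n N"
    and "N4star C SO SM n N"
  shows "N4 C SO SM n N"
  unfolding N4_def
proof (intro ballI allI impI)
  interpret n_angles C SO SM n N
    by unfold_locales (fact assms)+
  fix S T f1 f2
  assume S: "S \<in> N" and T: "T \<in> N"
    and f: "f1 \<in> Hom C (fst S 1) (fst T 1) \<and> f2 \<in> Hom C (fst S 2) (fst T 2) \<and>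
      cmp C f2 (snd S 1) = cmp C (snd T 1) f1"
  obtain A a B b where ST: "S = (A, a)" "T = (B, b)" by fastforce
  have I: "1 \<in> I" "2 \<in> I" using n3 by simp_all
  have Ob: "A 1 \<in> Ob C" "A 2 \<in> Ob C" "B 1 \<in> Ob C" "B 2 \<in> Ob C"
    using N_Ob[OF S[unfolded ST]] N_Ob[OF T[unfolded ST]] I by blast+
  interpret square C SO SM n N A a B b f1 f2
    by unfold_locales (use S T f Ob ST assms(8) in \<open>simp_all add: hom_def\<close>)
  show "\<exists>phi. phi 1 = f1 \<and> phi 2 = f2 \<and> seq_mor C SO SM n S T phi \<and> mapping_cone C SO SM n S T phi \<in> N"
    using completion_ex unfolding ST .
qed

end
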